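(* Let $R$ be a commutative Noetherian ring, $M$ a finitely generated $R$-module and $\mathfrak{a}$ an ideal of $R$. Let $t$ and $n_0$ be positive integers such that $\mathfrak{a}^{n_0}H^{i}_\mathfrak{a}(M) = 0$ for all $i<t$. Then for every $\mathfrak{a}$-filter regular sequence $x_1, \dots, x_t$ of $M$ contained in $\mathfrak{a}^{2n_0}$ we have $$\bigcup_{i=0}^j\mathrm{Ass}\, H^i_\mathfrak{a}(M) = \mathrm{Ass}\bigl(M/(x_1,\dots,x_j)M\bigr) \cap V(\mathfrak{a})$$ for all $j= 1, \ldots , t$. In particular, $H^t_\mathfrak{a}(M)$ has only finitely many associated primes.
   Context: $H^i_{\mathfrak{a}}(\cdot)$ denotes the $i$-th local cohomology functor with respect to $\mathfrak{a}$, and $V(\mathfrak{a})$ is the set of prime ideals of $R$ containing $\mathfrak{a}$. An element $x\in\mathfrak{a}$ is an $\mathfrak{a}$-filter regular element of a finitely generated module $N$ if $x\notin\mathfrak{p}$ for all $\mathfrak{p}\in \mathrm{Ass}\,N\setminus V(\mathfrak{a})$. A sequence $x_1,\dots,x_t$ of elements of $\mathfrak{a}$ is an $\mathfrak{a}$-filter regular sequence of $M$ if $x_i$ is an $\mathfrak{a}$-filter regular element of $M/(x_1,\dots,x_{i-1})M$ for each $i=1,\dots,t$. *)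

theory Defs
  imports "HOL-Algebra.Algebra"
begin

section \<open>Modules over a commutative ring\<close>

definition mod_hom ::
    "('a, 'r) ring_scheme \<Rightarrow> ('a, 'b, 'm) module_scheme \<Rightarrow> ('a, 'c, 'n) module_scheme \<Rightarrow> ('b \<Rightarrow> 'c) set"
  where "mod_hom R M N =
    {f \<in> hom (add_monoid M) (add_monoid N).
      \<forall>r\<in>carrier R. \<forall>x\<in>carrier M. f (r \<odot>\<^bsub>M\<^esub> x) = r \<odot>\<^bsub>N\<^esub> f x}"

definition gen_submodule ::
    "('a, 'r) ring_scheme \<Rightarrow> ('a, 'b, 'm) module_scheme \<Rightarrow> 'b set \<Rightarrow> 'b set"
  where "gen_submodule R M S = \<Inter>{N. submodule N R M \<and> S \<subseteq> N}"

definition fin_gen_module :: "('a, 'r) ring_scheme \<Rightarrow> ('a, 'b, 'm) module_scheme \<Rightarrow> bool"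
  where "fin_gen_module R M \<longleftrightarrow>
    module R M \<and> (\<exists>S\<subseteq>carrier M. finite S \<and> gen_submodule R M S = carrier M)"

text \<open>The submodule \<open>I M\<close>.\<close>
definition ideal_smult ::
    "('a, 'r) ring_scheme \<Rightarrow> 'a set \<Rightarrow> ('a, 'b, 'm) module_scheme \<Rightarrow> 'b set"
  where "ideal_smult R I M = gen_submodule R M {r \<odot>\<^bsub>M\<^esub> x | r x. r \<in> I \<and> x \<in> carrier M}"

text \<open>
  The quotient module \<open>M / N\<close>, on additive cosets as in \<^const>\<open>FactRing\<close>. The record type of
  modules extends that of rings; the locale \<^locale>\<open>module\<close> does not constrain the fields
  \<^const>\<open>monoid.mult\<close> and \<^const>\<open>one\<close>, so they carry no information.
\<close>
definition quot_module :: "('a, 'b, 'm) module_scheme \<Rightarrow> 'b set \<Rightarrow> ('a, 'b set) module"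
  where "quot_module M N =
    \<lparr>carrier = a_rcosets\<^bsub>M\<^esub> N, monoid.mult = (\<lambda>_ _. undefined), one = undefined,
     ring.zero = N, ring.add = set_add M,
     smult = (\<lambda>r C. \<Union>x\<in>C. N +>\<^bsub>M\<^esub> (r \<odot>\<^bsub>M\<^esub> x))\<rparr>"


section \<open>Associated primes and filter regular sequences\<close>

definition Ass :: "('a, 'r) ring_scheme \<Rightarrow> ('a, 'b, 'm) module_scheme \<Rightarrow> 'a set set"
  where "Ass R M =
    {p. primeideal p R \<and> (\<exists>x\<in>carrier M. p = {r \<in> carrier R. r \<odot>\<^bsub>M\<^esub> x = \<zero>\<^bsub>M\<^esub>})}"

definition V :: "('a, 'r) ring_scheme \<Rightarrow> 'a set \<Rightarrow> 'a set set"
  where "V R \<aa> = {p. primeideal p R \<and> \<aa> \<subseteq> p}"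

text \<open>
  Ideal powers are powers in the multiplicative monoid of ideals, so \<open>\<aa>\<close> to the power \<open>0\<close> is the
  unit ideal.
\<close>
abbreviation ideal_pow :: "('a, 'r) ring_scheme \<Rightarrow> 'a set \<Rightarrow> nat \<Rightarrow> 'a set"
  where "ideal_pow R \<aa> n \<equiv> \<aa> [^]\<^bsub>ideals_set R\<^esub> n"

definition filter_regular ::
    "('a, 'r) ring_scheme \<Rightarrow> 'a set \<Rightarrow> ('a, 'b, 'm) module_scheme \<Rightarrow> 'a \<Rightarrow> bool"
  where "filter_regular R \<aa> N x \<longleftrightarrow> x \<in> \<aa> \<and> (\<forall>p \<in> Ass R N - V R \<aa>. x \<notin> p)"

text \<open>The module \<open>M / (x\<^sub>1, \<dots>, x\<^sub>k) M\<close>.\<close>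
definition quot_by_seq ::
    "('a, 'r) ring_scheme \<Rightarrow> ('a, 'b, 'm) module_scheme \<Rightarrow> 'a list \<Rightarrow> ('a, 'b set) module"
  where "quot_by_seq R M xs = quot_module M (ideal_smult R (genideal R (set xs)) M)"

text \<open>Lists are indexed from \<open>0\<close>, so \<open>xs ! i\<close> is tested on the quotient by the \<open>i\<close> entries before it.\<close>
definition filter_regular_seq ::
    "('a, 'r) ring_scheme \<Rightarrow> 'a set \<Rightarrow> ('a, 'b, 'm) module_scheme \<Rightarrow> 'a list \<Rightarrow> bool"
  where "filter_regular_seq R \<aa> M xs \<longleftrightarrow>
    (\<forall>i<length xs. filter_regular R \<aa> (quot_by_seq R M (take i xs)) (xs ! i))"


section \<open>Local cohomology as the right derived functor of the torsion functor\<close>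

text \<open>
  A definition in HOL cannot quantify over modules of all types, so the lifting property is required
  for the test modules carried by the element type of \<open>R\<close>. These include \<open>R\<close> itself and all its ideals,
  so by Baer's criterion the lifting property follows for test modules of any type.
\<close>
definition injective_module :: "('a, 'r) ring_scheme \<Rightarrow> ('a, 'e, 'm) module_scheme \<Rightarrow> bool"
  where "injective_module R E \<longleftrightarrow> module R E \<and>
    (\<forall>(A :: ('a, 'a) module) (B :: ('a, 'a) module) f g.
      module R A \<and> module R B \<and>
      f \<in> mod_hom R A B \<and> inj_on f (carrier A) \<and> g \<in> mod_hom R A E \<longrightarrow>
      (\<exists>h\<in>mod_hom R B E. \<forall>x\<in>carrier A. h (f x) = g x))"

text \<open>Exactness of \<open>0 \<rightarrow> M \<rightarrow> E 0 \<rightarrow> E 1 \<rightarrow> \<dots>\<close> with augmentation \<open>\<epsilon>\<close>, differentials \<open>d\<close> and all \<open>E i\<close> injective.\<close>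
definition injective_resolution ::
    "('a, 'r) ring_scheme \<Rightarrow> ('a, 'b, 'm) module_scheme \<Rightarrow> ('b \<Rightarrow> 'e) \<Rightarrow>
     (nat \<Rightarrow> ('a, 'e, 'n) module_scheme) \<Rightarrow> (nat \<Rightarrow> 'e \<Rightarrow> 'e) \<Rightarrow> bool"
  where "injective_resolution R M \<epsilon> E d \<longleftrightarrow>
    module R M \<and>
    (\<forall>i. injective_module R (E i)) \<and>
    \<epsilon> \<in> mod_hom R M (E 0) \<and>
    (\<forall>i. d i \<in> mod_hom R (E i) (E (Suc i))) \<and>
    inj_on \<epsilon> (carrier M) \<and>
    \<epsilon> ` carrier M = a_kernel (E 0) (E 1) (d 0) \<and>
    (\<forall>i. d i ` carrier (E i) = a_kernel (E (Suc i)) (E (Suc (Suc i))) (d (Suc i)))"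

text \<open>
  The \<open>\<aa>\<close>-torsion functor. Homomorphisms map torsion to torsion; on morphisms the functor is
  restriction, so the underlying function is unchanged.
\<close>
definition torsion ::
    "('a, 'r) ring_scheme \<Rightarrow> 'a set \<Rightarrow> ('a, 'b, 'm) module_scheme \<Rightarrow> ('a, 'b, 'm) module_scheme"
  where "torsion R \<aa> N =
    N\<lparr>carrier := {x \<in> carrier N. \<exists>n. \<forall>r\<in>ideal_pow R \<aa> n. r \<odot>\<^bsub>N\<^esub> x = \<zero>\<^bsub>N\<^esub>}\<rparr>"

definition cohomology ::
    "(nat \<Rightarrow> ('a, 'e, 'n) module_scheme) \<Rightarrow> (nat \<Rightarrow> 'e \<Rightarrow> 'e) \<Rightarrow> nat \<Rightarrow> ('a, 'e set) module"
  where "cohomology C d i =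
    quot_module ((C i)\<lparr>carrier := a_kernel (C i) (C (Suc i)) (d i)\<rparr>)
      (case i of 0 \<Rightarrow> {\<zero>\<^bsub>C 0\<^esub>} | Suc k \<Rightarrow> d k ` carrier (C k))"

text \<open>
  If \<open>E\<close>, \<open>d\<close> form an injective resolution of \<open>M\<close>, this is the \<open>i\<close>-th local cohomology module
  of \<open>M\<close> with respect to \<open>\<aa>\<close>, which does not depend on the resolution up to isomorphism.
\<close>
definition local_cohomology ::
    "('a, 'r) ring_scheme \<Rightarrow> 'a set \<Rightarrow> (nat \<Rightarrow> ('a, 'e, 'n) module_scheme) \<Rightarrow>
     (nat \<Rightarrow> 'e \<Rightarrow> 'e) \<Rightarrow> nat \<Rightarrow> ('a, 'e set) module"
  where "local_cohomology R \<aa> E d i = cohomology (\<lambda>k. torsion R \<aa> (E k)) d i"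

end

theory Submission
  imports Defs
begin

text \<open>
  The cohomology of all the modules \<open>M / (x\<^sub>1, \<dots>, x\<^sub>j) M\<close> can be read off from the given resolution
  \<open>E\<close> of \<open>M\<close>. Let \<open>E\<^sub>0 = E\<close>, and let \<open>E\<^sub>j\<close> be the mapping cone of multiplication by \<open>x\<^sub>j\<close> on
  \<open>E\<^sub>j\<^sub>-\<^sub>1\<close>, placed so that \<open>E\<^sub>j\<close> lives in degrees \<open>\<ge> -j\<close>; this is a Koszul complex with
  coefficients in \<open>E\<close>. Write \<open>\<Gamma>\<close> for \<open>\<aa>\<close>-torsion and \<open>I\<close> for \<open>\<aa>\<close> to the power \<open>n\<^sub>0\<close>. Two
  facts about \<open>\<Gamma> E\<^sub>j\<close> give the formula.

  Splitting (\<open>splitting_lift\<close>, \<open>coh_Ass_cone\<close>, \<open>kills_cohomology_cone\<close>). The cone \<open>K\<close> of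
  multiplication by \<open>x\<close> on a complex \<open>C\<close> has a long exact cohomology sequence, and for
  \<open>x \<in> I I\<close> and \<open>I H\<^sup>i(C) = 0\<close> a part of it splits. Write \<open>x = \<Sum> a b\<close> with \<open>a, b \<in> I\<close>. If \<open>I\<close>
  kills the class of a cocycle \<open>v\<close> of degree \<open>i + 1\<close>, then \<open>b v = d w\<close> with some \<open>w\<close> for each
  \<open>b\<close>, and \<open>(- \<Sum> a w, v)\<close> is a cocycle of the cone. Another choice of a \<open>w\<close> differs by a cocycle,
  whose class is killed by \<open>a\<close>; so the class of the lift depends linearly on the class of \<open>v\<close>.
  This is where the exponent \<open>2 n\<^sub>0\<close> is needed. It follows that the primes of \<open>Ass H\<^sup>i(K)\<close> that
  contain \<open>I\<close> are those of \<open>Ass H\<^sup>i(C) \<union> Ass H\<^sup>i\<^sup>+\<^sup>1(C)\<close>, and that \<open>I H\<^sup>i(K) = 0\<close> if \<open>I\<close> also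
  kills \<open>H\<^sup>i\<^sup>+\<^sup>1(C)\<close>. Iteration shows that \<open>Ass H\<^sup>0(\<Gamma> E\<^sub>j)\<close> is the union of the
  \<open>Ass H\<^sup>i(\<Gamma> E)\<close> with \<open>i \<le> j\<close>.

  Torsion (\<open>coh_Ass_torsion_zero\<close>). The complex \<open>E\<^sub>j\<close> has \<open>H\<^sup>0 = M / (x\<^sub>1, \<dots>, x\<^sub>j) M\<close>, no
  cohomology in positive degrees and, by filter regularity, only torsion cohomology in negative
  degrees. Hence \<open>H\<^sup>0(\<Gamma> E\<^sub>j)\<close> is the torsion of \<open>M / (x\<^sub>1, \<dots>, x\<^sub>j) M\<close>, and its associated primes
  are those of \<open>M / (x\<^sub>1, \<dots>, x\<^sub>j) M\<close> that contain \<open>\<aa>\<close>. The reason is that \<open>E\<^sub>j / \<Gamma> E\<^sub>j\<close> is a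
  complex of injective torsion-free modules, bounded below. The lowest nonzero cohomology of such a
  complex is torsion-free. In negative degrees the cohomology is torsion, so it vanishes there, and
  \<open>H\<^sup>0\<close> is torsion-free; now compare \<open>\<Gamma> E\<^sub>j\<close> with \<open>E\<^sub>j\<close>. This needs two facts over a
  Noetherian ring, proved from Baer's criterion: the torsion submodule of an injective module is
  injective (\<open>baer_torsion\<close>), and so is the quotient of an injective module by an injective
  submodule (\<open>baer_quotient\<close>).

  For the finiteness, prime avoidance gives a filter regular sequence of length \<open>t\<close> inside the
  power \<open>2 n\<^sub>0\<close> of \<open>\<aa>\<close>, and a finitely generated module has finitely many associated primes.

  Subquotients \<open>Z / B\<close> are handled as pairs of submodules, so that the arguments stay with
  elements; quotient modules enter only in the translation of the statement.
\<close>

section \<open>Modules, ideals and subquotients\<close>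

lemma set_add_iff: "x \<in> H <+>\<^bsub>M\<^esub> K \<longleftrightarrow> (\<exists>h\<in>H. \<exists>k\<in>K. x = h \<oplus>\<^bsub>M\<^esub> k)"
  by (auto simp: set_add_def')

context module
begin

lemma smult_left_commute:
  "a \<in> carrier R \<Longrightarrow> b \<in> carrier R \<Longrightarrow> x \<in> carrier M \<Longrightarrow>
    a \<odot>\<^bsub>M\<^esub> (b \<odot>\<^bsub>M\<^esub> x) = b \<odot>\<^bsub>M\<^esub> (a \<odot>\<^bsub>M\<^esub> x)"
  by (simp add: smult_assoc1[symmetric] R.m_comm)

lemma minus_zero_module: "\<ominus>\<^bsub>M\<^esub> \<zero>\<^bsub>M\<^esub> = \<zero>\<^bsub>M\<^esub>"
  using M.minus_equality[of "\<zero>\<^bsub>M\<^esub>" "\<zero>\<^bsub>M\<^esub>"] by simp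

text \<open>
  Registered for \<open>algebra\<close>, whose term order makes terms that cancel adjacent; scalars are
  distributed and collected in front.
\<close>
lemmas module_simprules
  [algebra module "ring.zero M" "ring.add M" "a_inv M" "a_minus M" "smult M"] =
  M.a_closed M.zero_closed M.a_inv_closed M.minus_closed smult_closed
  R.a_closed R.zero_closed R.a_inv_closed R.minus_closed R.m_closed R.one_closed
  M.a_assoc M.l_zero M.l_neg M.a_comm M.minus_eq M.r_zero M.r_neg M.r_neg2 M.r_neg1
  M.minus_add M.minus_minus minus_zero_module M.a_lcomm
  smult_l_distr smult_r_distr smult_assoc1 smult_one smult_l_null smult_r_null
  smult_l_minus smult_r_minus smult_left_commute R.minus_eq

lemma submodule_intro:
  assumes "H \<subseteq> carrier M" "\<zero>\<^bsub>M\<^esub> \<in> H"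
    and "\<And>x y. x \<in> H \<Longrightarrow> y \<in> H \<Longrightarrow> x \<oplus>\<^bsub>M\<^esub> y \<in> H"
    and smult: "\<And>r x. r \<in> carrier R \<Longrightarrow> x \<in> H \<Longrightarrow> r \<odot>\<^bsub>M\<^esub> x \<in> H"
  shows "submodule H R M"
proof (rule submoduleI)
  fix x assume x: "x \<in> H"
  then have "\<ominus>\<^bsub>M\<^esub> x = (\<ominus> \<one>) \<odot>\<^bsub>M\<^esub> x"
    using assms(1) smult_l_minus[of \<one> x] by auto
  then show "\<ominus>\<^bsub>M\<^esub> x \<in> H" using smult[of "\<ominus> \<one>" x] x by simp
qed (use assms in auto)

lemma submodule_carrier: "submodule H R M \<Longrightarrow> x \<in> H \<Longrightarrow> x \<in> carrier M"
  using submoduleE(1) by blast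

lemma submodule_zero: "submodule H R M \<Longrightarrow> \<zero>\<^bsub>M\<^esub> \<in> H"
  using subgroup.one_closed[OF submodule.axioms(1)] by fastforce

lemma submodule_add: "submodule H R M \<Longrightarrow> x \<in> H \<Longrightarrow> y \<in> H \<Longrightarrow> x \<oplus>\<^bsub>M\<^esub> y \<in> H"
  using submoduleE(5) by blast

lemma submodule_smult: "submodule H R M \<Longrightarrow> r \<in> carrier R \<Longrightarrow> x \<in> H \<Longrightarrow> r \<odot>\<^bsub>M\<^esub> x \<in> H"
  using submoduleE(4) by blast

lemma submodule_neg: "submodule H R M \<Longrightarrow> x \<in> H \<Longrightarrow> \<ominus>\<^bsub>M\<^esub> x \<in> H"
  using submoduleE(3) by blast

lemma submodule_minus: "submodule H R M \<Longrightarrow> x \<in> H \<Longrightarrow> y \<in> H \<Longrightarrow> x \<ominus>\<^bsub>M\<^esub> y \<in> H"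
  unfolding M.minus_eq by (intro submodule_add submodule_neg)

lemma submodule_add_iff:
  assumes "submodule H R M" "x \<in> carrier M" "y \<in> H"
  shows "x \<oplus>\<^bsub>M\<^esub> y \<in> H \<longleftrightarrow> x \<in> H"
proof
  have y: "y \<in> carrier M" using submodule_carrier assms by blast
  assume "x \<oplus>\<^bsub>M\<^esub> y \<in> H"
  then have "(x \<oplus>\<^bsub>M\<^esub> y) \<ominus>\<^bsub>M\<^esub> y \<in> H" using submodule_minus assms by blast
  moreover have "(x \<oplus>\<^bsub>M\<^esub> y) \<ominus>\<^bsub>M\<^esub> y = x" using assms(2) y by algebra
  ultimately show "x \<in> H" by simp
qed (use assms submodule_add in blast)

lemma submodule_zero_set: "submodule {\<zero>\<^bsub>M\<^esub>} R M"
  by (rule submodule_intro) auto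

lemma submodule_set_add:
  assumes H: "submodule H R M" and K: "submodule K R M"
  shows "submodule (H <+>\<^bsub>M\<^esub> K) R M"
proof -
  note iff = set_add_iff[where M = M]
  note c = submodule_carrier[OF H] submodule_carrier[OF K]
  show ?thesis
  proof (rule submodule_intro)
    show "H <+>\<^bsub>M\<^esub> K \<subseteq> carrier M" using c by (auto simp: iff)
    show "\<zero>\<^bsub>M\<^esub> \<in> H <+>\<^bsub>M\<^esub> K" unfolding iff
      by (intro bexI[of _ "\<zero>\<^bsub>M\<^esub>"]) (auto simp: submodule_zero H K)
    fix x y assume "x \<in> H <+>\<^bsub>M\<^esub> K" "y \<in> H <+>\<^bsub>M\<^esub> K"
    then obtain h k h' k' where e: "h \<in> H" "k \<in> K" "h' \<in> H" "k' \<in> K"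
      "x = h \<oplus>\<^bsub>M\<^esub> k" "y = h' \<oplus>\<^bsub>M\<^esub> k'" unfolding iff by blast
    have "x \<oplus>\<^bsub>M\<^esub> y = (h \<oplus>\<^bsub>M\<^esub> h') \<oplus>\<^bsub>M\<^esub> (k \<oplus>\<^bsub>M\<^esub> k')"
      using c(1)[OF e(1)] c(1)[OF e(3)] c(2)[OF e(2)] c(2)[OF e(4)] unfolding e by algebra
    then show "x \<oplus>\<^bsub>M\<^esub> y \<in> H <+>\<^bsub>M\<^esub> K" unfolding iff
      using e submodule_add H K by metis
  next
    fix r x assume r: "r \<in> carrier R" and "x \<in> H <+>\<^bsub>M\<^esub> K"
    then obtain h k where e: "h \<in> H" "k \<in> K" "x = h \<oplus>\<^bsub>M\<^esub> k" unfolding iff by blast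
    then show "r \<odot>\<^bsub>M\<^esub> x \<in> H <+>\<^bsub>M\<^esub> K" unfolding iff
      using smult_r_distr[OF r c(1) c(2)] submodule_smult[OF _ r] H K by metis
  qed
qed

end

context cring
begin

lemma ideal_intro:
  assumes "I \<subseteq> carrier R" "\<zero> \<in> I"
    and add: "\<And>x y. x \<in> I \<Longrightarrow> y \<in> I \<Longrightarrow> x \<oplus> y \<in> I"
    and mult: "\<And>r x. r \<in> carrier R \<Longrightarrow> x \<in> I \<Longrightarrow> r \<otimes> x \<in> I"
  shows "ideal I R"
proof (rule idealI[OF ring_axioms])
  show "subgroup I (add_monoid R)"
  proof (rule add.subgroupI)
    fix a assume a: "a \<in> I"
    have "\<ominus> a = (\<ominus> \<one>) \<otimes> a" using a assms(1) l_minus[of \<one> a] by auto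
    then show "\<ominus> a \<in> I" using mult[of "\<ominus> \<one>" a] a by simp
  qed (use assms in auto)
  fix a x assume "a \<in> I" "x \<in> carrier R"
  then show "x \<otimes> a \<in> I" "a \<otimes> x \<in> I" using mult[of x a] m_comm[of a x] assms(1) by auto
qed

lemma ideal_closed:
  assumes "ideal I R"
  shows "I \<subseteq> carrier R" "\<zero> \<in> I" "\<And>x y. x \<in> I \<Longrightarrow> y \<in> I \<Longrightarrow> x \<oplus> y \<in> I"
    "\<And>x. x \<in> I \<Longrightarrow> \<ominus> x \<in> I"
    "\<And>r x. r \<in> carrier R \<Longrightarrow> x \<in> I \<Longrightarrow> r \<otimes> x \<in> I"
proof -
  interpret ideal I R by fact
  show "I \<subseteq> carrier R" "\<zero> \<in> I" "\<And>x y. x \<in> I \<Longrightarrow> y \<in> I \<Longrightarrow> x \<oplus> y \<in> I"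
    "\<And>x. x \<in> I \<Longrightarrow> \<ominus> x \<in> I" "\<And>r x. r \<in> carrier R \<Longrightarrow> x \<in> I \<Longrightarrow> r \<otimes> x \<in> I"
    using I_l_closed a_subset a_inv_closed by (auto simp: a_subset)
qed

lemma primeideal_pow:
  assumes "primeideal p R" "y \<in> carrier R" "y [^] (n::nat) \<in> p"
  shows "y \<in> p"
proof -
  interpret primeideal p R by fact
  show ?thesis using assms(3)
  proof (induction n)
    case 0
    then show ?case using I_notcarr one_imp_carrier by simp
  next
    case (Suc n)
    then show ?case using I_prime[of "y [^] n" y] assms(2) by auto
  qed
qed

end

lemma mod_homD:
  assumes "f \<in> mod_hom R M N"
  shows "x \<in> carrier M \<Longrightarrow> f x \<in> carrier N"
    and "x \<in> carrier M \<Longrightarrow> y \<in> carrier M \<Longrightarrow> f (x \<oplus>\<^bsub>M\<^esub> y) = f x \<oplus>\<^bsub>N\<^esub> f y"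
    and "r \<in> carrier R \<Longrightarrow> x \<in> carrier M \<Longrightarrow> f (r \<odot>\<^bsub>M\<^esub> x) = r \<odot>\<^bsub>N\<^esub> f x"
  using assms by (auto simp: mod_hom_def hom_def)

lemma mod_homI:
  assumes "\<And>x. x \<in> carrier M \<Longrightarrow> f x \<in> carrier N"
    and "\<And>x y. x \<in> carrier M \<Longrightarrow> y \<in> carrier M \<Longrightarrow> f (x \<oplus>\<^bsub>M\<^esub> y) = f x \<oplus>\<^bsub>N\<^esub> f y"
    and "\<And>r x. r \<in> carrier R \<Longrightarrow> x \<in> carrier M \<Longrightarrow> f (r \<odot>\<^bsub>M\<^esub> x) = r \<odot>\<^bsub>N\<^esub> f x"
  shows "f \<in> mod_hom R M N"
  using assms by (auto simp: mod_hom_def hom_def)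

lemma mod_hom_zero:
  assumes "module R M" "module R N" "f \<in> mod_hom R M N"
  shows "f \<zero>\<^bsub>M\<^esub> = \<zero>\<^bsub>N\<^esub>"
proof -
  interpret M: module R M by fact
  interpret N: module R N by fact
  have "f (\<zero>\<^bsub>R\<^esub> \<odot>\<^bsub>M\<^esub> \<zero>\<^bsub>M\<^esub>) = \<zero>\<^bsub>R\<^esub> \<odot>\<^bsub>N\<^esub> f \<zero>\<^bsub>M\<^esub>"
    by (rule mod_homD(3)[OF assms(3)]) auto
  then show ?thesis using mod_homD(1)[OF assms(3), of "\<zero>\<^bsub>M\<^esub>"] by simp
qed

lemma mod_hom_neg:
  assumes "module R M" "module R N" "f \<in> mod_hom R M N" "x \<in> carrier M"
  shows "f (\<ominus>\<^bsub>M\<^esub> x) = \<ominus>\<^bsub>N\<^esub> f x"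
proof -
  interpret M: module R M by fact
  interpret N: module R N by fact
  have "f ((\<ominus>\<^bsub>R\<^esub> \<one>\<^bsub>R\<^esub>) \<odot>\<^bsub>M\<^esub> x) = (\<ominus>\<^bsub>R\<^esub> \<one>\<^bsub>R\<^esub>) \<odot>\<^bsub>N\<^esub> f x"
    by (rule mod_homD(3)[OF assms(3)]) (use assms(4) in auto)
  then show ?thesis
    using mod_homD(1)[OF assms(3,4)] assms(4) M.smult_l_minus[of "\<one>\<^bsub>R\<^esub>" x]
      N.smult_l_minus[of "\<one>\<^bsub>R\<^esub>" "f x"] by simp
qed

lemma mod_hom_minus:
  assumes "module R M" "module R N" "f \<in> mod_hom R M N" "x \<in> carrier M" "y \<in> carrier M"
  shows "f (x \<ominus>\<^bsub>M\<^esub> y) = f x \<ominus>\<^bsub>N\<^esub> f y"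
proof -
  interpret M: module R M by fact
  interpret N: module R N by fact
  show ?thesis
    using mod_homD(2)[OF assms(3,4), of "\<ominus>\<^bsub>M\<^esub> y"] mod_hom_neg[OF assms(1-3,5)] assms(5)
    by (simp add: M.minus_eq N.minus_eq)
qed

lemma mod_hom_kernel:
  assumes M: "module R M" and N: "module R N" and f: "f \<in> mod_hom R M N"
  shows "submodule (a_kernel M N f) R M"
proof -
  interpret M: module R M by fact
  interpret N: module R N by fact
  show ?thesis
    by (rule M.submodule_intro) (auto simp: a_kernel_def' mod_hom_zero[OF M N f] mod_homD[OF f])
qed

lemma mod_hom_image:
  assumes M: "module R M" and N: "module R N" and f: "f \<in> mod_hom R M N"
  shows "submodule (f ` carrier M) R N"
proof -
  interpret M: module R M by fact
  interpret N: module R N by fact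
  show ?thesis
  proof (rule N.submodule_intro)
    show "f ` carrier M \<subseteq> carrier N" using mod_homD(1)[OF f] by auto
    show "\<zero>\<^bsub>N\<^esub> \<in> f ` carrier M" using mod_hom_zero[OF M N f] by (intro image_eqI[of _ _ "\<zero>\<^bsub>M\<^esub>"]) auto
    fix x y assume "x \<in> f ` carrier M" "y \<in> f ` carrier M"
    then obtain u v where "u \<in> carrier M" "v \<in> carrier M" "x = f u" "y = f v" by blast
    then show "x \<oplus>\<^bsub>N\<^esub> y \<in> f ` carrier M"
      using mod_homD(2)[OF f, of u v] by (intro image_eqI[of _ _ "u \<oplus>\<^bsub>M\<^esub> v"]) auto
  next
    fix r x assume r: "r \<in> carrier R" and "x \<in> f ` carrier M"
    then obtain u where "u \<in> carrier M" "x = f u" by blast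
    then show "r \<odot>\<^bsub>N\<^esub> x \<in> f ` carrier M"
      using mod_homD(3)[OF f r, of u] r by (intro image_eqI[of _ _ "r \<odot>\<^bsub>M\<^esub> u"]) auto
  qed
qed

definition regular_module :: "('a, 'r) ring_scheme \<Rightarrow> ('a, 'a) module"
  where "regular_module R =
    \<lparr>carrier = carrier R, monoid.mult = monoid.mult R, one = \<one>\<^bsub>R\<^esub>, ring.zero = \<zero>\<^bsub>R\<^esub>,
      ring.add = ring.add R, smult = monoid.mult R\<rparr>"

lemma regular_module_simps [simp]:
  "carrier (regular_module R) = carrier R" "\<zero>\<^bsub>regular_module R\<^esub> = \<zero>\<^bsub>R\<^esub>"
  "ring.add (regular_module R) = ring.add R" "smult (regular_module R) = monoid.mult R"
  by (simp_all add: regular_module_def)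

lemma (in cring) regular_module: "module R (regular_module R)"
proof (rule moduleI[OF is_cring])
  show "abelian_group (regular_module R)"
    by (rule abelian_groupI) (auto simp: a_ac intro: l_neg)
qed (auto simp: l_distr r_distr m_assoc)

lemma (in module) submodule_add_principal:
  assumes L: "submodule L R M" and y: "y \<in> carrier M"
  defines "K \<equiv> {l \<oplus>\<^bsub>M\<^esub> s \<odot>\<^bsub>M\<^esub> y | l s. l \<in> L \<and> s \<in> carrier R}"
  shows "submodule K R M" "L \<subseteq> K" "y \<in> K"
proof -
  have "(\<lambda>s. s \<odot>\<^bsub>M\<^esub> y) \<in> mod_hom R (regular_module R) M"
    by (rule mod_homI) (use y in \<open>auto simp: smult_l_distr smult_assoc1\<close>)
  from mod_hom_image[OF R.regular_module module_axioms this]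
  have "submodule (L <+>\<^bsub>M\<^esub> (\<lambda>s. s \<odot>\<^bsub>M\<^esub> y) ` carrier R) R M"
    by (intro submodule_set_add[OF L]) simp
  moreover have "L <+>\<^bsub>M\<^esub> (\<lambda>s. s \<odot>\<^bsub>M\<^esub> y) ` carrier R = K"
    unfolding K_def set_eq_iff set_add_iff by blast
  ultimately show "submodule K R M" by simp
  have "l = l \<oplus>\<^bsub>M\<^esub> \<zero> \<odot>\<^bsub>M\<^esub> y" if "l \<in> L" for l using submodule_carrier[OF L that] y by simp
  then show "L \<subseteq> K" unfolding K_def by blast
  have "y = \<zero>\<^bsub>M\<^esub> \<oplus>\<^bsub>M\<^esub> \<one> \<odot>\<^bsub>M\<^esub> y" using y by simp
  then show "y \<in> K" unfolding K_def using submodule_zero[OF L] by blast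
qed

lemma (in module) submodule_add_multiples:
  assumes L: "submodule L R M" and x: "x \<in> carrier R"
  shows "submodule {l \<oplus>\<^bsub>M\<^esub> x \<odot>\<^bsub>M\<^esub> m | l m. l \<in> L \<and> m \<in> carrier M} R M"
proof -
  have "(\<lambda>m. x \<odot>\<^bsub>M\<^esub> m) \<in> mod_hom R M M"
    by (rule mod_homI) (use x in \<open>auto simp: smult_r_distr smult_left_commute\<close>)
  from submodule_set_add[OF L mod_hom_image[OF module_axioms module_axioms this]]
  have "submodule (L <+>\<^bsub>M\<^esub> (\<lambda>m. x \<odot>\<^bsub>M\<^esub> m) ` carrier M) R M" .
  moreover have "L <+>\<^bsub>M\<^esub> (\<lambda>m. x \<odot>\<^bsub>M\<^esub> m) ` carrier M =
      {l \<oplus>\<^bsub>M\<^esub> x \<odot>\<^bsub>M\<^esub> m | l m. l \<in> L \<and> m \<in> carrier M}"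
    unfolding set_eq_iff set_add_iff by blast
  ultimately show ?thesis by simp
qed

lemma (in cring) submodule_regular_module_iff:
  "submodule I R (regular_module R) \<longleftrightarrow> ideal I R"
proof -
  interpret M: module R "regular_module R" by (rule regular_module)
  show ?thesis
  proof
    assume I: "submodule I R (regular_module R)"
    show "ideal I R"
      by (rule ideal_intro)
        (use M.submoduleE(1)[OF I] M.submodule_zero[OF I] M.submodule_add[OF I] M.submodule_smult[OF I] in auto)
  next
    assume I: "ideal I R"
    show "submodule I R (regular_module R)"
      by (rule M.submodule_intro) (use ideal_closed[OF I] in auto)
  qed
qed

lemma (in cring) ideal_add_principal:
  assumes I: "ideal I R" and b: "b \<in> carrier R"
  defines "K \<equiv> {i \<oplus> s \<otimes> b | i s. i \<in> I \<and> s \<in> carrier R}"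
  shows "ideal K R" "I \<subseteq> K" "b \<in> K"
proof -
  interpret M: module R "regular_module R" by (rule regular_module)
  note K = M.submodule_add_principal[of I b, unfolded regular_module_simps, folded K_def]
  show "ideal K R" "I \<subseteq> K" "b \<in> K"
    using K I b by (simp_all add: submodule_regular_module_iff)
qed

lemma (in noetherian_ring) maximal_ideal_in_family:
  assumes "S \<noteq> {}" "\<And>I. I \<in> S \<Longrightarrow> ideal I R"
  shows "\<exists>I\<in>S. \<forall>J\<in>S. I \<subseteq> J \<longrightarrow> J = I"
proof (rule subset_Zorn)
  fix C assume C: "subset.chain S C"
  show "\<exists>U\<in>S. \<forall>J\<in>C. J \<subseteq> U"
  proof (cases "C = {}")
    case True
    then show ?thesis using assms(1) by blast
  next
    case False
    have "C \<subseteq> S" using C by (simp add: pred_on.chain_def)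
    moreover have "subset.chain {I. ideal I R} C"
      using C assms(2) by (auto simp: pred_on.chain_def)
    ultimately show ?thesis using ideal_chain_is_trivial[OF False] by blast
  qed
qed

definition colon :: "('a, 'r) ring_scheme \<Rightarrow> ('a, 'b, 'm) module_scheme \<Rightarrow> 'b set \<Rightarrow> 'b \<Rightarrow> 'a set"
  where "colon R M L x = {r \<in> carrier R. r \<odot>\<^bsub>M\<^esub> x \<in> L}"

definition subquot_Ass ::
    "('a, 'r) ring_scheme \<Rightarrow> ('a, 'b, 'm) module_scheme \<Rightarrow> 'b set \<Rightarrow> 'b set \<Rightarrow> 'a set set"
  where "subquot_Ass R M Z B = {p. primeideal p R \<and> (\<exists>z\<in>Z. p = colon R M B z)}"

lemma (in module) colon_ideal:
  assumes L: "submodule L R M" and x: "x \<in> carrier M"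
  shows "ideal (colon R M L x) R"
  by (rule R.ideal_intro)
    (use x in \<open>auto simp: colon_def smult_l_distr smult_assoc1 submodule_zero[OF L]
      submodule_add[OF L] submodule_smult[OF L]\<close>)


section \<open>Torsion with respect to an ideal\<close>

text \<open>
  Torsion is tested at one element of \<open>\<aa>\<close> at a time. Over a Noetherian ring this agrees with being
  killed by a power of \<open>\<aa>\<close>, and it is visibly stable under extensions, without any bound on the
  exponents. For general \<open>L\<close> the set is the preimage in \<open>M\<close> of the torsion of \<open>M / L\<close>.
\<close>
definition tors_mod ::
    "('a, 'r) ring_scheme \<Rightarrow> 'a set \<Rightarrow> ('a, 'b, 'm) module_scheme \<Rightarrow> 'b set \<Rightarrow> 'b set"
  where "tors_mod R \<aa> M L =
    {x \<in> carrier M. \<forall>y\<in>\<aa>. \<exists>n::nat. (y [^]\<^bsub>R\<^esub> n) \<odot>\<^bsub>M\<^esub> x \<in> L}"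

context module
begin

lemma pow_smult_add:
  "y \<in> carrier R \<Longrightarrow> x \<in> carrier M \<Longrightarrow>
    (y [^] (m + n :: nat)) \<odot>\<^bsub>M\<^esub> x = (y [^] m) \<odot>\<^bsub>M\<^esub> ((y [^] n) \<odot>\<^bsub>M\<^esub> x)"
  by (simp add: R.nat_pow_mult[symmetric] smult_assoc1)

lemma tors_mod_submodule:
  assumes a: "\<aa> \<subseteq> carrier R" and L: "submodule L R M"
  shows "submodule (tors_mod R \<aa> M L) R M"
proof (rule submodule_intro)
  fix x x' assume x: "x \<in> tors_mod R \<aa> M L" and x': "x' \<in> tors_mod R \<aa> M L"
  show "x \<oplus>\<^bsub>M\<^esub> x' \<in> tors_mod R \<aa> M L"
    unfolding tors_mod_def
  proof (intro CollectI conjI ballI)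
    show "x \<oplus>\<^bsub>M\<^esub> x' \<in> carrier M" using x x' by (auto simp: tors_mod_def)
    fix y assume y: "y \<in> \<aa>"
    then obtain m n :: nat where mn: "(y [^] m) \<odot>\<^bsub>M\<^esub> x \<in> L" "(y [^] n) \<odot>\<^bsub>M\<^esub> x' \<in> L"
      using x x' unfolding tors_mod_def by blast
    have c: "y \<in> carrier R" "x \<in> carrier M" "x' \<in> carrier M"
      using a y x x' by (auto simp: tors_mod_def)
    have "(y [^] (n + m)) \<odot>\<^bsub>M\<^esub> (x \<oplus>\<^bsub>M\<^esub> x') =
      (y [^] n) \<odot>\<^bsub>M\<^esub> ((y [^] m) \<odot>\<^bsub>M\<^esub> x) \<oplus>\<^bsub>M\<^esub> (y [^] m) \<odot>\<^bsub>M\<^esub> ((y [^] n) \<odot>\<^bsub>M\<^esub> x')"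
      using c by (simp add: smult_r_distr pow_smult_add smult_left_commute)
    moreover have "\<dots> \<in> L" 
      using c by (intro submodule_add[OF L] submodule_smult[OF L _ mn(1)] submodule_smult[OF L _ mn(2)]) auto
    ultimately show "\<exists>n::nat. (y [^] n) \<odot>\<^bsub>M\<^esub> (x \<oplus>\<^bsub>M\<^esub> x') \<in> L" by metis
  qed
next
  fix r x assume r: "r \<in> carrier R" and x: "x \<in> tors_mod R \<aa> M L"
  then have xc: "x \<in> carrier M" by (auto simp: tors_mod_def)
  show "r \<odot>\<^bsub>M\<^esub> x \<in> tors_mod R \<aa> M L"
    unfolding tors_mod_def
  proof (intro CollectI conjI ballI)
    fix y assume y: "y \<in> \<aa>"
    then obtain n :: nat where n: "(y [^] n) \<odot>\<^bsub>M\<^esub> x \<in> L" using x by (auto simp: tors_mod_def)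
    have "(y [^] n) \<odot>\<^bsub>M\<^esub> (r \<odot>\<^bsub>M\<^esub> x) = r \<odot>\<^bsub>M\<^esub> ((y [^] n) \<odot>\<^bsub>M\<^esub> x)"
      using smult_left_commute y a r xc by auto
    then show "\<exists>n::nat. (y [^] n) \<odot>\<^bsub>M\<^esub> (r \<odot>\<^bsub>M\<^esub> x) \<in> L"
      using submodule_smult[OF L r n] by metis
  qed (use r xc in auto)
qed (use a in \<open>auto simp: tors_mod_def submodule_zero[OF L] subset_iff\<close>)

lemma tors_mod_upper:
  assumes "submodule L R M" "\<aa> \<subseteq> carrier R"
  shows "L \<subseteq> tors_mod R \<aa> M L"
  using assms submodule_carrier[OF assms(1)] submodule_smult[OF assms(1)]
  by (auto simp: tors_mod_def subset_iff intro!: exI[of _ 0])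

lemma tors_mod_idem:
  assumes a: "\<aa> \<subseteq> carrier R"
    and x: "x \<in> carrier M" "\<And>y. y \<in> \<aa> \<Longrightarrow> \<exists>n::nat. (y [^] n) \<odot>\<^bsub>M\<^esub> x \<in> tors_mod R \<aa> M L"
  shows "x \<in> tors_mod R \<aa> M L"
  unfolding tors_mod_def
proof (intro CollectI conjI ballI x)
  fix y assume y: "y \<in> \<aa>"
  then obtain n :: nat where "(y [^] n) \<odot>\<^bsub>M\<^esub> x \<in> tors_mod R \<aa> M L" using x(2) by blast
  then obtain m :: nat where "(y [^] m) \<odot>\<^bsub>M\<^esub> ((y [^] n) \<odot>\<^bsub>M\<^esub> x) \<in> L"
    using y by (auto simp: tors_mod_def)
  then show "\<exists>n::nat. (y [^] n) \<odot>\<^bsub>M\<^esub> x \<in> L"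
    using pow_smult_add y a x(1) by (metis subset_iff)
qed

end

section \<open>Baer's criterion for subquotients\<close>

text \<open>
  The graph of a homomorphism from an ideal of \<open>R\<close> to \<open>M\<close>, but possibly multivalued. With
  relations in place of maps, homomorphisms into quotients need no choice of representatives.
\<close>
definition linear_relation ::
    "('a, 'r) ring_scheme \<Rightarrow> ('a, 'b, 'm) module_scheme \<Rightarrow> ('a \<times> 'b) set \<Rightarrow> bool"
  where "linear_relation R M G \<longleftrightarrow>
    G \<subseteq> carrier R \<times> carrier M \<and> (\<zero>\<^bsub>R\<^esub>, \<zero>\<^bsub>M\<^esub>) \<in> G \<and>
    (\<forall>r x s y. (r, x) \<in> G \<longrightarrow> (s, y) \<in> G \<longrightarrow> (r \<oplus>\<^bsub>R\<^esub> s, x \<oplus>\<^bsub>M\<^esub> y) \<in> G) \<and>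
    (\<forall>c r x. c \<in> carrier R \<longrightarrow> (r, x) \<in> G \<longrightarrow> (c \<otimes>\<^bsub>R\<^esub> r, c \<odot>\<^bsub>M\<^esub> x) \<in> G)"

text \<open>
  Baer's criterion for \<open>L / N\<close>: a relation whose values at \<open>0\<close> lie in \<open>N\<close> is a homomorphism from
  an ideal to \<open>L / N\<close>, and it has to be multiplication by an element.
\<close>
definition baer ::
    "('a, 'r) ring_scheme \<Rightarrow> ('a, 'b, 'm) module_scheme \<Rightarrow> 'b set \<Rightarrow> 'b set \<Rightarrow> bool"
  where "baer R M L N \<longleftrightarrow>
    (\<forall>G. linear_relation R M G \<and> (\<forall>r x. (r, x) \<in> G \<longrightarrow> x \<in> L) \<and> (\<forall>x. (\<zero>\<^bsub>R\<^esub>, x) \<in> G \<longrightarrow> x \<in> N) \<longrightarrow>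
      (\<exists>l\<in>L. \<forall>r x. (r, x) \<in> G \<longrightarrow> x \<ominus>\<^bsub>M\<^esub> r \<odot>\<^bsub>M\<^esub> l \<in> N))"

lemma baerD:
  assumes "baer R M L N" "linear_relation R M G"
    and "\<And>r x. (r, x) \<in> G \<Longrightarrow> x \<in> L" "\<And>x. (\<zero>\<^bsub>R\<^esub>, x) \<in> G \<Longrightarrow> x \<in> N"
  obtains l where "l \<in> L" "\<And>r x. (r, x) \<in> G \<Longrightarrow> x \<ominus>\<^bsub>M\<^esub> r \<odot>\<^bsub>M\<^esub> l \<in> N"
  using assms unfolding baer_def by metis

lemma linear_relationD:
  assumes "linear_relation R M G"
  shows "\<And>r x. (r, x) \<in> G \<Longrightarrow> r \<in> carrier R" "\<And>r x. (r, x) \<in> G \<Longrightarrow> x \<in> carrier M"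
    "(\<zero>\<^bsub>R\<^esub>, \<zero>\<^bsub>M\<^esub>) \<in> G"
    "\<And>r x s y. (r, x) \<in> G \<Longrightarrow> (s, y) \<in> G \<Longrightarrow> (r \<oplus>\<^bsub>R\<^esub> s, x \<oplus>\<^bsub>M\<^esub> y) \<in> G"
    "\<And>c r x. c \<in> carrier R \<Longrightarrow> (r, x) \<in> G \<Longrightarrow> (c \<otimes>\<^bsub>R\<^esub> r, c \<odot>\<^bsub>M\<^esub> x) \<in> G"
  using assms unfolding linear_relation_def by (simp_all add: subset_iff)

lemma linear_relationI:
  assumes "\<And>r x. (r, x) \<in> G \<Longrightarrow> r \<in> carrier R" "\<And>r x. (r, x) \<in> G \<Longrightarrow> x \<in> carrier M"
    "(\<zero>\<^bsub>R\<^esub>, \<zero>\<^bsub>M\<^esub>) \<in> G"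
    "\<And>r x s y. (r, x) \<in> G \<Longrightarrow> (s, y) \<in> G \<Longrightarrow> (r \<oplus>\<^bsub>R\<^esub> s, x \<oplus>\<^bsub>M\<^esub> y) \<in> G"
    "\<And>c r x. c \<in> carrier R \<Longrightarrow> (r, x) \<in> G \<Longrightarrow> (c \<otimes>\<^bsub>R\<^esub> r, c \<odot>\<^bsub>M\<^esub> x) \<in> G"
  shows "linear_relation R M G"
  unfolding linear_relation_def
proof (intro conjI allI impI)
  show "G \<subseteq> carrier R \<times> carrier M" using assms(1,2) by auto
qed (fact assms)+

lemma (in module) linear_relation_minus:
  assumes G: "linear_relation R M G" and e: "(r, x) \<in> G" "(s, y) \<in> G"
  shows "(r \<ominus> s, x \<ominus>\<^bsub>M\<^esub> y) \<in> G"
proof -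
  note c = linear_relationD[OF G]
  have "(r \<oplus> (\<ominus> \<one>) \<otimes> s, x \<oplus>\<^bsub>M\<^esub> (\<ominus> \<one>) \<odot>\<^bsub>M\<^esub> y) \<in> G"
    by (intro c(4)[OF e(1)] c(5)[OF _ e(2)]) auto
  moreover have "r \<oplus> (\<ominus> \<one>) \<otimes> s = r \<ominus> s"
    using c(1)[OF e(1)] c(1)[OF e(2)] by algebra
  moreover have "x \<oplus>\<^bsub>M\<^esub> (\<ominus> \<one>) \<odot>\<^bsub>M\<^esub> y = x \<ominus>\<^bsub>M\<^esub> y"
    using c(2)[OF e(1)] c(2)[OF e(2)] by algebra
  ultimately show ?thesis by simp
qed

lemma (in module) linear_relation_multiples:
  assumes c: "ideal c R" and b: "b \<in> carrier R" and p: "p \<in> carrier M"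
  shows "linear_relation R M {(s \<otimes> b, s \<odot>\<^bsub>M\<^esub> p) | s. s \<in> c}"
proof -
  note cc = R.ideal_closed[OF c]
  have car: "s \<in> carrier R" if "s \<in> c" for s using that cc(1) by blast
  show ?thesis
  proof (rule linear_relationI)
    show "(\<zero>, \<zero>\<^bsub>M\<^esub>) \<in> {(s \<otimes> b, s \<odot>\<^bsub>M\<^esub> p) | s. s \<in> c}" using cc(2) b p by force
    fix r x s y
    assume "(r, x) \<in> {(s \<otimes> b, s \<odot>\<^bsub>M\<^esub> p) | s. s \<in> c}" "(s, y) \<in> {(s \<otimes> b, s \<odot>\<^bsub>M\<^esub> p) | s. s \<in> c}"
    then obtain u v where "u \<in> c" "v \<in> c" "r = u \<otimes> b" "x = u \<odot>\<^bsub>M\<^esub> p" "s = v \<otimes> b" "y = v \<odot>\<^bsub>M\<^esub> p"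
      by blast
    then have "r \<oplus> s = (u \<oplus> v) \<otimes> b" "x \<oplus>\<^bsub>M\<^esub> y = (u \<oplus> v) \<odot>\<^bsub>M\<^esub> p" "u \<oplus> v \<in> c"
      using car b p cc(3) by (auto simp: R.l_distr smult_l_distr)
    then show "(r \<oplus> s, x \<oplus>\<^bsub>M\<^esub> y) \<in> {(s \<otimes> b, s \<odot>\<^bsub>M\<^esub> p) | s. s \<in> c}" by blast
  next
    fix k r x assume k: "k \<in> carrier R" and "(r, x) \<in> {(s \<otimes> b, s \<odot>\<^bsub>M\<^esub> p) | s. s \<in> c}"
    then obtain u where "u \<in> c" "r = u \<otimes> b" "x = u \<odot>\<^bsub>M\<^esub> p" by blast
    then have "k \<otimes> r = (k \<otimes> u) \<otimes> b" "k \<odot>\<^bsub>M\<^esub> x = (k \<otimes> u) \<odot>\<^bsub>M\<^esub> p" "k \<otimes> u \<in> c"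
      using car b p k cc(5) by (auto simp: R.m_assoc smult_assoc1)
    then show "(k \<otimes> r, k \<odot>\<^bsub>M\<^esub> x) \<in> {(s \<otimes> b, s \<odot>\<^bsub>M\<^esub> p) | s. s \<in> c}" by blast
  qed (use car b p in auto)
qed

lemma (in module) linear_relation_add_ideal:
  assumes G: "linear_relation R M G" and c: "ideal c R"
  shows "linear_relation R M {(r \<oplus> s, x) | r s x. (r, x) \<in> G \<and> s \<in> c}" (is "linear_relation R M ?H")
proof -
  note g = linear_relationD[OF G] and cc = R.ideal_closed[OF c]
  have car: "s \<in> carrier R" if "s \<in> c" for s using that cc(1) by blast
  show ?thesis
  proof (rule linear_relationI)
    have "(\<zero> \<oplus> \<zero>, \<zero>\<^bsub>M\<^esub>) \<in> ?H" using g(3) cc(2) by blast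
    then show "(\<zero>, \<zero>\<^bsub>M\<^esub>) \<in> ?H" by simp
    fix r x s y assume "(r, x) \<in> ?H" "(s, y) \<in> ?H"
    then obtain r1 s1 r2 s2 where e: "(r1, x) \<in> G" "s1 \<in> c" "(r2, y) \<in> G" "s2 \<in> c"
      "r = r1 \<oplus> s1" "s = r2 \<oplus> s2" by blast
    have "r \<oplus> s = (r1 \<oplus> r2) \<oplus> (s1 \<oplus> s2)"
      unfolding e using g(1)[OF e(1)] g(1)[OF e(3)] car[OF e(2)] car[OF e(4)] by algebra
    then show "(r \<oplus> s, x \<oplus>\<^bsub>M\<^esub> y) \<in> ?H" using g(4)[OF e(1,3)] cc(3)[OF e(2,4)] by blast
  next
    fix k r x assume k: "k \<in> carrier R" and "(r, x) \<in> ?H"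
    then obtain r1 s1 where e: "(r1, x) \<in> G" "s1 \<in> c" "r = r1 \<oplus> s1" by blast
    then have "k \<otimes> r = k \<otimes> r1 \<oplus> k \<otimes> s1" using R.r_distr[OF g(1)[OF e(1)] car[OF e(2)] k] by simp
    then show "(k \<otimes> r, k \<odot>\<^bsub>M\<^esub> x) \<in> ?H" using g(5)[OF k e(1)] cc(5)[OF k e(2)] by blast
  qed (use g car in auto)
qed

lemma linear_relation_image:
  assumes "module R M" "module R N" and f: "f \<in> mod_hom R M N" and G: "linear_relation R M G"
  shows "linear_relation R N {(r, f x) | r x. (r, x) \<in> G}" (is "linear_relation R N ?H")
proof -
  note g = linear_relationD[OF G] and h = mod_homD[OF f]
  show ?thesis
  proof (rule linear_relationI)
    show "(\<zero>\<^bsub>R\<^esub>, \<zero>\<^bsub>N\<^esub>) \<in> ?H" using g(3) mod_hom_zero[OF assms(1-3)] by force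
    fix r x s y assume "(r, x) \<in> ?H" "(s, y) \<in> ?H"
    then obtain u v where e: "(r, u) \<in> G" "(s, v) \<in> G" "x = f u" "y = f v" by blast
    then have "x \<oplus>\<^bsub>N\<^esub> y = f (u \<oplus>\<^bsub>M\<^esub> v)" using h(2) g(2) by metis
    then show "(r \<oplus>\<^bsub>R\<^esub> s, x \<oplus>\<^bsub>N\<^esub> y) \<in> ?H" using g(4)[OF e(1,2)] by blast
  next
    fix k r x assume k: "k \<in> carrier R" and "(r, x) \<in> ?H"
    then obtain u where e: "(r, u) \<in> G" "x = f u" by blast
    then have "k \<odot>\<^bsub>N\<^esub> x = f (k \<odot>\<^bsub>M\<^esub> u)" using h(3)[OF k g(2)[OF e(1)]] by simp
    then show "(k \<otimes>\<^bsub>R\<^esub> r, k \<odot>\<^bsub>N\<^esub> x) \<in> ?H" using g(5)[OF k e(1)] by blast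
  qed (use g h(1) in auto)
qed

lemma linear_relation_pullback:
  assumes M: "module R M" and N: "module R N" and f: "f \<in> mod_hom R M N"
    and T: "submodule T R N" and G: "linear_relation R N G"
  shows "linear_relation R M {(r, w). w \<in> carrier M \<and> (\<exists>x. (r, x) \<in> G \<and> x \<ominus>\<^bsub>N\<^esub> f w \<in> T)}"
    (is "linear_relation R M ?H")
proof -
  interpret M: module R M by fact
  interpret N: module R N by fact
  note g = linear_relationD[OF G] and h = mod_homD[OF f]
  show ?thesis
  proof (rule linear_relationI)
    have "\<zero>\<^bsub>N\<^esub> \<ominus>\<^bsub>N\<^esub> f \<zero>\<^bsub>M\<^esub> = \<zero>\<^bsub>N\<^esub>"
      using mod_hom_zero[OF M N f] by (simp add: N.M.minus_eq N.M.r_neg)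
    then show "(\<zero>\<^bsub>R\<^esub>, \<zero>\<^bsub>M\<^esub>) \<in> ?H" using g(3) N.submodule_zero[OF T] by force
    fix r w s w' assume "(r, w) \<in> ?H" "(s, w') \<in> ?H"
    then obtain x x' where a: "(r, x) \<in> G" "(s, x') \<in> G" "x \<ominus>\<^bsub>N\<^esub> f w \<in> T" "x' \<ominus>\<^bsub>N\<^esub> f w' \<in> T"
      "w \<in> carrier M" "w' \<in> carrier M" by blast
    have "(x \<oplus>\<^bsub>N\<^esub> x') \<ominus>\<^bsub>N\<^esub> (f w \<oplus>\<^bsub>N\<^esub> f w') = (x \<ominus>\<^bsub>N\<^esub> f w) \<oplus>\<^bsub>N\<^esub> (x' \<ominus>\<^bsub>N\<^esub> f w')"
      using g(2)[OF a(1)] g(2)[OF a(2)] h(1)[OF a(5)] h(1)[OF a(6)] by algebra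
    also have "\<dots> \<in> T" using a(3,4) by (rule N.submodule_add[OF T])
    finally show "(r \<oplus>\<^bsub>R\<^esub> s, w \<oplus>\<^bsub>M\<^esub> w') \<in> ?H"
      using a(5,6) g(4)[OF a(1,2)] h(2)[OF a(5,6)] by auto
  next
    fix k r w assume k: "k \<in> carrier R" and "(r, w) \<in> ?H"
    then obtain x where a: "(r, x) \<in> G" "x \<ominus>\<^bsub>N\<^esub> f w \<in> T" "w \<in> carrier M" by blast
    have "k \<odot>\<^bsub>N\<^esub> x \<ominus>\<^bsub>N\<^esub> k \<odot>\<^bsub>N\<^esub> f w = k \<odot>\<^bsub>N\<^esub> (x \<ominus>\<^bsub>N\<^esub> f w)"
      using g(2)[OF a(1)] k h(1)[OF a(3)] by algebra
    also have "\<dots> \<in> T" using a(2) by (rule N.submodule_smult[OF T k])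
    finally show "(k \<otimes>\<^bsub>R\<^esub> r, k \<odot>\<^bsub>M\<^esub> w) \<in> ?H"
      using a(3) k g(5)[OF k a(1)] h(3)[OF k a(3)] by auto
  qed (use g(1) in auto)
qed

text \<open>
  The quotient of an injective module \<open>M / N\<close> by an injective submodule \<open>L / N\<close> is injective.
  The usual proof splits off \<open>L / N\<close>; here the ideals on which a given homomorphism \<open>G\<close> to
  \<open>M / L\<close> is multiplication by an element are enlarged one generator at a time, up to a maximal
  one. Given such an ideal \<open>J\<close> and a further generator \<open>b\<close>, injectivity of \<open>L / N\<close> allows
  correcting the value at \<open>b\<close> to one that \<open>J : b\<close> kills, and injectivity of \<open>M / N\<close> then extends
  \<open>0\<close> on \<open>J\<close> together with this value at \<open>b\<close>.
\<close>
lemma (in module) baer_quotient: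
  assumes noeth: "noetherian_ring R"
    and L: "submodule L R M" and N: "submodule N R M" and NL: "N \<subseteq> L"
    and M_baer: "baer R M (carrier M) N" and L_baer: "baer R M L N"
  shows "baer R M (carrier M) L"
  unfolding baer_def
proof (intro allI impI, elim conjE)
  fix G assume G: "linear_relation R M G" and G0: "\<forall>x. (\<zero>, x) \<in> G \<longrightarrow> x \<in> L"
  note g = linear_relationD[OF G]
  note Lc = submodule_carrier[OF L] and Nc = submodule_carrier[OF N]
  define lifts where
    "lifts J p \<longleftrightarrow> p \<in> carrier M \<and> (\<forall>r x. (r, x) \<in> G \<longrightarrow> r \<in> J \<longrightarrow> x \<ominus>\<^bsub>M\<^esub> r \<odot>\<^bsub>M\<^esub> p \<in> L)" for J p
  define S where "S = {J. ideal J R \<and> (\<exists>p. lifts J p)}"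
  have "lifts {\<zero>} \<zero>\<^bsub>M\<^esub>"
    using G0 g(2) unfolding lifts_def by (auto simp: M.minus_eq minus_zero_module)
  moreover have "ideal {\<zero>} R" by (rule R.zeroideal)
  ultimately have "S \<noteq> {}" unfolding S_def by blast
  moreover have Sid: "ideal J R" if "J \<in> S" for J using that by (simp add: S_def)
  ultimately obtain J where J: "J \<in> S" and Jmax: "\<And>K. K \<in> S \<Longrightarrow> J \<subseteq> K \<Longrightarrow> K = J"
    using noetherian_ring.maximal_ideal_in_family[OF noeth, of S] Sid by blast
  from J obtain p where Ji: "ideal J R" and p: "lifts J p" unfolding S_def by blast
  have pc: "p \<in> carrier M" and pL: "\<And>r x. (r, x) \<in> G \<Longrightarrow> r \<in> J \<Longrightarrow> x \<ominus>\<^bsub>M\<^esub> r \<odot>\<^bsub>M\<^esub> p \<in> L"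
    using p unfolding lifts_def by auto
  note j = R.ideal_closed[OF Ji]
  have Jc: "r \<in> carrier R" if "r \<in> J" for r using that j(1) by blast
  have "b \<in> J" if bq: "(b, q) \<in> G" for b q
  proof -
    have b: "b \<in> carrier R" and q: "q \<in> carrier M" using g(1,2)[OF bq] by auto
    define p1 where "p1 = q \<ominus>\<^bsub>M\<^esub> b \<odot>\<^bsub>M\<^esub> p"
    have p1: "p1 \<in> carrier M" using q b pc by (simp add: p1_def)
    have sp1: "s \<odot>\<^bsub>M\<^esub> p1 \<in> L" if s: "s \<in> carrier R" "s \<otimes> b \<in> J" for s
    proof -
      have "s \<odot>\<^bsub>M\<^esub> q \<ominus>\<^bsub>M\<^esub> (s \<otimes> b) \<odot>\<^bsub>M\<^esub> p \<in> L" by (rule pL[OF g(5)[OF s(1) bq] s(2)])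
      moreover have "s \<odot>\<^bsub>M\<^esub> q \<ominus>\<^bsub>M\<^esub> (s \<otimes> b) \<odot>\<^bsub>M\<^esub> p = s \<odot>\<^bsub>M\<^esub> p1"
        unfolding p1_def using s q b pc by algebra
      ultimately show ?thesis by simp
    qed
    \<comment> \<open>correct \<open>p1\<close> by an element of \<open>L\<close> so that \<open>(J : b)\<close> kills it modulo \<open>N\<close>\<close>
    define c where "c = {s \<in> carrier R. s \<otimes> b \<in> J}"
    have c: "ideal c R"
      by (rule R.ideal_intro) (use j(2,3,5) b in \<open>auto simp: c_def R.l_distr R.m_assoc\<close>)
    obtain l where l: "l \<in> L"
      and lN: "\<And>s x. (s, x) \<in> {(s \<otimes> \<one>, s \<odot>\<^bsub>M\<^esub> p1) | s. s \<in> c} \<Longrightarrow> x \<ominus>\<^bsub>M\<^esub> s \<odot>\<^bsub>M\<^esub> l \<in> N"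
      by (rule baerD[OF L_baer linear_relation_multiples[OF c R.one_closed p1]])
        (use sp1 p1 submodule_zero[OF N] in \<open>auto simp: c_def\<close>)
    have lc: "l \<in> carrier M" using Lc[OF l] .
    define p2 where "p2 = p1 \<ominus>\<^bsub>M\<^esub> l"
    have p2: "p2 \<in> carrier M" using p1 lc by (simp add: p2_def)
    have sp2: "s \<odot>\<^bsub>M\<^esub> p2 \<in> N" if s: "s \<in> carrier R" "s \<otimes> b \<in> J" for s
    proof -
      have "s \<odot>\<^bsub>M\<^esub> p1 \<ominus>\<^bsub>M\<^esub> s \<odot>\<^bsub>M\<^esub> l \<in> N" by (rule lN) (use s in \<open>force simp: c_def\<close>)
      moreover have "s \<odot>\<^bsub>M\<^esub> p1 \<ominus>\<^bsub>M\<^esub> s \<odot>\<^bsub>M\<^esub> l = s \<odot>\<^bsub>M\<^esub> p2"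
        unfolding p2_def using s(1) p1 lc by algebra
      ultimately show ?thesis by simp
    qed
    \<comment> \<open>so \<open>J \<mapsto> 0\<close>, \<open>b \<mapsto> p2\<close> is well defined modulo \<open>N\<close> on \<open>J + Rb\<close>\<close>
    define G2 where
      "G2 = {(r \<oplus> i, x) | r i x. (r, x) \<in> {(s \<otimes> b, s \<odot>\<^bsub>M\<^esub> p2) | s. s \<in> carrier R} \<and> i \<in> J}"
    have G2I: "(s \<otimes> b \<oplus> i, s \<odot>\<^bsub>M\<^esub> p2) \<in> G2" if "i \<in> J" "s \<in> carrier R" for i s
      using that unfolding G2_def by blast
    have "linear_relation R M G2"
      unfolding G2_def
      by (intro linear_relation_add_ideal linear_relation_multiples R.oneideal b p2 Ji)
    moreover have "x \<in> N" if z: "(\<zero>, x) \<in> G2" for x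
    proof -
      obtain r1 s1 where e: "r1 \<in> J" "s1 \<in> carrier R" "\<zero> = s1 \<otimes> b \<oplus> r1" "x = s1 \<odot>\<^bsub>M\<^esub> p2"
        using z unfolding G2_def by blast
      have "s1 \<otimes> b = \<ominus> r1"
        using e(3) Jc[OF e(1)] e(2) b R.minus_equality[of "s1 \<otimes> b" r1] R.a_comm by simp
      then have "s1 \<otimes> b \<in> J" using j(4)[OF e(1)] by simp
      then show ?thesis using sp2[OF e(2)] e(4) by simp
    qed
    moreover have "x \<in> carrier M" if "(r, x) \<in> G2" for r x using that p2 by (auto simp: G2_def)
    ultimately obtain p3 where p3: "p3 \<in> carrier M"
      and p3N: "\<And>s x. (s, x) \<in> G2 \<Longrightarrow> x \<ominus>\<^bsub>M\<^esub> s \<odot>\<^bsub>M\<^esub> p3 \<in> N"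
      using baerD[OF M_baer, of G2] by blast
    have rp3: "r \<odot>\<^bsub>M\<^esub> p3 \<in> N" if "r \<in> J" for r
    proof -
      have "\<ominus>\<^bsub>M\<^esub> (\<zero> \<odot>\<^bsub>M\<^esub> p2 \<ominus>\<^bsub>M\<^esub> (\<zero> \<otimes> b \<oplus> r) \<odot>\<^bsub>M\<^esub> p3) \<in> N"
        by (rule submodule_neg[OF N p3N[OF G2I[OF that R.zero_closed]]])
      moreover have "\<ominus>\<^bsub>M\<^esub> (\<zero> \<odot>\<^bsub>M\<^esub> p2 \<ominus>\<^bsub>M\<^esub> (\<zero> \<otimes> b \<oplus> r) \<odot>\<^bsub>M\<^esub> p3) = r \<odot>\<^bsub>M\<^esub> p3"
        using Jc[OF that] p2 p3 b by (simp add: M.minus_eq minus_zero_module)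
      ultimately show ?thesis by simp
    qed
    have bp3: "p2 \<ominus>\<^bsub>M\<^esub> b \<odot>\<^bsub>M\<^esub> p3 \<in> N"
      using p3N[OF G2I[OF j(2) R.one_closed]] p2 b by simp
    define K where "K = {i \<oplus> s \<otimes> b | i s. i \<in> J \<and> s \<in> carrier R}"
    note K = R.ideal_add_principal[OF Ji b, folded K_def]
    have "lifts K (p \<oplus>\<^bsub>M\<^esub> p3)"
      unfolding lifts_def
    proof (intro conjI allI impI)
      fix r x assume rx: "(r, x) \<in> G" and "r \<in> K"
      then obtain i s where e: "i \<in> J" "s \<in> carrier R" "r = i \<oplus> s \<otimes> b" unfolding K_def by blast
      have xc: "x \<in> carrier M" using g(2)[OF rx] .
      have ic: "i \<in> carrier R" using Jc[OF e(1)] .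
      have "(r \<ominus> s \<otimes> b, x \<ominus>\<^bsub>M\<^esub> s \<odot>\<^bsub>M\<^esub> q) \<in> G"
        by (rule linear_relation_minus[OF G rx g(5)[OF e(2) bq]])
      moreover have "r \<ominus> s \<otimes> b = i" unfolding e using e(2) ic b by algebra
      ultimately have 1: "(x \<ominus>\<^bsub>M\<^esub> s \<odot>\<^bsub>M\<^esub> q) \<ominus>\<^bsub>M\<^esub> i \<odot>\<^bsub>M\<^esub> p \<in> L" using pL e(1) by metis
      have 2: "i \<odot>\<^bsub>M\<^esub> p3 \<in> L" using rp3[OF e(1)] NL by blast
      have "l \<oplus>\<^bsub>M\<^esub> (p2 \<ominus>\<^bsub>M\<^esub> b \<odot>\<^bsub>M\<^esub> p3) \<in> L" by (intro submodule_add[OF L l]) (use bp3 NL in blast)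
      moreover have "l \<oplus>\<^bsub>M\<^esub> (p2 \<ominus>\<^bsub>M\<^esub> b \<odot>\<^bsub>M\<^esub> p3) = p1 \<ominus>\<^bsub>M\<^esub> b \<odot>\<^bsub>M\<^esub> p3"
        unfolding p2_def using lc p1 p3 b by algebra
      ultimately have 3: "s \<odot>\<^bsub>M\<^esub> (p1 \<ominus>\<^bsub>M\<^esub> b \<odot>\<^bsub>M\<^esub> p3) \<in> L"
        using submodule_smult[OF L e(2)] by simp
      have "x \<ominus>\<^bsub>M\<^esub> r \<odot>\<^bsub>M\<^esub> (p \<oplus>\<^bsub>M\<^esub> p3) =
        (((x \<ominus>\<^bsub>M\<^esub> s \<odot>\<^bsub>M\<^esub> q) \<ominus>\<^bsub>M\<^esub> i \<odot>\<^bsub>M\<^esub> p) \<ominus>\<^bsub>M\<^esub> i \<odot>\<^bsub>M\<^esub> p3)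
          \<oplus>\<^bsub>M\<^esub> s \<odot>\<^bsub>M\<^esub> (p1 \<ominus>\<^bsub>M\<^esub> b \<odot>\<^bsub>M\<^esub> p3)"
        unfolding p1_def e(3) using xc q pc p3 b ic e(2) by algebra
      moreover have "\<dots> \<in> L"
        by (rule submodule_add[OF L submodule_minus[OF L 1 2] 3])
      ultimately show "x \<ominus>\<^bsub>M\<^esub> r \<odot>\<^bsub>M\<^esub> (p \<oplus>\<^bsub>M\<^esub> p3) \<in> L" by simp
    qed (use pc p3 in simp)
    then have "K \<in> S" using K(1) unfolding S_def by blast
    then have "K = J" using Jmax K(2) by blast
    then show "b \<in> J" using K(3) by simp
  qed
  then show "\<exists>l\<in>carrier M. \<forall>r x. (r, x) \<in> G \<longrightarrow> x \<ominus>\<^bsub>M\<^esub> r \<odot>\<^bsub>M\<^esub> l \<in> L"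
    using pL pc by blast
qed

text \<open>
  Let \<open>K\<close> be the kernel of a homomorphism \<open>G\<close> from an ideal to the torsion submodule, and let
  \<open>c\<close> be maximal among the ideals whose intersection with the domain of \<open>G\<close> lies in \<open>K\<close>. Each
  \<open>y \<in> \<aa>\<close> has a power in \<open>c\<close>, as in the Artin-Rees lemma: for large \<open>m\<close> the ideal \<open>c : y\<^sup>m\<close> is
  stationary, and then \<open>c + R y\<^sup>m\<close> meets the domain inside \<open>K\<close> too. So \<open>G\<close> extended by \<open>0\<close> on
  \<open>c\<close> is multiplication by an element that \<open>c\<close> kills, and such an element is torsion.
\<close>
lemma (in module) baer_torsion:
  assumes noeth: "noetherian_ring R" and a: "\<aa> \<subseteq> carrier R"
    and E: "baer R M (carrier M) {\<zero>\<^bsub>M\<^esub>}"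
  shows "baer R M (tors_mod R \<aa> M {\<zero>\<^bsub>M\<^esub>}) {\<zero>\<^bsub>M\<^esub>}"
  unfolding baer_def
proof (intro allI impI, elim conjE)
  fix G assume G: "linear_relation R M G" and G0: "\<forall>x. (\<zero>, x) \<in> G \<longrightarrow> x \<in> {\<zero>\<^bsub>M\<^esub>}"
    and GT: "\<forall>r x. (r, x) \<in> G \<longrightarrow> x \<in> tors_mod R \<aa> M {\<zero>\<^bsub>M\<^esub>}"
  note g = linear_relationD[OF G]
  define S where "S = {c. ideal c R \<and> (\<forall>r x. (r, x) \<in> G \<longrightarrow> r \<in> c \<longrightarrow> x = \<zero>\<^bsub>M\<^esub>)}"
  have "{\<zero>} \<in> S" using G0 R.zeroideal unfolding S_def by auto
  moreover have "ideal J R" if "J \<in> S" for J using that by (simp add: S_def)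
  ultimately obtain c where c: "c \<in> S" and cmax: "\<And>K. K \<in> S \<Longrightarrow> c \<subseteq> K \<Longrightarrow> K = c"
    using noetherian_ring.maximal_ideal_in_family[OF noeth, of S] by blast
  have ci: "ideal c R" and cG: "\<And>r x. (r, x) \<in> G \<Longrightarrow> r \<in> c \<Longrightarrow> x = \<zero>\<^bsub>M\<^esub>"
    using c unfolding S_def by blast+
  note cc = R.ideal_closed[OF ci]
  have ccar: "r \<in> carrier R" if "r \<in> c" for r using that cc(1) by blast
  have ker: "k \<in> c" if k: "(k, \<zero>\<^bsub>M\<^esub>) \<in> G" for k
  proof -
    have kc: "k \<in> carrier R" using g(1)[OF k] .
    define K where "K = {i \<oplus> s \<otimes> k | i s. i \<in> c \<and> s \<in> carrier R}"
    note K = R.ideal_add_principal[OF ci kc, folded K_def]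
    have "x = \<zero>\<^bsub>M\<^esub>" if rx: "(r, x) \<in> G" "r \<in> K" for r x
    proof -
      obtain i s where e: "i \<in> c" "s \<in> carrier R" "r = i \<oplus> s \<otimes> k" using rx(2) unfolding K_def by blast
      have "(r \<ominus> s \<otimes> k, x \<ominus>\<^bsub>M\<^esub> s \<odot>\<^bsub>M\<^esub> \<zero>\<^bsub>M\<^esub>) \<in> G"
        by (rule linear_relation_minus[OF G rx(1) g(5)[OF e(2) k]])
      moreover have "r \<ominus> s \<otimes> k = i" unfolding e using e(2) ccar[OF e(1)] kc by algebra
      moreover have "x \<ominus>\<^bsub>M\<^esub> s \<odot>\<^bsub>M\<^esub> \<zero>\<^bsub>M\<^esub> = x" using g(2)[OF rx(1)] e(2) by algebra
      ultimately show ?thesis using cG e(1) by metis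
    qed
    then have "K \<in> S" using K(1) unfolding S_def by blast
    then show "k \<in> c" using cmax K(2,3) by blast
  qed
  have pow: "\<exists>m::nat. y [^] m \<in> c" if y: "y \<in> \<aa>" for y
  proof -
    have yc: "y \<in> carrier R" using y a by blast
    define A where "A m = {r \<in> carrier R. y [^] m \<otimes> r \<in> c}" for m :: nat
    have Ai: "ideal (A m) R" for m
    proof (rule R.ideal_intro)
      show "\<zero> \<in> A m" using yc cc(2) by (simp add: A_def)
      fix r s assume "r \<in> A m" "s \<in> A m"
      then show "r \<oplus> s \<in> A m" using yc cc(3) by (simp add: A_def R.r_distr)
    next
      fix r s assume "r \<in> carrier R" "s \<in> A m"
      then show "r \<otimes> s \<in> A m" using yc cc(5) by (simp add: A_def R.m_lcomm)
    qed (auto simp: A_def)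
    have "\<exists>I\<in>range A. \<forall>J\<in>range A. I \<subseteq> J \<longrightarrow> J = I"
      by (rule noetherian_ring.maximal_ideal_in_family[OF noeth]) (use Ai in auto)
    then obtain m where "\<forall>J\<in>range A. A m \<subseteq> J \<longrightarrow> J = A m" by (elim bexE rangeE) simp
    then have m: "A n = A m" if "A m \<subseteq> A n" for n using that by simp
    have Aadd: "A m \<subseteq> A (n + m)" for n
      using yc cc(5) by (auto simp: A_def R.nat_pow_mult[symmetric] R.m_assoc)
    have stable: "r \<in> A m" if "r \<in> A (n + m)" for r n using that m[OF Aadd] by blast
    have ymc: "y [^] m \<in> carrier R" using yc by simp
    define K where "K = {i \<oplus> s \<otimes> y [^] m | i s. i \<in> c \<and> s \<in> carrier R}"
    note K = R.ideal_add_principal[OF ci ymc, folded K_def]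
    have "x = \<zero>\<^bsub>M\<^esub>" if rx: "(r, x) \<in> G" "r \<in> K" for r x
    proof -
      obtain i s where e: "i \<in> c" "s \<in> carrier R" "r = i \<oplus> s \<otimes> y [^] m"
        using rx(2) unfolding K_def by blast
      obtain n :: nat where n: "(y [^] n) \<odot>\<^bsub>M\<^esub> x = \<zero>\<^bsub>M\<^esub>"
        using GT rx(1) y unfolding tors_mod_def by blast
      have rc: "r \<in> carrier R" using g(1) rx by blast
      have "(y [^] n \<otimes> r, \<zero>\<^bsub>M\<^esub>) \<in> G" using g(5)[OF _ rx(1), of "y [^] n"] n yc by simp
      then have 1: "y [^] n \<otimes> r \<in> c" by (rule ker)
      have "y [^] (n + m) \<otimes> s = y [^] n \<otimes> r \<oplus> \<ominus> (y [^] n \<otimes> i)"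
      proof -
        have "y [^] (n + m) \<otimes> s = (y [^] n \<otimes> y [^] m) \<otimes> s" using yc by (simp add: R.nat_pow_mult)
        also have "\<dots> = y [^] n \<otimes> r \<oplus> \<ominus> (y [^] n \<otimes> i)"
          unfolding e(3) using ymc e(2) ccar[OF e(1)] R.nat_pow_closed[OF yc, of n] by algebra
        finally show ?thesis .
      qed
      also have "\<dots> \<in> c" using 1 cc(3,4,5) e(1) yc by simp
      finally have "s \<in> A (n + m)" using e(2) by (simp add: A_def)
      then have "y [^] m \<otimes> s \<in> c" using stable unfolding A_def by blast
      then have "r \<in> c" unfolding e(3) using cc(3)[OF e(1)] R.m_comm[OF e(2) ymc] by simp
      then show ?thesis using cG rx(1) by blast
    qed
    then have "K \<in> S" using K(1) unfolding S_def by blast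
    then have "K = c" using cmax K(2) by blast
    then show ?thesis using K(3) by blast
  qed
  define G' where "G' = {(r \<oplus> s, x) | r s x. (r, x) \<in> G \<and> s \<in> c}"
  have G'I: "(r \<oplus> s, x) \<in> G'" if "(r, x) \<in> G" "s \<in> c" for r s x using that by (auto simp: G'_def)
  have "linear_relation R M G'" unfolding G'_def by (rule linear_relation_add_ideal[OF G ci])
  moreover have "x \<in> {\<zero>\<^bsub>M\<^esub>}" if z: "(\<zero>, x) \<in> G'" for x
  proof -
    obtain r1 s1 where e: "(r1, x) \<in> G" "s1 \<in> c" "\<zero> = r1 \<oplus> s1" using z unfolding G'_def by blast
    have "r1 = \<ominus> s1" using e(3) g(1)[OF e(1)] ccar[OF e(2)] R.minus_equality[of r1 s1] by simp
    then have "r1 \<in> c" using cc(4)[OF e(2)] by simp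
    then show ?thesis using cG e(1) by simp
  qed
  moreover have "x \<in> carrier M" if "(r, x) \<in> G'" for r x using that g(2) by (auto simp: G'_def)
  ultimately obtain l where l: "l \<in> carrier M"
    and lG: "\<And>s x. (s, x) \<in> G' \<Longrightarrow> x \<ominus>\<^bsub>M\<^esub> s \<odot>\<^bsub>M\<^esub> l \<in> {\<zero>\<^bsub>M\<^esub>}"
    using baerD[OF E, of G'] by blast
  have "s \<odot>\<^bsub>M\<^esub> l = \<zero>\<^bsub>M\<^esub>" if s: "s \<in> c" for s
  proof -
    have "\<zero>\<^bsub>M\<^esub> \<ominus>\<^bsub>M\<^esub> s \<odot>\<^bsub>M\<^esub> l = \<zero>\<^bsub>M\<^esub>" using lG[OF G'I[OF g(3) s]] ccar[OF s] by simp
    moreover have "s \<odot>\<^bsub>M\<^esub> l = \<ominus>\<^bsub>M\<^esub> (\<zero>\<^bsub>M\<^esub> \<ominus>\<^bsub>M\<^esub> s \<odot>\<^bsub>M\<^esub> l)" using l ccar[OF s] by algebra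
    ultimately show ?thesis by (simp add: minus_zero_module)
  qed
  then have "l \<in> tors_mod R \<aa> M {\<zero>\<^bsub>M\<^esub>}"
    using pow l unfolding tors_mod_def by blast
  moreover have "x \<ominus>\<^bsub>M\<^esub> r \<odot>\<^bsub>M\<^esub> l \<in> {\<zero>\<^bsub>M\<^esub>}" if rx: "(r, x) \<in> G" for r x
    using lG[OF G'I[OF rx cc(2)]] g(1)[OF rx] by simp
  ultimately show "\<exists>l\<in>tors_mod R \<aa> M {\<zero>\<^bsub>M\<^esub>}. \<forall>r x. (r, x) \<in> G \<longrightarrow> x \<ominus>\<^bsub>M\<^esub> r \<odot>\<^bsub>M\<^esub> l \<in> {\<zero>\<^bsub>M\<^esub>}"
    by blast
qed

lemma (in module) baer_mod_torsion:
  assumes noeth: "noetherian_ring R" and a: "\<aa> \<subseteq> carrier R"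
    and E: "baer R M (carrier M) {\<zero>\<^bsub>M\<^esub>}"
  shows "baer R M (carrier M) (tors_mod R \<aa> M {\<zero>\<^bsub>M\<^esub>})"
  using baer_quotient[OF noeth tors_mod_submodule[OF a submodule_zero_set] submodule_zero_set
    tors_mod_upper[OF submodule_zero_set a] E baer_torsion[OF assms]] .

text \<open>
  Only inclusions of an ideal into \<open>R\<close> are used as test maps, and these live on the element type
  of \<open>R\<close>.
\<close>
lemma injective_imp_baer:
  assumes "cring R" and E: "injective_module R E"
  shows "baer R E (carrier E) {\<zero>\<^bsub>E\<^esub>}"
  unfolding baer_def
proof (intro allI impI, elim conjE)
  interpret R: cring R by fact
  have "module R E" using E by (simp add: injective_module_def)
  then interpret E: module R E .
  fix G assume G: "linear_relation R E G" and G0: "\<forall>x. (\<zero>\<^bsub>R\<^esub>, x) \<in> G \<longrightarrow> x \<in> {\<zero>\<^bsub>E\<^esub>}"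
  note g = linear_relationD[OF G]
  let ?B = "regular_module R"
  have B: "module R ?B" by (rule R.regular_module)
  then interpret B: module R ?B .
  define J where "J = {r. \<exists>x. (r, x) \<in> G}"
  have J: "submodule J R ?B"
  proof (rule B.submodule_intro)
    show "J \<subseteq> carrier ?B" using g(1) by (auto simp: J_def)
    show "\<zero>\<^bsub>?B\<^esub> \<in> J" using g(3) by (auto simp: J_def)
    show "x \<oplus>\<^bsub>?B\<^esub> y \<in> J" if "x \<in> J" "y \<in> J" for x y
      using that g(4) unfolding J_def by simp blast
    show "r \<odot>\<^bsub>?B\<^esub> x \<in> J" if "r \<in> carrier R" "x \<in> J" for r x
      using that g(5) unfolding J_def by simp blast
  qed
  define A where "A = ?B\<lparr>carrier := J\<rparr>"
  have A: "module R A" unfolding A_def by (rule submodule.submodule_is_module[OF J B])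
  have [simp]: "carrier A = J" "ring.add A = ring.add R" "smult A = monoid.mult R" by (simp_all add: A_def)
  have uniq: "x = y" if "(r, x) \<in> G" "(r, y) \<in> G" for r x y
  proof -
    have "(r \<ominus>\<^bsub>R\<^esub> r, x \<ominus>\<^bsub>E\<^esub> y) \<in> G" by (rule E.linear_relation_minus[OF G that])
    then have "x \<ominus>\<^bsub>E\<^esub> y = \<zero>\<^bsub>E\<^esub>" using G0 g(1)[OF that(1)] by (simp add: R.minus_eq R.r_neg)
    then show ?thesis using g(2) that by (metis E.M.minus_eq E.M.minus_equality E.M.minus_minus E.M.a_inv_closed)
  qed
  define \<phi> where "\<phi> r = (THE x. (r, x) \<in> G)" for r
  have \<phi>: "\<phi> r = x" if "(r, x) \<in> G" for r x
    unfolding \<phi>_def using that uniq by blast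
  have "\<phi> \<in> mod_hom R A E"
  proof (rule mod_homI)
    show "\<phi> x \<in> carrier E" if "x \<in> carrier A" for x using that \<phi> g(2) by (auto simp: J_def)
    show "\<phi> (x \<oplus>\<^bsub>A\<^esub> y) = \<phi> x \<oplus>\<^bsub>E\<^esub> \<phi> y" if "x \<in> carrier A" "y \<in> carrier A" for x y
      using that \<phi> g(4) by (auto simp: J_def)
    show "\<phi> (r \<odot>\<^bsub>A\<^esub> x) = r \<odot>\<^bsub>E\<^esub> \<phi> x" if "r \<in> carrier R" "x \<in> carrier A" for r x
      using that \<phi> g(5) by (auto simp: J_def)
  qed
  moreover have "id \<in> mod_hom R A ?B"
    using B.submoduleE(1)[OF J] by (intro mod_homI) auto
  ultimately obtain h where h: "h \<in> mod_hom R ?B E" "\<And>x. x \<in> J \<Longrightarrow> h x = \<phi> x"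
    using E A B unfolding injective_module_def by (metis \<open>carrier A = J\<close> id_apply inj_on_id)
  have h1: "h \<one>\<^bsub>R\<^esub> \<in> carrier E" using mod_homD(1)[OF h(1), of "\<one>\<^bsub>R\<^esub>"] by simp
  have "x \<ominus>\<^bsub>E\<^esub> r \<odot>\<^bsub>E\<^esub> h \<one>\<^bsub>R\<^esub> = \<zero>\<^bsub>E\<^esub>" if rx: "(r, x) \<in> G" for r x
  proof -
    have "r \<odot>\<^bsub>E\<^esub> h \<one>\<^bsub>R\<^esub> = h (r \<odot>\<^bsub>?B\<^esub> \<one>\<^bsub>R\<^esub>)"
      using mod_homD(3)[OF h(1), of r "\<one>\<^bsub>R\<^esub>"] g(1)[OF rx] by simp
    also have "\<dots> = x" using h(2)[of r] \<phi>[OF rx] rx g(1)[OF rx] by (auto simp: J_def)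
    finally show ?thesis using g(2)[OF rx] by (simp add: E.M.minus_eq E.M.r_neg)
  qed
  then show "\<exists>l\<in>carrier E. \<forall>r x. (r, x) \<in> G \<longrightarrow> x \<ominus>\<^bsub>E\<^esub> r \<odot>\<^bsub>E\<^esub> l \<in> {\<zero>\<^bsub>E\<^esub>}"
    using h1 by blast
qed

section \<open>Cochain complexes\<close>

definition cycles :: "(int \<Rightarrow> ('a, 'e, 'n) module_scheme) \<Rightarrow> (int \<Rightarrow> 'e \<Rightarrow> 'e) \<Rightarrow> int \<Rightarrow> 'e set"
  where "cycles C D i = {u \<in> carrier (C i). D i u = \<zero>\<^bsub>C (i + 1)\<^esub>}"

definition boundaries :: "(int \<Rightarrow> ('a, 'e, 'n) module_scheme) \<Rightarrow> (int \<Rightarrow> 'e \<Rightarrow> 'e) \<Rightarrow> int \<Rightarrow> 'e set"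
  where "boundaries C D i = D (i - 1) ` carrier (C (i - 1))"

locale cochain_complex =
  fixes R :: "('a, 'r) ring_scheme" and C :: "int \<Rightarrow> ('a, 'e, 'n) module_scheme"
    and D :: "int \<Rightarrow> 'e \<Rightarrow> 'e"
  assumes module_C: "module R (C i)"
    and D_hom: "D i \<in> mod_hom R (C i) (C (i + 1))"
    and D_D: "u \<in> carrier (C i) \<Longrightarrow> D (i + 1) (D i u) = \<zero>\<^bsub>C (i + 1 + 1)\<^esub>"
begin

lemma D_hom_pred: "D (i - 1) \<in> mod_hom R (C (i - 1)) (C i)"
  using D_hom[of "i - 1"] by simp

lemma D_closed [simp]: "u \<in> carrier (C i) \<Longrightarrow> D i u \<in> carrier (C (i + 1))"
  using mod_homD(1)[OF D_hom] .

lemma D_add: "u \<in> carrier (C i) \<Longrightarrow> v \<in> carrier (C i) \<Longrightarrow>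
    D i (u \<oplus>\<^bsub>C i\<^esub> v) = D i u \<oplus>\<^bsub>C (i + 1)\<^esub> D i v"
  using mod_homD(2)[OF D_hom] .

lemma D_smult: "r \<in> carrier R \<Longrightarrow> u \<in> carrier (C i) \<Longrightarrow> D i (r \<odot>\<^bsub>C i\<^esub> u) = r \<odot>\<^bsub>C (i + 1)\<^esub> D i u"
  using mod_homD(3)[OF D_hom] .

lemma D_zero: "D i \<zero>\<^bsub>C i\<^esub> = \<zero>\<^bsub>C (i + 1)\<^esub>"
  by (rule mod_hom_zero[OF module_C module_C D_hom])

lemma D_neg: "u \<in> carrier (C i) \<Longrightarrow> D i (\<ominus>\<^bsub>C i\<^esub> u) = \<ominus>\<^bsub>C (i + 1)\<^esub> D i u"
  by (rule mod_hom_neg[OF module_C module_C D_hom])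

lemma D_minus: "u \<in> carrier (C i) \<Longrightarrow> v \<in> carrier (C i) \<Longrightarrow>
    D i (u \<ominus>\<^bsub>C i\<^esub> v) = D i u \<ominus>\<^bsub>C (i + 1)\<^esub> D i v"
  by (rule mod_hom_minus[OF module_C module_C D_hom])

lemma boundaries_succ: "boundaries C D (i + 1) = D i ` carrier (C i)"
  by (simp add: boundaries_def)

lemma cycles_submodule: "submodule (cycles C D i) R (C i)"
proof -
  interpret Ci: module R "C i" by (rule module_C)
  interpret Cj: module R "C (i + 1)" by (rule module_C)
  show ?thesis
    by (rule Ci.submodule_intro) (auto simp: cycles_def D_zero D_add D_smult)
qed

lemma boundaries_submodule: "submodule (boundaries C D i) R (C i)"
proof -
  interpret Ci: module R "C i" by (rule module_C)
  interpret Cj: module R "C (i - 1)" by (rule module_C)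
  note h = mod_homD[OF D_hom_pred[of i]]
  show ?thesis
  proof (rule Ci.submodule_intro)
    show "boundaries C D i \<subseteq> carrier (C i)" using h(1) by (auto simp: boundaries_def)
    show "\<zero>\<^bsub>C i\<^esub> \<in> boundaries C D i"
      using mod_hom_zero[OF module_C module_C D_hom_pred[of i]] unfolding boundaries_def
      by (metis Cj.M.zero_closed image_eqI)
    fix x y assume "x \<in> boundaries C D i" "y \<in> boundaries C D i"
    then obtain u v where "u \<in> carrier (C (i - 1))" "v \<in> carrier (C (i - 1))"
      "x = D (i - 1) u" "y = D (i - 1) v" unfolding boundaries_def by blast
    then show "x \<oplus>\<^bsub>C i\<^esub> y \<in> boundaries C D i"
      using h(2)[of u v] unfolding boundaries_def by (intro image_eqI[of _ _ "u \<oplus>\<^bsub>C (i - 1)\<^esub> v"]) auto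
  next
    fix r x assume r: "r \<in> carrier R" and "x \<in> boundaries C D i"
    then obtain u where "u \<in> carrier (C (i - 1))" "x = D (i - 1) u" unfolding boundaries_def by blast
    then show "r \<odot>\<^bsub>C i\<^esub> x \<in> boundaries C D i"
      using h(3)[OF r, of u] r unfolding boundaries_def by (intro image_eqI[of _ _ "r \<odot>\<^bsub>C (i - 1)\<^esub> u"]) auto
  qed
qed

lemma boundaries_cycles: "boundaries C D i \<subseteq> cycles C D i"
proof
  fix z assume "z \<in> boundaries C D i"
  then obtain u where u: "u \<in> carrier (C (i - 1))" "z = D (i - 1) u" unfolding boundaries_def by blast
  then show "z \<in> cycles C D i"
    using mod_homD(1)[OF D_hom_pred u(1)] D_D[OF u(1)] by (simp add: cycles_def)
qed

end

section \<open>Mapping cones\<close>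

(* Otherwise indices such as i + 1 + 1 are rewritten to 2 + i and no longer match the degrees of
   the differentials. *)
declare [[simproc del: int_combine_numerals]]


text \<open>
  The iterated cone construction has to stay within one type of elements. Interleaving identifies
  pairs of sequences with sequences.
\<close>
definition evens :: "(nat \<Rightarrow> 'e) \<Rightarrow> nat \<Rightarrow> 'e" where "evens f n = f (2 * n)"
definition odds :: "(nat \<Rightarrow> 'e) \<Rightarrow> nat \<Rightarrow> 'e" where "odds f n = f (2 * n + 1)"
definition interleave :: "(nat \<Rightarrow> 'e) \<Rightarrow> (nat \<Rightarrow> 'e) \<Rightarrow> nat \<Rightarrow> 'e"
  where "interleave u v n = (if even n then u (n div 2) else v (n div 2))"

lemma interleave_simps [simp]:
  "evens (interleave u v) = u" "odds (interleave u v) = v" "interleave (evens f) (odds f) = f"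
  by (auto simp: evens_def odds_def interleave_def fun_eq_iff elim: oddE)

lemma interleave_eq_iff [simp]: "interleave u v = interleave u' v' \<longleftrightarrow> u = u' \<and> v = v'"
  by (metis interleave_simps(1,2))

lemma interleave_cases: obtains u v where "f = interleave u v"
  using interleave_simps(3) by metis

definition pair_module ::
    "('a, nat \<Rightarrow> 'e, 'm) module_scheme \<Rightarrow> ('a, nat \<Rightarrow> 'e, 'm) module_scheme \<Rightarrow> ('a, nat \<Rightarrow> 'e) module"
  where "pair_module M N =
    \<lparr>carrier = {f. evens f \<in> carrier M \<and> odds f \<in> carrier N},
     monoid.mult = (\<lambda>_ _. undefined), one = undefined,
     ring.zero = interleave \<zero>\<^bsub>M\<^esub> \<zero>\<^bsub>N\<^esub>,
     ring.add = (\<lambda>f g. interleave (evens f \<oplus>\<^bsub>M\<^esub> evens g) (odds f \<oplus>\<^bsub>N\<^esub> odds g)),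
     smult = (\<lambda>r f. interleave (r \<odot>\<^bsub>M\<^esub> evens f) (r \<odot>\<^bsub>N\<^esub> odds f))\<rparr>"

lemma pair_module_simps [simp]:
  "interleave u v \<in> carrier (pair_module M N) \<longleftrightarrow> u \<in> carrier M \<and> v \<in> carrier N"
  "\<zero>\<^bsub>pair_module M N\<^esub> = interleave \<zero>\<^bsub>M\<^esub> \<zero>\<^bsub>N\<^esub>"
  "interleave u v \<oplus>\<^bsub>pair_module M N\<^esub> interleave u' v' = interleave (u \<oplus>\<^bsub>M\<^esub> u') (v \<oplus>\<^bsub>N\<^esub> v')"
  "r \<odot>\<^bsub>pair_module M N\<^esub> interleave u v = interleave (r \<odot>\<^bsub>M\<^esub> u) (r \<odot>\<^bsub>N\<^esub> v)"
  by (simp_all add: pair_module_def)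

lemma pair_module_module:
  assumes "module R M" "module R N"
  shows "module R (pair_module M N)"
proof -
  interpret M: module R M by fact
  interpret N: module R N by fact
  show ?thesis
  proof (rule moduleI[OF M.R.is_cring])
    show "abelian_group (pair_module M N)"
    proof (rule abelian_groupI)
      fix f g h
      assume f: "f \<in> carrier (pair_module M N)" and g: "g \<in> carrier (pair_module M N)"
      obtain u v where fe: "f = interleave u v" by (rule interleave_cases)
      obtain u' v' where ge: "g = interleave u' v'" by (rule interleave_cases)
      show "f \<oplus>\<^bsub>pair_module M N\<^esub> g \<in> carrier (pair_module M N)" using f g unfolding fe ge by simp
      show "f \<oplus>\<^bsub>pair_module M N\<^esub> g = g \<oplus>\<^bsub>pair_module M N\<^esub> f"
        using f g unfolding fe ge by (simp add: M.M.a_comm N.M.a_comm)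
      assume h: "h \<in> carrier (pair_module M N)"
      obtain u'' v'' where he: "h = interleave u'' v''" by (rule interleave_cases)
      show "f \<oplus>\<^bsub>pair_module M N\<^esub> g \<oplus>\<^bsub>pair_module M N\<^esub> h =
          f \<oplus>\<^bsub>pair_module M N\<^esub> (g \<oplus>\<^bsub>pair_module M N\<^esub> h)"
        using f g h unfolding fe ge he by (simp add: M.M.a_assoc N.M.a_assoc)
    next
      fix f assume f: "f \<in> carrier (pair_module M N)"
      obtain u v where fe: "f = interleave u v" by (rule interleave_cases)
      show "\<zero>\<^bsub>pair_module M N\<^esub> \<oplus>\<^bsub>pair_module M N\<^esub> f = f" using f unfolding fe by simp
      show "\<exists>g\<in>carrier (pair_module M N). g \<oplus>\<^bsub>pair_module M N\<^esub> f = \<zero>\<^bsub>pair_module M N\<^esub>"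
        using f unfolding fe
        by (intro bexI[of _ "interleave (\<ominus>\<^bsub>M\<^esub> u) (\<ominus>\<^bsub>N\<^esub> v)"]) (auto simp: M.M.l_neg N.M.l_neg)
    qed simp
  next
    fix r s f g
    assume rs: "r \<in> carrier R" "s \<in> carrier R"
      and f: "f \<in> carrier (pair_module M N)" and g: "g \<in> carrier (pair_module M N)"
    obtain u v where fe: "f = interleave u v" by (rule interleave_cases)
    obtain u' v' where ge: "g = interleave u' v'" by (rule interleave_cases)
    show "(r \<oplus>\<^bsub>R\<^esub> s) \<odot>\<^bsub>pair_module M N\<^esub> f =
        r \<odot>\<^bsub>pair_module M N\<^esub> f \<oplus>\<^bsub>pair_module M N\<^esub> s \<odot>\<^bsub>pair_module M N\<^esub> f"
      using f rs unfolding fe by (simp add: M.smult_l_distr N.smult_l_distr)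
    show "(r \<otimes>\<^bsub>R\<^esub> s) \<odot>\<^bsub>pair_module M N\<^esub> f = r \<odot>\<^bsub>pair_module M N\<^esub> (s \<odot>\<^bsub>pair_module M N\<^esub> f)"
      using f rs unfolding fe by (simp add: M.smult_assoc1 N.smult_assoc1)
    show "r \<odot>\<^bsub>pair_module M N\<^esub> (f \<oplus>\<^bsub>pair_module M N\<^esub> g) =
        r \<odot>\<^bsub>pair_module M N\<^esub> f \<oplus>\<^bsub>pair_module M N\<^esub> r \<odot>\<^bsub>pair_module M N\<^esub> g"
      using f g rs unfolding fe ge by (simp add: M.smult_r_distr N.smult_r_distr)
    show "r \<odot>\<^bsub>pair_module M N\<^esub> f \<in> carrier (pair_module M N)" using f rs unfolding fe by simp
  next
    fix f assume f: "f \<in> carrier (pair_module M N)"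
    obtain u v where fe: "f = interleave u v" by (rule interleave_cases)
    show "\<one>\<^bsub>R\<^esub> \<odot>\<^bsub>pair_module M N\<^esub> f = f" using f unfolding fe by simp
  qed
qed

definition cone :: "(int \<Rightarrow> ('a, nat \<Rightarrow> 'e, 'm) module_scheme) \<Rightarrow> int \<Rightarrow> ('a, nat \<Rightarrow> 'e) module"
  where "cone C i = pair_module (C i) (C (i + 1))"

text \<open>
  The differential \<open>(u, v) \<mapsto> (d u + x v, - d v)\<close>. The sign is multiplication by the scalar
  \<open>-1\<close>, which does not refer to the carrier of \<open>C\<close>: so the same function is the differential for
  subcomplexes such as the torsion of \<open>C\<close>.
\<close>
definition cone_diff ::
    "('a, 'r) ring_scheme \<Rightarrow> (int \<Rightarrow> ('a, nat \<Rightarrow> 'e, 'm) module_scheme) \<Rightarrow> (int \<Rightarrow> (nat \<Rightarrow> 'e) \<Rightarrow> nat \<Rightarrow> 'e) \<Rightarrow> 'a \<Rightarrow>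
      int \<Rightarrow> (nat \<Rightarrow> 'e) \<Rightarrow> nat \<Rightarrow> 'e"
  where "cone_diff R C D x i f =
    interleave (D i (evens f) \<oplus>\<^bsub>C (i + 1)\<^esub> x \<odot>\<^bsub>C (i + 1)\<^esub> odds f) 
      ((\<ominus>\<^bsub>R\<^esub> \<one>\<^bsub>R\<^esub>) \<odot>\<^bsub>C (i + 1 + 1)\<^esub> D (i + 1) (odds f))"

locale cone_complex = cochain_complex R C D
  for R :: "('a, 'r) ring_scheme" and C :: "int \<Rightarrow> ('a, nat \<Rightarrow> 'e, 'm) module_scheme"
    and D :: "int \<Rightarrow> (nat \<Rightarrow> 'e) \<Rightarrow> nat \<Rightarrow> 'e" +
  fixes x :: 'a
  assumes x: "x \<in> carrier R"
begin

lemma cone_diff_interleave [simp]: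
  assumes "v \<in> carrier (C (i + 1))"
  shows "cone_diff R C D x i (interleave u v) =
    interleave (D i u \<oplus>\<^bsub>C (i + 1)\<^esub> x \<odot>\<^bsub>C (i + 1)\<^esub> v) (\<ominus>\<^bsub>C (i + 1 + 1)\<^esub> D (i + 1) v)"
proof -
  interpret C2: module R "C (i + 1 + 1)" by (rule module_C)
  show ?thesis using D_closed[OF assms] C2.smult_l_minus[of "\<one>\<^bsub>R\<^esub>" "D (i + 1) v"]
    by (simp add: cone_diff_def)
qed

lemma cone_is_complex: "cochain_complex R (cone C) (cone_diff R C D x)"
proof (rule cochain_complex.intro)
  fix i
  interpret C0: module R "C i" by (rule module_C)
  interpret C1: module R "C (i + 1)" by (rule module_C)
  interpret C2: module R "C (i + 1 + 1)" by (rule module_C)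
  interpret C3: module R "C (i + 1 + 1 + 1)" by (rule module_C)
  show "module R (cone C i)" unfolding cone_def by (rule pair_module_module[OF module_C module_C])
  show "cone_diff R C D x i \<in> mod_hom R (cone C i) (cone C (i + 1))"
  proof (rule mod_homI)
    fix f assume f: "f \<in> carrier (cone C i)"
    obtain u v where fe: "f = interleave u v" by (rule interleave_cases)
    show "cone_diff R C D x i f \<in> carrier (cone C (i + 1))"
      using f x unfolding fe by (simp add: cone_def)
    fix g assume g: "g \<in> carrier (cone C i)"
    obtain u' v' where ge: "g = interleave u' v'" by (rule interleave_cases)
    show "cone_diff R C D x i (f \<oplus>\<^bsub>cone C i\<^esub> g) =
        cone_diff R C D x i f \<oplus>\<^bsub>cone C (i + 1)\<^esub> cone_diff R C D x i g"
      using f g x unfolding fe ge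
      by (simp add: cone_def D_add C1.smult_r_distr C1.M.a_ac C2.M.minus_add C2.M.a_ac)
  next
    fix r f assume r: "r \<in> carrier R" and f: "f \<in> carrier (cone C i)"
    obtain u v where fe: "f = interleave u v" by (rule interleave_cases)
    show "cone_diff R C D x i (r \<odot>\<^bsub>cone C i\<^esub> f) = r \<odot>\<^bsub>cone C (i + 1)\<^esub> cone_diff R C D x i f"
      using f x r unfolding fe
      by (simp add: cone_def D_smult C1.smult_r_distr C2.smult_r_minus C1.smult_left_commute)
  qed
  fix f assume f: "f \<in> carrier (cone C i)"
  obtain u v where fe: "f = interleave u v" by (rule interleave_cases)
  have "D (i + 1) (x \<odot>\<^bsub>C (i + 1)\<^esub> v) \<oplus>\<^bsub>C (i + 1 + 1)\<^esub> x \<odot>\<^bsub>C (i + 1 + 1)\<^esub> (\<ominus>\<^bsub>C (i + 1 + 1)\<^esub> D (i + 1) v) =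
      \<zero>\<^bsub>C (i + 1 + 1)\<^esub>"
    using f x unfolding fe by (simp add: cone_def D_smult C2.smult_r_minus C2.M.r_neg)
  then show "cone_diff R C D x (i + 1) (cone_diff R C D x i f) = \<zero>\<^bsub>cone C (i + 1 + 1)\<^esub>"
    using f x unfolding fe
    by (simp add: cone_def D_add D_D D_neg C3.minus_zero_module)
qed

sublocale cone: cochain_complex R "cone C" "cone_diff R C D x"
  by (rule cone_is_complex)

lemma cone_carrier [simp]:
  "interleave u v \<in> carrier (cone C i) \<longleftrightarrow> u \<in> carrier (C i) \<and> v \<in> carrier (C (i + 1))"
  by (simp add: cone_def)

lemma cone_smult [simp]:
  "r \<odot>\<^bsub>cone C i\<^esub> interleave u v = interleave (r \<odot>\<^bsub>C i\<^esub> u) (r \<odot>\<^bsub>C (i + 1)\<^esub> v)"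
  by (simp add: cone_def)

lemma cone_cycles_iff:
  "interleave u v \<in> cycles (cone C) (cone_diff R C D x) i \<longleftrightarrow>
    u \<in> carrier (C i) \<and> v \<in> cycles C D (i + 1) \<and>
    D i u \<oplus>\<^bsub>C (i + 1)\<^esub> x \<odot>\<^bsub>C (i + 1)\<^esub> v = \<zero>\<^bsub>C (i + 1)\<^esub>"
proof -
  interpret C2: module R "C (i + 1 + 1)" by (rule module_C)
  have "\<ominus>\<^bsub>C (i + 1 + 1)\<^esub> D (i + 1) v = \<zero>\<^bsub>C (i + 1 + 1)\<^esub> \<longleftrightarrow> D (i + 1) v = \<zero>\<^bsub>C (i + 1 + 1)\<^esub>"
    if "v \<in> carrier (C (i + 1))"
    using C2.M.minus_minus[OF D_closed[OF that]] C2.minus_zero_module by metis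
  then show ?thesis by (auto simp: cycles_def cone_def)
qed

lemma cone_boundaries_iff:
  assumes u: "u \<in> carrier (C i)" and v: "v \<in> carrier (C (i + 1))"
  shows "interleave u v \<in> boundaries (cone C) (cone_diff R C D x) i \<longleftrightarrow>
    (\<exists>w\<in>carrier (C i). v = D i w \<and> u \<oplus>\<^bsub>C i\<^esub> x \<odot>\<^bsub>C i\<^esub> w \<in> boundaries C D i)" (is "?l \<longleftrightarrow> ?r")
proof -
  interpret C0: module R "C i" by (rule module_C)
  interpret C1: module R "C (i + 1)" by (rule module_C)
  have D0: "D (i - 1) u' \<in> carrier (C i)" if "u' \<in> carrier (C (i - 1))" for u'
    using mod_homD(1)[OF D_hom_pred that] .
  show ?thesis
  proof
    assume ?l
    then obtain f where f: "f \<in> carrier (cone C (i - 1))"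
      "interleave u v = cone_diff R C D x (i - 1) f" unfolding boundaries_def by blast
    obtain u' w where fe: "f = interleave u' w" by (rule interleave_cases)
    have e: "u' \<in> carrier (C (i - 1))" "w \<in> carrier (C i)"
      "u = D (i - 1) u' \<oplus>\<^bsub>C i\<^esub> x \<odot>\<^bsub>C i\<^esub> w" "v = \<ominus>\<^bsub>C (i + 1)\<^esub> D i w"
      using f unfolding fe by simp_all
    have "v = D i (\<ominus>\<^bsub>C i\<^esub> w)" using e(2,4) by (simp add: D_neg)
    moreover have "u \<oplus>\<^bsub>C i\<^esub> x \<odot>\<^bsub>C i\<^esub> (\<ominus>\<^bsub>C i\<^esub> w) = D (i - 1) u'"
      unfolding e(3) using D0[OF e(1)] e(2) x by algebra
    ultimately show ?r using e(1,2) unfolding boundaries_def by (metis C0.M.a_inv_closed image_eqI)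
  next
    assume ?r
    then obtain w u' where e: "w \<in> carrier (C i)" "v = D i w" "u' \<in> carrier (C (i - 1))"
      "u \<oplus>\<^bsub>C i\<^esub> x \<odot>\<^bsub>C i\<^esub> w = D (i - 1) u'" unfolding boundaries_def by blast
    have "(u \<oplus>\<^bsub>C i\<^esub> x \<odot>\<^bsub>C i\<^esub> w) \<oplus>\<^bsub>C i\<^esub> x \<odot>\<^bsub>C i\<^esub> (\<ominus>\<^bsub>C i\<^esub> w) = u"
      using u e(1) x by algebra
    then have "interleave u v = cone_diff R C D x (i - 1) (interleave u' (\<ominus>\<^bsub>C i\<^esub> w))"
      using e by (simp add: D_neg)
    moreover have "interleave u' (\<ominus>\<^bsub>C i\<^esub> w) \<in> carrier (cone C (i - 1))" using e by simp
    ultimately show ?l unfolding boundaries_def by blast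
  qed
qed

end

section \<open>Associated primes of the cohomology of a cone\<close>

text \<open>
  A multiple \<open>r z\<close> with \<open>r \<notin> p\<close> has the same annihilator \<open>p\<close> modulo \<open>B\<close> as \<open>z\<close>; and if no such
  multiple lies in \<open>L\<close>, then \<open>p\<close> is also the annihilator of \<open>z\<close> modulo \<open>L\<close>. This places the
  associated primes of an extension among those of its two parts.
\<close>
lemma (in module) prime_colon_dichotomy:
  assumes p: "primeideal p R" "p = colon R M B z" and z: "z \<in> carrier M" and BL: "B \<subseteq> L"
  obtains "p = colon R M L z"
  | r where "r \<in> carrier R" "r \<odot>\<^bsub>M\<^esub> z \<in> L" "p = colon R M B (r \<odot>\<^bsub>M\<^esub> z)"
proof (cases "\<exists>r\<in>carrier R - p. r \<odot>\<^bsub>M\<^esub> z \<in> L")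
  case True
  then obtain r where r: "r \<in> carrier R" "r \<notin> p" "r \<odot>\<^bsub>M\<^esub> z \<in> L" by blast
  interpret p: primeideal p R by (rule p)
  have "s \<in> p \<longleftrightarrow> s \<odot>\<^bsub>M\<^esub> (r \<odot>\<^bsub>M\<^esub> z) \<in> B" if s: "s \<in> carrier R" for s
  proof -
    have "s \<in> p \<longleftrightarrow> s \<otimes> r \<in> p" using p.I_prime[of s r] p.I_r_closed[of s r] r s by blast
    also have "\<dots> \<longleftrightarrow> s \<odot>\<^bsub>M\<^esub> (r \<odot>\<^bsub>M\<^esub> z) \<in> B"
      unfolding p(2) colon_def using s r(1) z by (simp add: smult_assoc1)
    finally show ?thesis .
  qed
  then have "p = colon R M B (r \<odot>\<^bsub>M\<^esub> z)" using p.a_subset unfolding colon_def by blast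
  then show thesis using that r by blast
next
  case False
  then have "p = colon R M L z" using BL unfolding p(2) colon_def by blast
  then show thesis using that by blast
qed

definition kills_cohomology where
  "kills_cohomology I C D i \<longleftrightarrow> (\<forall>r\<in>I. \<forall>z\<in>cycles C D i. r \<odot>\<^bsub>C i\<^esub> z \<in> boundaries C D i)"

definition coh_Ass where
  "coh_Ass R C D i = subquot_Ass R (C i) (cycles C D i) (boundaries C D i)"

text \<open>
  The lift of \<open>v\<close> to a cocycle \<open>(u, v)\<close> of the cone. By \<open>cone_boundaries_iff\<close> the last
  condition makes \<open>r (u, v)\<close> a boundary whenever \<open>r v\<close> is one, so that lifting does not enlarge
  annihilators. The induction follows the generation of \<open>I I\<close> by products and sums: for a product
  \<open>a b\<close>, take \<open>u = - a w\<^sub>b\<close> with \<open>b v = D w\<^sub>b\<close>.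
\<close>
lemma (in cone_complex) splitting_lift:
  assumes I: "ideal I R" and xII: "x' \<in> ideal_prod R I I"
    and kills: "kills_cohomology I C D i"
    and v: "v \<in> cycles C D (i + 1)" and Iv: "I \<subseteq> colon R (C (i + 1)) (boundaries C D (i + 1)) v"
  shows "\<exists>u\<in>carrier (C i). D i u \<oplus>\<^bsub>C (i + 1)\<^esub> x' \<odot>\<^bsub>C (i + 1)\<^esub> v = \<zero>\<^bsub>C (i + 1)\<^esub> \<and>
    (\<forall>r\<in>carrier R. \<forall>w\<in>carrier (C i). D i w = r \<odot>\<^bsub>C (i + 1)\<^esub> v \<longrightarrow>
      r \<odot>\<^bsub>C i\<^esub> u \<oplus>\<^bsub>C i\<^esub> x' \<odot>\<^bsub>C i\<^esub> w \<in> boundaries C D i)"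
  using xII
proof (induction x')
  interpret C0: module R "C i" by (rule module_C)
  interpret C1: module R "C (i + 1)" by (rule module_C)
  note Ic = C0.R.ideal_closed(1)[OF I]
  have vc: "v \<in> carrier (C (i + 1))" using v by (simp add: cycles_def)
  {
    case (prod a b)
    then have ab: "a \<in> carrier R" "b \<in> carrier R" using Ic by auto
    have "b \<odot>\<^bsub>C (i + 1)\<^esub> v \<in> boundaries C D (i + 1)" using Iv prod(2) by (auto simp: colon_def)
    then obtain wb where wb: "wb \<in> carrier (C i)" "b \<odot>\<^bsub>C (i + 1)\<^esub> v = D i wb"
      unfolding boundaries_succ by blast
    define u where "u = \<ominus>\<^bsub>C i\<^esub> (a \<odot>\<^bsub>C i\<^esub> wb)"
    have u: "u \<in> carrier (C i)" using ab wb by (simp add: u_def)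
    have "D i u \<oplus>\<^bsub>C (i + 1)\<^esub> (a \<otimes>\<^bsub>R\<^esub> b) \<odot>\<^bsub>C (i + 1)\<^esub> v = \<zero>\<^bsub>C (i + 1)\<^esub>"
      using ab wb vc by (simp add: u_def D_neg D_smult C1.smult_assoc1 C1.M.l_neg)
    moreover have "r \<odot>\<^bsub>C i\<^esub> u \<oplus>\<^bsub>C i\<^esub> (a \<otimes>\<^bsub>R\<^esub> b) \<odot>\<^bsub>C i\<^esub> w \<in> boundaries C D i"
      if r: "r \<in> carrier R" and w: "w \<in> carrier (C i)" "D i w = r \<odot>\<^bsub>C (i + 1)\<^esub> v" for r w
    proof -
      have "D i (b \<odot>\<^bsub>C i\<^esub> w \<ominus>\<^bsub>C i\<^esub> r \<odot>\<^bsub>C i\<^esub> wb) = \<zero>\<^bsub>C (i + 1)\<^esub>"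
        using ab r w wb vc
        by (simp add: D_minus D_smult wb(2)[symmetric] C1.smult_left_commute C1.M.minus_eq C1.M.r_neg)
      then have "b \<odot>\<^bsub>C i\<^esub> w \<ominus>\<^bsub>C i\<^esub> r \<odot>\<^bsub>C i\<^esub> wb \<in> cycles C D i"
        using ab r w wb by (simp add: cycles_def)
      then have "a \<odot>\<^bsub>C i\<^esub> (b \<odot>\<^bsub>C i\<^esub> w \<ominus>\<^bsub>C i\<^esub> r \<odot>\<^bsub>C i\<^esub> wb) \<in> boundaries C D i"
        using kills prod(1) by (simp add: kills_cohomology_def)
      moreover have "a \<odot>\<^bsub>C i\<^esub> (b \<odot>\<^bsub>C i\<^esub> w \<ominus>\<^bsub>C i\<^esub> r \<odot>\<^bsub>C i\<^esub> wb) =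
          r \<odot>\<^bsub>C i\<^esub> u \<oplus>\<^bsub>C i\<^esub> (a \<otimes>\<^bsub>R\<^esub> b) \<odot>\<^bsub>C i\<^esub> w"
        unfolding u_def using ab r w(1) wb(1) by algebra
      ultimately show ?thesis by simp
    qed
    ultimately show ?case using u by blast
  next
    case (sum s1 s2)
    have s: "s1 \<in> carrier R" "s2 \<in> carrier R"
      using sum(1,2) C0.R.ideal_prod_in_carrier[OF I I] by auto
    from sum.IH obtain u1 u2 where u: "u1 \<in> carrier (C i)" "u2 \<in> carrier (C i)"
      "D i u1 \<oplus>\<^bsub>C (i + 1)\<^esub> s1 \<odot>\<^bsub>C (i + 1)\<^esub> v = \<zero>\<^bsub>C (i + 1)\<^esub>"
      "D i u2 \<oplus>\<^bsub>C (i + 1)\<^esub> s2 \<odot>\<^bsub>C (i + 1)\<^esub> v = \<zero>\<^bsub>C (i + 1)\<^esub>"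
      and ub: "\<And>r w. r \<in> carrier R \<Longrightarrow> w \<in> carrier (C i) \<Longrightarrow> D i w = r \<odot>\<^bsub>C (i + 1)\<^esub> v \<Longrightarrow>
        r \<odot>\<^bsub>C i\<^esub> u1 \<oplus>\<^bsub>C i\<^esub> s1 \<odot>\<^bsub>C i\<^esub> w \<in> boundaries C D i \<and>
        r \<odot>\<^bsub>C i\<^esub> u2 \<oplus>\<^bsub>C i\<^esub> s2 \<odot>\<^bsub>C i\<^esub> w \<in> boundaries C D i" by blast
    have "D i (u1 \<oplus>\<^bsub>C i\<^esub> u2) \<oplus>\<^bsub>C (i + 1)\<^esub> (s1 \<oplus>\<^bsub>R\<^esub> s2) \<odot>\<^bsub>C (i + 1)\<^esub> v =
      (D i u1 \<oplus>\<^bsub>C (i + 1)\<^esub> s1 \<odot>\<^bsub>C (i + 1)\<^esub> v) \<oplus>\<^bsub>C (i + 1)\<^esub>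
      (D i u2 \<oplus>\<^bsub>C (i + 1)\<^esub> s2 \<odot>\<^bsub>C (i + 1)\<^esub> v)"
      using u(1,2) s vc by (simp add: D_add C1.smult_l_distr C1.M.a_ac)
    then have "D i (u1 \<oplus>\<^bsub>C i\<^esub> u2) \<oplus>\<^bsub>C (i + 1)\<^esub> (s1 \<oplus>\<^bsub>R\<^esub> s2) \<odot>\<^bsub>C (i + 1)\<^esub> v = \<zero>\<^bsub>C (i + 1)\<^esub>"
      using u(3,4) by simp
    moreover have "r \<odot>\<^bsub>C i\<^esub> (u1 \<oplus>\<^bsub>C i\<^esub> u2) \<oplus>\<^bsub>C i\<^esub> (s1 \<oplus>\<^bsub>R\<^esub> s2) \<odot>\<^bsub>C i\<^esub> w \<in> boundaries C D i"
      if r: "r \<in> carrier R" and w: "w \<in> carrier (C i)" "D i w = r \<odot>\<^bsub>C (i + 1)\<^esub> v" for r w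
    proof -
      have "(r \<odot>\<^bsub>C i\<^esub> u1 \<oplus>\<^bsub>C i\<^esub> s1 \<odot>\<^bsub>C i\<^esub> w) \<oplus>\<^bsub>C i\<^esub> (r \<odot>\<^bsub>C i\<^esub> u2 \<oplus>\<^bsub>C i\<^esub> s2 \<odot>\<^bsub>C i\<^esub> w)
          \<in> boundaries C D i"
        using ub[OF r w] C0.submodule_add[OF boundaries_submodule] by blast
      moreover have "(r \<odot>\<^bsub>C i\<^esub> u1 \<oplus>\<^bsub>C i\<^esub> s1 \<odot>\<^bsub>C i\<^esub> w) \<oplus>\<^bsub>C i\<^esub> (r \<odot>\<^bsub>C i\<^esub> u2 \<oplus>\<^bsub>C i\<^esub> s2 \<odot>\<^bsub>C i\<^esub> w) =
        r \<odot>\<^bsub>C i\<^esub> (u1 \<oplus>\<^bsub>C i\<^esub> u2) \<oplus>\<^bsub>C i\<^esub> (s1 \<oplus>\<^bsub>R\<^esub> s2) \<odot>\<^bsub>C i\<^esub> w"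
        using r w(1) u(1,2) s by algebra
      ultimately show ?thesis by simp
    qed
    ultimately show ?case using u(1,2) by blast
  }
qed

context cone_complex
begin

text \<open>
  A cocycle \<open>(u, v)\<close> is the sum of the lift \<open>(u\<^sub>0, v)\<close> and of \<open>(u - u\<^sub>0, 0)\<close>, which comes from
  \<open>H\<^sup>i(C)\<close>. The lift is killed by \<open>I\<close> since \<open>v\<close> is, and the rest since \<open>H\<^sup>i(C)\<close> is.
\<close>
lemma kills_cohomology_cone:
  assumes I: "ideal I R" and xII: "x \<in> ideal_prod R I I"
    and kills: "kills_cohomology I C D i" "kills_cohomology I C D (i + 1)"
  shows "kills_cohomology I (cone C) (cone_diff R C D x) i"
  unfolding kills_cohomology_def
proof (intro ballI)
  interpret C0: module R "C i" by (rule module_C)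
  interpret C1: module R "C (i + 1)" by (rule module_C)
  fix r f assume r: "r \<in> I" and f: "f \<in> cycles (cone C) (cone_diff R C D x) i"
  obtain u v where fe: "f = interleave u v" by (rule interleave_cases)
  have uv: "u \<in> carrier (C i)" "v \<in> cycles C D (i + 1)"
    "D i u \<oplus>\<^bsub>C (i + 1)\<^esub> x \<odot>\<^bsub>C (i + 1)\<^esub> v = \<zero>\<^bsub>C (i + 1)\<^esub>"
    using f unfolding fe by (simp_all add: cone_cycles_iff)
  have vc: "v \<in> carrier (C (i + 1))" using uv by (simp add: cycles_def)
  have rc: "r \<in> carrier R" using r C0.R.ideal_closed(1)[OF I] by blast
  have Iv: "I \<subseteq> colon R (C (i + 1)) (boundaries C D (i + 1)) v"
    using kills(2) uv(2) C0.R.ideal_closed(1)[OF I] by (auto simp: colon_def kills_cohomology_def)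
  obtain u0 where u0: "u0 \<in> carrier (C i)"
    "D i u0 \<oplus>\<^bsub>C (i + 1)\<^esub> x \<odot>\<^bsub>C (i + 1)\<^esub> v = \<zero>\<^bsub>C (i + 1)\<^esub>"
    and u0b: "\<And>r w. r \<in> carrier R \<Longrightarrow> w \<in> carrier (C i) \<Longrightarrow> D i w = r \<odot>\<^bsub>C (i + 1)\<^esub> v \<Longrightarrow>
      r \<odot>\<^bsub>C i\<^esub> u0 \<oplus>\<^bsub>C i\<^esub> x \<odot>\<^bsub>C i\<^esub> w \<in> boundaries C D i"
    using splitting_lift[OF I xII kills(1) uv(2) Iv] by blast
  have "r \<odot>\<^bsub>C (i + 1)\<^esub> v \<in> boundaries C D (i + 1)" using Iv r by (auto simp: colon_def)
  then obtain w where w: "w \<in> carrier (C i)" "r \<odot>\<^bsub>C (i + 1)\<^esub> v = D i w"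
    unfolding boundaries_succ by blast
  have "D i u = D i u0"
    using uv(3) u0(2) uv(1) u0(1) vc x C1.M.add.right_cancel[of "x \<odot>\<^bsub>C (i + 1)\<^esub> v" "D i u" "D i u0"] by simp
  then have "u \<ominus>\<^bsub>C i\<^esub> u0 \<in> cycles C D i"
    using uv(1) u0(1) by (simp add: cycles_def D_minus C1.M.minus_eq C1.M.r_neg)
  then have 1: "r \<odot>\<^bsub>C i\<^esub> (u \<ominus>\<^bsub>C i\<^esub> u0) \<in> boundaries C D i"
    using kills(1) r by (simp add: kills_cohomology_def)
  have 2: "r \<odot>\<^bsub>C i\<^esub> u0 \<oplus>\<^bsub>C i\<^esub> x \<odot>\<^bsub>C i\<^esub> w \<in> boundaries C D i"
    using u0b[OF rc w(1)] w(2) by simp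
  have "r \<odot>\<^bsub>C i\<^esub> (u \<ominus>\<^bsub>C i\<^esub> u0) \<oplus>\<^bsub>C i\<^esub> (r \<odot>\<^bsub>C i\<^esub> u0 \<oplus>\<^bsub>C i\<^esub> x \<odot>\<^bsub>C i\<^esub> w) =
    r \<odot>\<^bsub>C i\<^esub> u \<oplus>\<^bsub>C i\<^esub> x \<odot>\<^bsub>C i\<^esub> w"
    using rc uv(1) u0(1) w(1) x by algebra
  then have "r \<odot>\<^bsub>C i\<^esub> u \<oplus>\<^bsub>C i\<^esub> x \<odot>\<^bsub>C i\<^esub> w \<in> boundaries C D i"
    using C0.submodule_add[OF boundaries_submodule 1 2] by simp
  then show "r \<odot>\<^bsub>cone C i\<^esub> f \<in> boundaries (cone C) (cone_diff R C D x) i"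
    unfolding fe using w rc uv(1) vc by (auto simp: cone_boundaries_iff)
qed

text \<open>
  The map \<open>H\<^sup>i(C) \<rightarrow> H\<^sup>i(K)\<close> to the cohomology of the cone \<open>K\<close> is injective because \<open>x \<in> I\<close>
  kills \<open>H\<^sup>i(C)\<close>. So the primes of \<open>H\<^sup>i(K)\<close> are among those of its image and of the image in
  \<open>H\<^sup>i\<^sup>+\<^sup>1(C)\<close>, and those of \<open>H\<^sup>i(C)\<close> occur. A prime \<open>p \<supseteq> I\<close> of \<open>H\<^sup>i\<^sup>+\<^sup>1(C)\<close> is the annihilator of
  a class killed by \<open>I\<close>, and the lift of this class has the same annihilator.
\<close>
lemma coh_Ass_cone:
  assumes I: "ideal I R" and xII: "x \<in> ideal_prod R I I"
    and kills: "kills_cohomology I C D i"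
  shows "{p \<in> coh_Ass R (cone C) (cone_diff R C D x) i. I \<subseteq> p} =
    {p \<in> coh_Ass R C D i \<union> coh_Ass R C D (i + 1). I \<subseteq> p}"
proof -
  interpret C0: module R "C i" by (rule module_C)
  interpret C1: module R "C (i + 1)" by (rule module_C)
  interpret K0: module R "cone C i" by (rule cone.module_C)
  let ?B = "boundaries (cone C) (cone_diff R C D x) i"
  have xI: "x \<in> I" using xII C0.R.ideal_prod_inter[OF I I] by blast
  note B0 = C0.submodule_add_iff[OF boundaries_submodule]
  have xz: "x \<odot>\<^bsub>C i\<^esub> w \<in> boundaries C D i" if "w \<in> cycles C D i" for w
    using kills xI that by (simp add: kills_cohomology_def)
  have zc: "z \<in> carrier (C j)" if "z \<in> cycles C D j" for z j using that by (simp add: cycles_def)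
  \<comment> \<open>modulo boundaries, \<open>(a, D w)\<close> is \<open>(a + x w, 0)\<close>, and \<open>H\<^sup>i(C)\<close> embeds\<close>
  have left: "colon R (cone C i) ?B (interleave a (D i w)) =
      colon R (C i) (boundaries C D i) (a \<oplus>\<^bsub>C i\<^esub> x \<odot>\<^bsub>C i\<^esub> w)"
    if a: "a \<in> carrier (C i)" and w: "w \<in> carrier (C i)" for a w
  proof -
    have "(s \<odot>\<^bsub>cone C i\<^esub> interleave a (D i w) \<in> ?B) \<longleftrightarrow>
        s \<odot>\<^bsub>C i\<^esub> (a \<oplus>\<^bsub>C i\<^esub> x \<odot>\<^bsub>C i\<^esub> w) \<in> boundaries C D i" if s: "s \<in> carrier R" for s
    proof -
      have e: "s \<odot>\<^bsub>C i\<^esub> (a \<oplus>\<^bsub>C i\<^esub> x \<odot>\<^bsub>C i\<^esub> w) = s \<odot>\<^bsub>C i\<^esub> a \<oplus>\<^bsub>C i\<^esub> x \<odot>\<^bsub>C i\<^esub> (s \<odot>\<^bsub>C i\<^esub> w)"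
        using s a w x by algebra
      have sw: "s \<odot>\<^bsub>C i\<^esub> w \<in> carrier (C i)" "s \<odot>\<^bsub>C (i + 1)\<^esub> D i w = D i (s \<odot>\<^bsub>C i\<^esub> w)"
        using s w by (simp_all add: D_smult)
      have "s \<odot>\<^bsub>C i\<^esub> a \<oplus>\<^bsub>C i\<^esub> x \<odot>\<^bsub>C i\<^esub> (s \<odot>\<^bsub>C i\<^esub> w) \<in> boundaries C D i"
        if w': "w' \<in> carrier (C i)" "D i (s \<odot>\<^bsub>C i\<^esub> w) = D i w'"
          "s \<odot>\<^bsub>C i\<^esub> a \<oplus>\<^bsub>C i\<^esub> x \<odot>\<^bsub>C i\<^esub> w' \<in> boundaries C D i" for w'
      proof -
        have "s \<odot>\<^bsub>C i\<^esub> w \<ominus>\<^bsub>C i\<^esub> w' \<in> cycles C D i"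
          using w' sw(1) by (simp add: cycles_def D_minus C1.M.minus_eq C1.M.r_neg)
        note xz[OF this]
        moreover have "s \<odot>\<^bsub>C i\<^esub> a \<oplus>\<^bsub>C i\<^esub> x \<odot>\<^bsub>C i\<^esub> (s \<odot>\<^bsub>C i\<^esub> w) =
          (s \<odot>\<^bsub>C i\<^esub> a \<oplus>\<^bsub>C i\<^esub> x \<odot>\<^bsub>C i\<^esub> w') \<oplus>\<^bsub>C i\<^esub> x \<odot>\<^bsub>C i\<^esub> (s \<odot>\<^bsub>C i\<^esub> w \<ominus>\<^bsub>C i\<^esub> w')"
          using s a w x w'(1) by algebra
        ultimately show ?thesis using C0.submodule_add[OF boundaries_submodule w'(3)] by simp
      qed
      then show ?thesis unfolding e using sw s a w by (auto simp: cone_boundaries_iff)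
    qed
    then show ?thesis by (auto simp: colon_def)
  qed
  have "p \<in> coh_Ass R C D i \<union> coh_Ass R C D (i + 1)"
    if p: "p \<in> coh_Ass R (cone C) (cone_diff R C D x) i" for p
  proof -
    from p obtain f where pr: "primeideal p R" and f: "f \<in> cycles (cone C) (cone_diff R C D x) i"
      and pf: "p = colon R (cone C i) ?B f" unfolding coh_Ass_def subquot_Ass_def by blast
    obtain u v where fe: "f = interleave u v" by (rule interleave_cases)
    have uv: "u \<in> carrier (C i)" "v \<in> cycles C D (i + 1)"
      "D i u \<oplus>\<^bsub>C (i + 1)\<^esub> x \<odot>\<^bsub>C (i + 1)\<^esub> v = \<zero>\<^bsub>C (i + 1)\<^esub>"
      using f unfolding fe by (simp_all add: cone_cycles_iff)
    have vc: "v \<in> carrier (C (i + 1))" using uv zc by blast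
    define L where "L = {interleave a b | a b. a \<in> carrier (C i) \<and> b \<in> boundaries C D (i + 1)}"
    have BL: "?B \<subseteq> L"
    proof
      fix g assume g: "g \<in> ?B"
      obtain a b where ge: "g = interleave a b" by (rule interleave_cases)
      have "g \<in> carrier (cone C i)" using K0.submodule_carrier[OF cone.boundaries_submodule g] .
      then show "g \<in> L" using g unfolding ge L_def
        by (auto simp: cone_boundaries_iff boundaries_succ)
    qed
    have fc: "f \<in> carrier (cone C i)" using f by (simp add: cycles_def)
    show ?thesis
    proof (rule K0.prime_colon_dichotomy[OF pr pf fc BL])
      assume "p = colon R (cone C i) L f"
      also have "\<dots> = colon R (C (i + 1)) (boundaries C D (i + 1)) v"
        using uv(1) unfolding fe colon_def L_def by auto
      finally show ?thesis using pr uv(2) unfolding coh_Ass_def subquot_Ass_def by blast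
    next
      fix r assume r: "r \<in> carrier R" "r \<odot>\<^bsub>cone C i\<^esub> f \<in> L"
        and pr': "p = colon R (cone C i) ?B (r \<odot>\<^bsub>cone C i\<^esub> f)"
      then obtain w where w: "w \<in> carrier (C i)" "r \<odot>\<^bsub>C (i + 1)\<^esub> v = D i w"
        unfolding fe L_def boundaries_succ by auto
      let ?u = "r \<odot>\<^bsub>C i\<^esub> u \<oplus>\<^bsub>C i\<^esub> x \<odot>\<^bsub>C i\<^esub> w"
      have "D i ?u = r \<odot>\<^bsub>C (i + 1)\<^esub> (D i u \<oplus>\<^bsub>C (i + 1)\<^esub> x \<odot>\<^bsub>C (i + 1)\<^esub> v)"
        using r(1) uv(1) vc w x
        by (simp add: D_add D_smult w(2)[symmetric] C1.smult_r_distr C1.smult_left_commute)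
      then have "?u \<in> cycles C D i" using uv(1,3) w(1) x r(1) by (simp add: cycles_def)
      moreover have "p = colon R (C i) (boundaries C D i) ?u"
        using left[of "r \<odot>\<^bsub>C i\<^esub> u" w] r(1) uv(1) w pr' unfolding fe by simp
      ultimately show ?thesis using pr unfolding coh_Ass_def subquot_Ass_def by blast
    qed
  qed
  moreover have "p \<in> coh_Ass R (cone C) (cone_diff R C D x) i" if p: "p \<in> coh_Ass R C D i" for p
  proof -
    from p obtain z where pr: "primeideal p R" and z: "z \<in> cycles C D i"
      and pz: "p = colon R (C i) (boundaries C D i) z" unfolding coh_Ass_def subquot_Ass_def by blast
    have zC: "z \<in> carrier (C i)" "D i z = \<zero>\<^bsub>C (i + 1)\<^esub>" using z by (simp_all add: cycles_def)
    have "interleave z \<zero>\<^bsub>C (i + 1)\<^esub> \<in> cycles (cone C) (cone_diff R C D x) i"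
      using zC x C1.submodule_zero[OF cycles_submodule] by (simp add: cone_cycles_iff)
    moreover have "p = colon R (cone C i) ?B (interleave z \<zero>\<^bsub>C (i + 1)\<^esub>)"
      using left[OF zC(1) C0.M.zero_closed] zC(1) x pz by (simp add: D_zero)
    ultimately show ?thesis using pr unfolding coh_Ass_def subquot_Ass_def by blast
  qed
  moreover have "p \<in> coh_Ass R (cone C) (cone_diff R C D x) i"
    if p: "p \<in> coh_Ass R C D (i + 1)" and Ip: "I \<subseteq> p" for p
  proof -
    from p obtain v where pr: "primeideal p R" and v: "v \<in> cycles C D (i + 1)"
      and pv: "p = colon R (C (i + 1)) (boundaries C D (i + 1)) v"
      unfolding coh_Ass_def subquot_Ass_def by blast
    have vc: "v \<in> carrier (C (i + 1))" using v zc by blast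
    obtain u where u: "u \<in> carrier (C i)"
      "D i u \<oplus>\<^bsub>C (i + 1)\<^esub> x \<odot>\<^bsub>C (i + 1)\<^esub> v = \<zero>\<^bsub>C (i + 1)\<^esub>"
      and ub: "\<And>r w. r \<in> carrier R \<Longrightarrow> w \<in> carrier (C i) \<Longrightarrow> D i w = r \<odot>\<^bsub>C (i + 1)\<^esub> v \<Longrightarrow>
        r \<odot>\<^bsub>C i\<^esub> u \<oplus>\<^bsub>C i\<^esub> x \<odot>\<^bsub>C i\<^esub> w \<in> boundaries C D i"
      using splitting_lift[OF I xII kills v] Ip pv by blast
    have "interleave u v \<in> cycles (cone C) (cone_diff R C D x) i" using u v by (simp add: cone_cycles_iff)
    moreover have "(r \<odot>\<^bsub>cone C i\<^esub> interleave u v \<in> ?B) \<longleftrightarrow> r \<odot>\<^bsub>C (i + 1)\<^esub> v \<in> boundaries C D (i + 1)"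
      if r: "r \<in> carrier R" for r
      using r u(1) vc ub[OF r] by (auto simp: cone_boundaries_iff boundaries_succ image_iff)
    then have "p = colon R (cone C i) ?B (interleave u v)" unfolding pv colon_def by blast
    ultimately show ?thesis using pr unfolding coh_Ass_def subquot_Ass_def by blast
  qed
  ultimately show ?thesis by blast
qed

end

section \<open>Powers of ideals and filter regular elements\<close>

context cring
begin

lemma ideal_pow_ideal: "ideal I R \<Longrightarrow> ideal (ideal_pow R I n) R"
proof -
  interpret ids: comm_monoid "ideals_set R" by (rule ideals_set_is_comm_monoid)
  assume "ideal I R"
  then have "I \<in> carrier (ideals_set R)" by (simp add: ideals_set_def)
  then have "ideal_pow R I n \<in> carrier (ideals_set R)" by (rule ids.nat_pow_closed)
  then show ?thesis by (simp add: ideals_set_def)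
qed

lemma ideal_pow_add:
  assumes "ideal I R"
  shows "ideal_pow R I (m + n) = ideal_prod R (ideal_pow R I m) (ideal_pow R I n)"
proof -
  interpret ids: comm_monoid "ideals_set R" by (rule ideals_set_is_comm_monoid)
  have "I \<in> carrier (ideals_set R)" using assms by (simp add: ideals_set_def)
  then show ?thesis using ids.nat_pow_mult[of I m n] by (simp add: ideals_set_def)
qed

lemma ideal_pow_one: "ideal I R \<Longrightarrow> ideal_pow R I (Suc 0) = I"
proof -
  interpret ids: comm_monoid "ideals_set R" by (rule ideals_set_is_comm_monoid)
  assume "ideal I R"
  then have "I \<in> carrier (ideals_set R)" by (simp add: ideals_set_def)
  then show ?thesis by simp
qed

lemma ideal_pow_Suc: "ideal_pow R I (Suc n) = ideal_prod R (ideal_pow R I n) I"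
  by (simp add: ideals_set_def)

lemma pow_in_ideal_pow:
  assumes I: "ideal I R" and y: "y \<in> I"
  shows "y [^] n \<in> ideal_pow R I n"
proof (induction n)
  case 0
  then show ?case by (simp add: ideals_set_def)
next
  case (Suc n)
  then show ?case unfolding ideal_pow_Suc using ideal_prod.prod[OF Suc y] by simp
qed

lemma ideal_pow_le:
  assumes I: "ideal I R" and n: "n > 0"
  shows "ideal_pow R I n \<subseteq> I"
proof -
  obtain m where "n = Suc m" using n gr0_implies_Suc by blast
  then show ?thesis using ideal_prod_inter[OF ideal_pow_ideal[OF I] I, of m] ideal_pow_Suc by simp
qed

lemma prime_contains_ideal_pow:
  assumes I: "ideal I R" and p: "primeideal p R" and "ideal_pow R I n \<subseteq> p"
  shows "I \<subseteq> p"
proof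
  fix y assume y: "y \<in> I"
  then show "y \<in> p"
    using primeideal_pow[OF p _ subsetD[OF assms(3) pow_in_ideal_pow[OF I y]]] ideal_closed(1)[OF I] by blast
qed

lemma ideal_prod_add_principal:
  assumes c: "ideal c R" and f: "f \<in> carrier R" and g: "g \<in> carrier R" and fg: "f \<otimes> g \<in> c"
  shows "ideal_prod R {i \<oplus> s \<otimes> f | i s. i \<in> c \<and> s \<in> carrier R} {i \<oplus> s \<otimes> g | i s. i \<in> c \<and> s \<in> carrier R} \<subseteq> c"
proof
  note cc = ideal_closed[OF c]
  fix x assume "x \<in> ideal_prod R {i \<oplus> s \<otimes> f | i s. i \<in> c \<and> s \<in> carrier R} {i \<oplus> s \<otimes> g | i s. i \<in> c \<and> s \<in> carrier R}"
  then show "x \<in> c"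
  proof (induction x rule: ideal_prod.induct)
    case (prod x y)
    then obtain i s j t where e: "x = i \<oplus> s \<otimes> f" "y = j \<oplus> t \<otimes> g" "i \<in> c" "j \<in> c"
      "s \<in> carrier R" "t \<in> carrier R" by blast
    have ij: "i \<in> carrier R" "j \<in> carrier R" using e cc(1) by auto
    have "x \<otimes> y = (j \<oplus> t \<otimes> g) \<otimes> i \<oplus> ((s \<otimes> f) \<otimes> j \<oplus> (s \<otimes> t) \<otimes> (f \<otimes> g))"
      unfolding e using ij e(5,6) f g by algebra
    then show ?case using cc(3,5) e(3-6) fg f g ij by simp
  next
    case (sum x y)
    then show ?case using cc(3) by blast
  qed
qed

end

lemma ideal_prod_mono: "I \<subseteq> I' \<Longrightarrow> J \<subseteq> J' \<Longrightarrow> ideal_prod R I J \<subseteq> ideal_prod R I' J'"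
proof
  fix x assume IJ: "I \<subseteq> I'" "J \<subseteq> J'" and "x \<in> ideal_prod R I J"
  from this(3) show "x \<in> ideal_prod R I' J'"
    by (induction x rule: ideal_prod.induct) (use IJ in \<open>auto intro: ideal_prod.intros\<close>)
qed

text \<open>
  Noetherian induction on \<open>c\<close>. A prime \<open>c\<close> contains \<open>\<aa>\<close> itself; otherwise some \<open>f g \<in> c\<close> with
  \<open>f, g \<notin> c\<close>, and powers of \<open>\<aa>\<close> inside \<open>c + R f\<close> and \<open>c + R g\<close> have their product in \<open>c\<close>.
\<close>
lemma ideal_pow_subset_of_radical:
  assumes R: "cring R" and noeth: "noetherian_ring R" and a: "ideal \<aa> R" and c: "ideal c R"
    and rad: "\<And>y. y \<in> \<aa> \<Longrightarrow> \<exists>n::nat. y [^]\<^bsub>R\<^esub> n \<in> c"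
  shows "\<exists>N. ideal_pow R \<aa> N \<subseteq> c"
proof (rule ccontr)
  interpret R: cring R by fact
  assume no: "\<nexists>N. ideal_pow R \<aa> N \<subseteq> c"
  define S where "S = {c. ideal c R \<and> (\<forall>y\<in>\<aa>. \<exists>n::nat. y [^]\<^bsub>R\<^esub> n \<in> c) \<and> (\<nexists>N. ideal_pow R \<aa> N \<subseteq> c)}"
  have "c \<in> S" using c rad no by (simp add: S_def)
  then have "S \<noteq> {}" by blast
  moreover have "ideal J R" if "J \<in> S" for J using that by (simp add: S_def)
  ultimately obtain b where b: "b \<in> S" and bmax: "\<And>J. J \<in> S \<Longrightarrow> b \<subseteq> J \<Longrightarrow> J = b"
    using noetherian_ring.maximal_ideal_in_family[OF noeth, of S] by blast
  note bS = b[unfolded S_def, THEN CollectD]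
  have bi: "ideal b R" by (rule bS[THEN conjunct1])
  have brad: "\<exists>n::nat. y [^]\<^bsub>R\<^esub> n \<in> b" if "y \<in> \<aa>" for y
    by (rule bspec[OF bS[THEN conjunct2, THEN conjunct1] that])
  have bno: "\<nexists>N. ideal_pow R \<aa> N \<subseteq> b" by (rule bS[THEN conjunct2, THEN conjunct2])
  have larger: "\<exists>N. ideal_pow R \<aa> N \<subseteq> {i \<oplus>\<^bsub>R\<^esub> s \<otimes>\<^bsub>R\<^esub> f | i s. i \<in> b \<and> s \<in> carrier R}"
    if f: "f \<in> carrier R" "f \<notin> b" for f
  proof (rule ccontr)
    let ?K = "{i \<oplus>\<^bsub>R\<^esub> s \<otimes>\<^bsub>R\<^esub> f | i s. i \<in> b \<and> s \<in> carrier R}"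
    note K = R.ideal_add_principal[OF bi f(1)]
    have "\<exists>n::nat. y [^]\<^bsub>R\<^esub> n \<in> ?K" if y: "y \<in> \<aa>" for y
    proof -
      obtain n :: nat where "y [^]\<^bsub>R\<^esub> n \<in> b" using brad[OF y] by (rule exE)
      then show ?thesis using subsetD[OF K(2)] by (intro exI[of _ n])
    qed
    moreover assume "\<nexists>N. ideal_pow R \<aa> N \<subseteq> ?K"
    ultimately have "?K \<in> S" using K(1) unfolding S_def by simp
    then have "?K = b" using K(2) by (rule bmax)
    then show False using K(3) f(2) by simp
  qed
  have "primeideal b R"
  proof (rule primeidealI[OF bi R])
    show "carrier R \<noteq> b"
    proof
      assume "carrier R = b"
      then have "ideal_pow R \<aa> 0 \<subseteq> b" using R.ideal_closed(1)[OF R.ideal_pow_ideal[OF a, of 0]] by simp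
      then show False using bno by (rule notE[rotated, OF exI])
    qed
    fix f g assume fg: "f \<in> carrier R" "g \<in> carrier R" "f \<otimes>\<^bsub>R\<^esub> g \<in> b"
    show "f \<in> b \<or> g \<in> b"
    proof (rule ccontr)
      assume "\<not> (f \<in> b \<or> g \<in> b)"
      then have n: "f \<notin> b" "g \<notin> b" by simp_all
      let ?K = "\<lambda>f. {i \<oplus>\<^bsub>R\<^esub> s \<otimes>\<^bsub>R\<^esub> f | i s. i \<in> b \<and> s \<in> carrier R}"
      obtain m where m: "ideal_pow R \<aa> m \<subseteq> ?K f" using larger[OF fg(1) n(1)] by (rule exE)
      obtain k where k: "ideal_pow R \<aa> k \<subseteq> ?K g" using larger[OF fg(2) n(2)] by (rule exE)
      have "ideal_pow R \<aa> (m + k) \<subseteq> b"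
        unfolding R.ideal_pow_add[OF a]
        by (rule subset_trans[OF ideal_prod_mono[OF m k] R.ideal_prod_add_principal[OF bi fg]])
      then show False using bno by (rule notE[rotated, OF exI])
    qed
  qed
  then have "y \<in> b" if "y \<in> \<aa>" for y
    using brad[OF that] R.primeideal_pow[of b y] R.ideal_closed(1)[OF a] that by auto
  then have "ideal_pow R \<aa> (Suc 0) \<subseteq> b" unfolding R.ideal_pow_one[OF a] by (rule subsetI)
  then show False using bno by (rule notE[rotated, OF exI])
qed

lemma (in module) carrier_torsion:
  assumes noeth: "noetherian_ring R" and a: "ideal \<aa> R"
  shows "carrier (torsion R \<aa> M) = tors_mod R \<aa> M {\<zero>\<^bsub>M\<^esub>}"
proof -
  note ac = R.ideal_closed(1)[OF a]
  have "(\<exists>n. \<forall>r\<in>ideal_pow R \<aa> n. r \<odot>\<^bsub>M\<^esub> x = \<zero>\<^bsub>M\<^esub>) \<longleftrightarrow>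
      (\<forall>y\<in>\<aa>. \<exists>n::nat. (y [^] n) \<odot>\<^bsub>M\<^esub> x = \<zero>\<^bsub>M\<^esub>)" (is "?l \<longleftrightarrow> ?r") if x: "x \<in> carrier M" for x
  proof
    show ?r if ?l using that R.pow_in_ideal_pow[OF a] by blast
    assume ?r
    then have "\<exists>n::nat. y [^] n \<in> colon R M {\<zero>\<^bsub>M\<^esub>} x" if "y \<in> \<aa>" for y
      using that ac by (auto simp: colon_def)
    then have "\<exists>N. ideal_pow R \<aa> N \<subseteq> colon R M {\<zero>\<^bsub>M\<^esub>} x"
      by (rule ideal_pow_subset_of_radical[OF R.is_cring noeth a colon_ideal[OF submodule_zero_set x]])
    then show ?l by (auto simp: colon_def)
  qed
  then show ?thesis by (auto simp: torsion_def tors_mod_def)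
qed

text \<open>
  Suppose \<open>x\<close> is a zero divisor modulo the torsion \<open>T\<close> of \<open>M / L\<close>, that is, on \<open>M / T\<close>. A maximal
  annihilator \<open>P = T : z\<close> among the elements killed by \<open>x\<close> is prime, contains \<open>x\<close> and does not
  contain \<open>\<aa>\<close>. With \<open>y \<in> \<aa> - P\<close>, multiplying \<open>z\<close> by a large power of \<open>y\<close> kills the torsion
  error, so that \<open>P = L : y\<^sup>n z\<close> is an associated prime of \<open>M / L\<close> outside \<open>V(\<aa>)\<close>.
\<close>
lemma (in module) filter_regular_annihilator_torsion:
  assumes noeth: "noetherian_ring R" and a: "ideal \<aa> R" and L: "submodule L R M" and x: "x \<in> carrier R"
    and reg: "\<And>p. p \<in> subquot_Ass R M (carrier M) L \<Longrightarrow> p \<notin> V R \<aa> \<Longrightarrow> x \<notin> p"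
    and m: "m \<in> carrier M" "x \<odot>\<^bsub>M\<^esub> m \<in> L"
  shows "m \<in> tors_mod R \<aa> M L"
proof (rule ccontr)
  let ?T = "tors_mod R \<aa> M L"
  note ac = R.ideal_closed(1)[OF a]
  have T: "submodule ?T R M" by (rule tors_mod_submodule[OF ac L])
  have LT: "L \<subseteq> ?T" by (rule tors_mod_upper[OF L ac])
  define Z where "Z = {z \<in> carrier M. z \<notin> ?T \<and> x \<odot>\<^bsub>M\<^esub> z \<in> ?T}"
  assume "m \<notin> ?T"
  then have "m \<in> Z" using m LT by (auto simp: Z_def)
  have "\<exists>P\<in>colon R M ?T ` Z. \<forall>J\<in>colon R M ?T ` Z. P \<subseteq> J \<longrightarrow> J = P"
    by (rule noetherian_ring.maximal_ideal_in_family[OF noeth, of "colon R M ?T ` Z"])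
      (use \<open>m \<in> Z\<close> colon_ideal[OF T] in \<open>auto simp: Z_def\<close>)
  then obtain z where z: "z \<in> Z"
    and zmax: "\<And>z'. z' \<in> Z \<Longrightarrow> colon R M ?T z \<subseteq> colon R M ?T z' \<Longrightarrow> colon R M ?T z' = colon R M ?T z"
    by blast
  define P where "P = colon R M ?T z"
  have zc: "z \<in> carrier M" "z \<notin> ?T" "x \<odot>\<^bsub>M\<^esub> z \<in> ?T" using z by (auto simp: Z_def)
  have P: "primeideal P R"
  proof (rule primeidealI)
    show "ideal P R" unfolding P_def by (rule colon_ideal[OF T zc(1)])
    have "\<one> \<notin> P" using zc by (simp add: P_def colon_def)
    then show "carrier R \<noteq> P" using R.one_closed by metis
    fix r s assume rs: "r \<in> carrier R" "s \<in> carrier R" "r \<otimes> s \<in> P"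
    show "r \<in> P \<or> s \<in> P"
    proof (rule ccontr)
      assume n: "\<not> (r \<in> P \<or> s \<in> P)"
      have sz: "s \<odot>\<^bsub>M\<^esub> z \<in> Z"
        using n rs zc submodule_smult[OF T rs(2) zc(3)] x
        by (auto simp: Z_def P_def colon_def smult_left_commute)
      have "P \<subseteq> colon R M ?T (s \<odot>\<^bsub>M\<^esub> z)"
      proof
        fix q assume "q \<in> P"
        then have q: "q \<in> carrier R" "q \<odot>\<^bsub>M\<^esub> z \<in> ?T" by (auto simp: P_def colon_def)
        then show "q \<in> colon R M ?T (s \<odot>\<^bsub>M\<^esub> z)"
          using submodule_smult[OF T rs(2) q(2)] smult_left_commute[OF q(1) rs(2) zc(1)]
          by (simp add: colon_def)
      qed
      then have "colon R M ?T (s \<odot>\<^bsub>M\<^esub> z) = P" using zmax[OF sz] by (simp add: P_def)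
      moreover have "r \<in> colon R M ?T (s \<odot>\<^bsub>M\<^esub> z)"
        using rs zc(1) by (simp add: P_def colon_def smult_assoc1)
      ultimately show False using n by blast
    qed
  qed (rule R.is_cring)
  have "\<not> \<aa> \<subseteq> P"
  proof
    assume "\<aa> \<subseteq> P"
    then have "\<exists>n::nat. (y [^] n) \<odot>\<^bsub>M\<^esub> z \<in> ?T" if "y \<in> \<aa>" for y
      using that ac by (intro exI[of _ 1]) (auto simp: P_def colon_def subset_iff)
    then show False using tors_mod_idem[OF ac zc(1)] zc(2) by blast
  qed
  then obtain y where y: "y \<in> \<aa>" "y \<notin> P" by blast
  then have yc: "y \<in> carrier R" using ac by blast
  define Q where "Q n = colon R M L ((y [^] n) \<odot>\<^bsub>M\<^esub> z)" for n :: nat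
  have "\<exists>I\<in>range Q. \<forall>J\<in>range Q. I \<subseteq> J \<longrightarrow> J = I"
    by (rule noetherian_ring.maximal_ideal_in_family[OF noeth, of "range Q"])
      (use colon_ideal[OF L] yc zc(1) in \<open>auto simp: Q_def\<close>)
  then obtain n where "\<forall>J\<in>range Q. Q n \<subseteq> J \<longrightarrow> J = Q n" by (elim bexE rangeE) simp
  then have n: "Q k = Q n" if "Q n \<subseteq> Q k" for k using that by simp
  have Qadd: "Q k \<subseteq> Q (l + k)" for k l
  proof
    fix r assume r: "r \<in> Q k"
    then have rc: "r \<in> carrier R" "r \<odot>\<^bsub>M\<^esub> ((y [^] k) \<odot>\<^bsub>M\<^esub> z) \<in> L" by (auto simp: Q_def colon_def)
    have "r \<odot>\<^bsub>M\<^esub> ((y [^] (l + k)) \<odot>\<^bsub>M\<^esub> z) = (y [^] l) \<odot>\<^bsub>M\<^esub> (r \<odot>\<^bsub>M\<^esub> ((y [^] k) \<odot>\<^bsub>M\<^esub> z))"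
      using rc(1) yc zc(1) by (simp add: pow_smult_add smult_left_commute)
    then show "r \<in> Q (l + k)" using rc submodule_smult[OF L _ rc(2), of "y [^] l"] yc by (simp add: Q_def colon_def)
  qed
  have "Q n = P"
  proof
    show "Q n \<subseteq> P"
    proof
      fix r assume "r \<in> Q n"
      then have r: "r \<in> carrier R" "r \<odot>\<^bsub>M\<^esub> ((y [^] n) \<odot>\<^bsub>M\<^esub> z) \<in> ?T" using LT by (auto simp: Q_def colon_def)
      then have "r \<otimes> y [^] n \<in> P" using yc zc(1) by (simp add: P_def colon_def smult_assoc1)
      then show "r \<in> P"
        using primeideal.I_prime[OF P r(1), of "y [^] n"] R.primeideal_pow[OF P yc] y(2) yc by auto
    qed
    show "P \<subseteq> Q n"
    proof
      fix r assume "r \<in> P"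
      then have r: "r \<in> carrier R" "r \<odot>\<^bsub>M\<^esub> z \<in> ?T" by (auto simp: P_def colon_def)
      then obtain k :: nat where k: "(y [^] k) \<odot>\<^bsub>M\<^esub> (r \<odot>\<^bsub>M\<^esub> z) \<in> L" using y(1) by (auto simp: tors_mod_def)
      then have "r \<in> Q k" using r(1) yc zc(1) by (simp add: Q_def colon_def smult_left_commute)
      then have "r \<in> Q (n + k)" using Qadd by blast
      then show "r \<in> Q n" using n[of "k + n"] Qadd[of n k] by (simp add: add.commute)
    qed
  qed
  then have "P \<in> subquot_Ass R M (carrier M) L"
    using P yc zc(1) unfolding subquot_Ass_def Q_def by blast
  moreover have "P \<notin> V R \<aa>" using \<open>\<not> \<aa> \<subseteq> P\<close> by (simp add: V_def)
  moreover have "x \<in> P" using x zc(3) by (simp add: P_def colon_def)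
  ultimately show False using reg by blast
qed

section \<open>Torsion in resolutions up to torsion\<close>

abbreviation tors :: "('a, 'r) ring_scheme \<Rightarrow> 'a set \<Rightarrow> ('a, 'b, 'm) module_scheme \<Rightarrow> 'b set"
  where "tors R \<aa> M \<equiv> tors_mod R \<aa> M {\<zero>\<^bsub>M\<^esub>}"

text \<open>
  What the iterated cones have in common: \<open>C\<close> is a resolution of \<open>M / L\<close> up to torsion cohomology
  in negative degrees, and \<open>C / \<Gamma> C\<close> consists of injective modules.
\<close>
locale torsion_resolution = cochain_complex R C D
  for R :: "('a, 'r) ring_scheme" and C :: "int \<Rightarrow> ('a, 'e, 'n) module_scheme" and D :: "int \<Rightarrow> 'e \<Rightarrow> 'e" +
  fixes \<aa> :: "'a set" and M :: "('a, 'b, 'm) module_scheme" and \<eta> :: "'b \<Rightarrow> 'e" and L :: "'b set"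
  assumes noeth: "noetherian_ring R" and ideal_a: "ideal \<aa> R"
    and bounded: "\<exists>k. \<forall>i<k. carrier (C i) = {\<zero>\<^bsub>C i\<^esub>}"
    and baer_C: "baer R (C i) (carrier (C i)) (tors R \<aa> (C i))"
    and neg: "i < 0 \<Longrightarrow> cycles C D i \<subseteq> tors_mod R \<aa> (C i) (boundaries C D i)"
    and pos: "i > 0 \<Longrightarrow> cycles C D i \<subseteq> boundaries C D i"
    and module_M: "module R M" and submodule_L: "submodule L R M"
    and \<eta>_hom: "\<eta> \<in> mod_hom R M (C 0)"
    and \<eta>_cycle: "m \<in> carrier M \<Longrightarrow> \<eta> m \<in> cycles C D 0"
    and \<eta>_surj: "z \<in> cycles C D 0 \<Longrightarrow> \<exists>m\<in>carrier M. z \<ominus>\<^bsub>C 0\<^esub> \<eta> m \<in> boundaries C D 0"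
    and \<eta>_ker: "m \<in> carrier M \<Longrightarrow> \<eta> m \<in> boundaries C D 0 \<longleftrightarrow> m \<in> L"
begin

lemma a_carrier: "\<aa> \<subseteq> carrier R"
proof -
  interpret C0: module R "C 0" by (rule module_C)
  show ?thesis using C0.R.ideal_closed(1)[OF ideal_a] .
qed

lemma tors_submodule: "submodule (tors R \<aa> (C i)) R (C i)"
  using module.tors_mod_submodule[OF module_C a_carrier module.submodule_zero_set[OF module_C]] .

lemma D_tors: "u \<in> tors R \<aa> (C i) \<Longrightarrow> D i u \<in> tors R \<aa> (C (i + 1))"
proof -
  interpret C0: module R "C i" by (rule module_C)
  interpret C1: module R "C (i + 1)" by (rule module_C)
  assume u: "u \<in> tors R \<aa> (C i)"
  then have uc: "u \<in> carrier (C i)" by (simp add: tors_mod_def)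
  show ?thesis unfolding tors_mod_def
  proof (intro CollectI conjI ballI D_closed uc)
    fix y assume y: "y \<in> \<aa>"
    then obtain n :: nat where "(y [^]\<^bsub>R\<^esub> n) \<odot>\<^bsub>C i\<^esub> u = \<zero>\<^bsub>C i\<^esub>" using u unfolding tors_mod_def by blast
    then have "(y [^]\<^bsub>R\<^esub> n) \<odot>\<^bsub>C (i + 1)\<^esub> D i u = \<zero>\<^bsub>C (i + 1)\<^esub>"
      using D_smult[of "y [^]\<^bsub>R\<^esub> n" u i] D_zero uc y a_carrier by auto
    then show "\<exists>n::nat. (y [^]\<^bsub>R\<^esub> n) \<odot>\<^bsub>C (i + 1)\<^esub> D i u \<in> {\<zero>\<^bsub>C (i + 1)\<^esub>}" by blast
  qed
qed

text \<open>
  The preimage in \<open>C\<close> of the boundaries of \<open>C / \<Gamma> C\<close>.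
\<close>
definition bd_tors :: "int \<Rightarrow> 'e set" where "bd_tors i = boundaries C D i <+>\<^bsub>C i\<^esub> tors R \<aa> (C i)"

lemma bd_tors_submodule: "submodule (bd_tors i) R (C i)"
  unfolding bd_tors_def using module.submodule_set_add[OF module_C boundaries_submodule tors_submodule] .

lemma bd_tors_iff: "z \<in> bd_tors (i + 1) \<longleftrightarrow> z \<in> carrier (C (i + 1)) \<and> (\<exists>w\<in>carrier (C i). z \<ominus>\<^bsub>C (i + 1)\<^esub> D i w \<in> tors R \<aa> (C (i + 1)))"
proof -
  interpret C1: module R "C (i + 1)" by (rule module_C)
  note tc = C1.submodule_carrier[OF tors_submodule]
  show ?thesis
  proof (safe)
    assume z: "z \<in> bd_tors (i + 1)"
    show "z \<in> carrier (C (i + 1))" using C1.submodule_carrier[OF bd_tors_submodule z] .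
    obtain w g where "w \<in> carrier (C i)" and g: "g \<in> tors R \<aa> (C (i + 1))" and "z = D i w \<oplus>\<^bsub>C (i + 1)\<^esub> g"
      using z unfolding bd_tors_def set_add_iff boundaries_succ by blast
    moreover have "(D i w \<oplus>\<^bsub>C (i + 1)\<^esub> g) \<ominus>\<^bsub>C (i + 1)\<^esub> D i w = g" if "w \<in> carrier (C i)"
      using D_closed[OF that] tc[OF g] by algebra
    ultimately show "\<exists>w\<in>carrier (C i). z \<ominus>\<^bsub>C (i + 1)\<^esub> D i w \<in> tors R \<aa> (C (i + 1))" by metis
  next
    fix w assume z: "z \<in> carrier (C (i + 1))" and w: "w \<in> carrier (C i)"
      and g: "z \<ominus>\<^bsub>C (i + 1)\<^esub> D i w \<in> tors R \<aa> (C (i + 1))"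
    have "z = D i w \<oplus>\<^bsub>C (i + 1)\<^esub> (z \<ominus>\<^bsub>C (i + 1)\<^esub> D i w)" using z D_closed[OF w] by algebra
    then show "z \<in> bd_tors (i + 1)" unfolding bd_tors_def set_add_iff boundaries_succ using w g by blast
  qed
qed

text \<open>
  Exactness of \<open>C / \<Gamma> C\<close> at \<open>i\<close>, together with injectivity of its cokernel of boundaries there.
  The two are carried together through the induction on degrees.
\<close>
definition tors_exact :: "int \<Rightarrow> bool" where
  "tors_exact i \<longleftrightarrow> (\<forall>w\<in>carrier (C i). D i w \<in> tors R \<aa> (C (i + 1)) \<longrightarrow> w \<in> bd_tors i) \<and> baer R (C i) (carrier (C i)) (bd_tors i)"

text \<open>
  The map \<open>r \<mapsto> w\<close> with \<open>r z \<equiv> D w\<close> modulo torsion is well defined into the cokernel of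
  \<open>C / \<Gamma> C\<close> at \<open>i\<close>, by exactness. It is multiplication by some \<open>l\<close>, so that \<open>r (z - D l)\<close> is
  torsion for each \<open>r\<close> in its domain. The domain contains a power of each element of \<open>\<aa>\<close>; hence
  \<open>z - D l\<close> is torsion.
\<close>
lemma tors_exact_lift:
  assumes tors_exact: "tors_exact i" and z: "z \<in> carrier (C (i + 1))"
    and tz: "\<And>y. y \<in> \<aa> \<Longrightarrow> \<exists>n::nat. (y [^]\<^bsub>R\<^esub> n) \<odot>\<^bsub>C (i + 1)\<^esub> z \<in> boundaries C D (i + 1)"
  shows "z \<in> bd_tors (i + 1)"
proof -
  interpret C0: module R "C i" by (rule module_C)
  interpret C1: module R "C (i + 1)" by (rule module_C)
  let ?T = "tors R \<aa> (C (i + 1))"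
  note tc = C1.submodule_carrier[OF tors_submodule]
  define G where "G = {(r, w). w \<in> carrier (C i) \<and>
    (\<exists>x. (r, x) \<in> {(s \<otimes>\<^bsub>R\<^esub> \<one>\<^bsub>R\<^esub>, s \<odot>\<^bsub>C (i + 1)\<^esub> z) | s. s \<in> carrier R} \<and> x \<ominus>\<^bsub>C (i + 1)\<^esub> D i w \<in> ?T)}"
  have G_iff: "(r, w) \<in> G \<longleftrightarrow>
      r \<in> carrier R \<and> w \<in> carrier (C i) \<and> r \<odot>\<^bsub>C (i + 1)\<^esub> z \<ominus>\<^bsub>C (i + 1)\<^esub> D i w \<in> ?T" for r w
    by (auto simp: G_def intro!: exI[of _ "r \<odot>\<^bsub>C (i + 1)\<^esub> z"] exI[of _ r])
  have "linear_relation R (C i) G"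
    unfolding G_def
    by (intro linear_relation_pullback[OF module_C module_C D_hom tors_submodule]
        C1.linear_relation_multiples C0.R.oneideal C0.R.one_closed z)
  moreover have "w \<in> bd_tors i" if w: "(\<zero>\<^bsub>R\<^esub>, w) \<in> G" for w
  proof -
    have wc: "w \<in> carrier (C i)" and t: "\<ominus>\<^bsub>C (i + 1)\<^esub> D i w \<in> ?T"
      using w z by (auto simp: G_iff C1.M.minus_eq)
    have "D i w \<in> ?T" using C1.submodule_neg[OF tors_submodule t] D_closed[OF wc] by simp
    then show ?thesis using tors_exact wc by (simp add: tors_exact_def)
  qed
  moreover have "w \<in> carrier (C i)" if "(r, w) \<in> G" for r w using that by (simp add: G_iff)
  moreover have "baer R (C i) (carrier (C i)) (bd_tors i)" using tors_exact by (simp add: tors_exact_def)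
  ultimately obtain l where l: "l \<in> carrier (C i)"
    and lG: "\<And>r w. (r, w) \<in> G \<Longrightarrow> w \<ominus>\<^bsub>C i\<^esub> r \<odot>\<^bsub>C i\<^esub> l \<in> bd_tors i"
    using baerD[of R "C i" "carrier (C i)" "bd_tors i" G] by blast
  have D_bd_tors: "D i b \<in> ?T" if b: "b \<in> bd_tors i" for b
  proof -
    obtain u g where ug: "u \<in> boundaries C D i" "g \<in> tors R \<aa> (C i)" "b = u \<oplus>\<^bsub>C i\<^esub> g"
      using b unfolding bd_tors_def set_add_iff by blast
    have "u \<in> carrier (C i)" "D i u = \<zero>\<^bsub>C (i + 1)\<^esub>" using ug(1) boundaries_cycles by (auto simp: cycles_def)
    then show ?thesis using ug(2,3) D_tors[OF ug(2)] C0.submodule_carrier[OF tors_submodule ug(2)]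
      by (simp add: D_add)
  qed
  let ?z = "z \<ominus>\<^bsub>C (i + 1)\<^esub> D i l"
  have "?z \<in> ?T"
  proof (rule C1.tors_mod_idem[OF a_carrier])
    show "?z \<in> carrier (C (i + 1))" using z l by simp
    fix y assume y: "y \<in> \<aa>"
    obtain n :: nat where "(y [^]\<^bsub>R\<^esub> n) \<odot>\<^bsub>C (i + 1)\<^esub> z \<in> boundaries C D (i + 1)" using tz[OF y] by blast
    then obtain w where w: "w \<in> carrier (C i)" "(y [^]\<^bsub>R\<^esub> n) \<odot>\<^bsub>C (i + 1)\<^esub> z = D i w"
      unfolding boundaries_succ by blast
    define r where "r = y [^]\<^bsub>R\<^esub> n"
    have r: "r \<in> carrier R" using y a_carrier by (auto simp: r_def)
    have "(r, w) \<in> G" using r w C1.submodule_zero[OF tors_submodule]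
      by (simp add: G_iff r_def[symmetric] C1.M.minus_eq C1.M.r_neg)
    then have "D i (w \<ominus>\<^bsub>C i\<^esub> r \<odot>\<^bsub>C i\<^esub> l) \<in> ?T" using lG D_bd_tors by blast
    then have "r \<odot>\<^bsub>C (i + 1)\<^esub> z \<ominus>\<^bsub>C (i + 1)\<^esub> r \<odot>\<^bsub>C (i + 1)\<^esub> D i l \<in> ?T"
      using w r l by (simp add: D_minus D_smult r_def)
    moreover have "r \<odot>\<^bsub>C (i + 1)\<^esub> z \<ominus>\<^bsub>C (i + 1)\<^esub> r \<odot>\<^bsub>C (i + 1)\<^esub> D i l = r \<odot>\<^bsub>C (i + 1)\<^esub> ?z"
      using r z D_closed[OF l] by algebra
    ultimately show "\<exists>n::nat. (y [^]\<^bsub>R\<^esub> n) \<odot>\<^bsub>C (i + 1)\<^esub> ?z \<in> ?T" unfolding r_def by auto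
  qed
  then show ?thesis using bd_tors_iff z l by blast
qed

text \<open>
  By exactness at \<open>i\<close>, the boundaries of \<open>C / \<Gamma> C\<close> at \<open>i + 1\<close> are isomorphic to the cokernel at
  \<open>i\<close>.
\<close>
lemma tors_exact_baer:
  assumes tors_exact: "tors_exact i"
  shows "baer R (C (i + 1)) (bd_tors (i + 1)) (tors R \<aa> (C (i + 1)))"
  unfolding baer_def
proof (intro allI impI, elim conjE)
  interpret C0: module R "C i" by (rule module_C)
  interpret C1: module R "C (i + 1)" by (rule module_C)
  let ?T = "tors R \<aa> (C (i + 1))"
  note tc = C1.submodule_carrier[OF tors_submodule]
  fix G assume G: "linear_relation R (C (i + 1)) G" and Gb: "\<forall>r x. (r, x) \<in> G \<longrightarrow> x \<in> bd_tors (i + 1)"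
    and G0: "\<forall>x. (\<zero>\<^bsub>R\<^esub>, x) \<in> G \<longrightarrow> x \<in> ?T"
  note g = linear_relationD[OF G]
  define G' where "G' = {(r, w). w \<in> carrier (C i) \<and> (\<exists>x. (r, x) \<in> G \<and> x \<ominus>\<^bsub>C (i + 1)\<^esub> D i w \<in> ?T)}"
  have "linear_relation R (C i) G'"
    unfolding G'_def by (rule linear_relation_pullback[OF module_C module_C D_hom tors_submodule G])
  moreover have "w \<in> bd_tors i" if "(\<zero>\<^bsub>R\<^esub>, w) \<in> G'" for w
  proof -
    from that obtain x where a: "(\<zero>\<^bsub>R\<^esub>, x) \<in> G" "x \<ominus>\<^bsub>C (i + 1)\<^esub> D i w \<in> ?T" "w \<in> carrier (C i)"
      unfolding G'_def by blast
    have "x \<in> ?T" using G0 a(1) by blast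
    then have "x \<ominus>\<^bsub>C (i + 1)\<^esub> (x \<ominus>\<^bsub>C (i + 1)\<^esub> D i w) \<in> ?T" using a(2) by (rule C1.submodule_minus[OF tors_submodule])
    moreover have "x \<ominus>\<^bsub>C (i + 1)\<^esub> (x \<ominus>\<^bsub>C (i + 1)\<^esub> D i w) = D i w"
      using g(2)[OF a(1)] D_closed[OF a(3)] by algebra
    ultimately show ?thesis using tors_exact a(3) by (simp add: tors_exact_def)
  qed
  moreover have "w \<in> carrier (C i)" if "(r, w) \<in> G'" for r w using that by (simp add: G'_def)
  moreover have "baer R (C i) (carrier (C i)) (bd_tors i)" using tors_exact by (simp add: tors_exact_def)
  ultimately obtain l where l: "l \<in> carrier (C i)"
    and lG: "\<And>r w. (r, w) \<in> G' \<Longrightarrow> w \<ominus>\<^bsub>C i\<^esub> r \<odot>\<^bsub>C i\<^esub> l \<in> bd_tors i"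
    using baerD[of R "C i" "carrier (C i)" "bd_tors i" G'] by blast
  have "x \<ominus>\<^bsub>C (i + 1)\<^esub> r \<odot>\<^bsub>C (i + 1)\<^esub> D i l \<in> ?T" if rx: "(r, x) \<in> G" for r x
  proof -
    obtain w where w: "w \<in> carrier (C i)" "x \<ominus>\<^bsub>C (i + 1)\<^esub> D i w \<in> ?T" using Gb rx bd_tors_iff by blast
    have r: "r \<in> carrier R" and x: "x \<in> carrier (C (i + 1))" using g(1,2)[OF rx] by auto
    have "w \<ominus>\<^bsub>C i\<^esub> r \<odot>\<^bsub>C i\<^esub> l \<in> bd_tors i" by (rule lG) (use w rx in \<open>auto simp: G'_def\<close>)
    then obtain u h where uh: "u \<in> boundaries C D i" "h \<in> tors R \<aa> (C i)" "w \<ominus>\<^bsub>C i\<^esub> r \<odot>\<^bsub>C i\<^esub> l = u \<oplus>\<^bsub>C i\<^esub> h"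
      unfolding bd_tors_def set_add_iff by blast
    have "u \<in> carrier (C i)" "D i u = \<zero>\<^bsub>C (i + 1)\<^esub>" using uh(1) boundaries_cycles by (auto simp: cycles_def)
    then have "D i (w \<ominus>\<^bsub>C i\<^esub> r \<odot>\<^bsub>C i\<^esub> l) \<in> ?T"
      unfolding uh(3) using D_tors[OF uh(2)] C0.submodule_carrier[OF tors_submodule uh(2)]
      by (simp add: D_add)
    then have "D i w \<ominus>\<^bsub>C (i + 1)\<^esub> r \<odot>\<^bsub>C (i + 1)\<^esub> D i l \<in> ?T"
      using w(1) r l by (simp add: D_minus D_smult)
    with w(2) have "(x \<ominus>\<^bsub>C (i + 1)\<^esub> D i w) \<oplus>\<^bsub>C (i + 1)\<^esub> (D i w \<ominus>\<^bsub>C (i + 1)\<^esub> r \<odot>\<^bsub>C (i + 1)\<^esub> D i l) \<in> ?T"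
      by (rule C1.submodule_add[OF tors_submodule])
    moreover have "(x \<ominus>\<^bsub>C (i + 1)\<^esub> D i w) \<oplus>\<^bsub>C (i + 1)\<^esub> (D i w \<ominus>\<^bsub>C (i + 1)\<^esub> r \<odot>\<^bsub>C (i + 1)\<^esub> D i l) =
        x \<ominus>\<^bsub>C (i + 1)\<^esub> r \<odot>\<^bsub>C (i + 1)\<^esub> D i l"
      using x r D_closed[OF w(1)] D_closed[OF l] by algebra
    ultimately show ?thesis by simp
  qed
  moreover have "D i l \<in> bd_tors (i + 1)"
    using bd_tors_iff l C1.submodule_zero[OF tors_submodule] by (auto simp: C1.M.minus_eq C1.M.r_neg intro!: bexI[of _ l])
  ultimately show "\<exists>l\<in>bd_tors (i + 1). \<forall>r x. (r, x) \<in> G \<longrightarrow> x \<ominus>\<^bsub>C (i + 1)\<^esub> r \<odot>\<^bsub>C (i + 1)\<^esub> l \<in> ?T"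
    by blast
qed

text \<open>
  If \<open>D z\<close> is torsion, then \<open>z\<close> has multiples \<open>y\<^sup>n z\<close> that are cocycles, and these are torsion
  modulo boundaries in negative degrees; so \<open>tors_exact_lift\<close> applies to \<open>z\<close>.
\<close>
lemma tors_exact_step:
  assumes "tors_exact i" "i + 1 < 0"
  shows "tors_exact (i + 1)"
  unfolding tors_exact_def
proof (intro conjI ballI impI)
  interpret C1: module R "C (i + 1)" by (rule module_C)
  interpret C2: module R "C (i + 1 + 1)" by (rule module_C)
  fix z assume z: "z \<in> carrier (C (i + 1))" and Dz: "D (i + 1) z \<in> tors R \<aa> (C (i + 1 + 1))"
  show "z \<in> bd_tors (i + 1)"
  proof (rule tors_exact_lift[OF assms(1) z])
    fix y assume y: "y \<in> \<aa>"
    then have yc: "y \<in> carrier R" using a_carrier by blast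
    obtain n :: nat where n: "(y [^]\<^bsub>R\<^esub> n) \<odot>\<^bsub>C (i + 1 + 1)\<^esub> D (i + 1) z = \<zero>\<^bsub>C (i + 1 + 1)\<^esub>"
      using Dz y unfolding tors_mod_def by blast
    then have "(y [^]\<^bsub>R\<^esub> n) \<odot>\<^bsub>C (i + 1)\<^esub> z \<in> cycles C D (i + 1)"
      using z yc by (simp add: cycles_def D_smult)
    then have "(y [^]\<^bsub>R\<^esub> n) \<odot>\<^bsub>C (i + 1)\<^esub> z \<in> tors_mod R \<aa> (C (i + 1)) (boundaries C D (i + 1))"
      using neg[OF assms(2)] by blast
    then obtain m :: nat where "(y [^]\<^bsub>R\<^esub> m) \<odot>\<^bsub>C (i + 1)\<^esub> ((y [^]\<^bsub>R\<^esub> n) \<odot>\<^bsub>C (i + 1)\<^esub> z) \<in> boundaries C D (i + 1)"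
      using y unfolding tors_mod_def by blast
    then show "\<exists>n::nat. (y [^]\<^bsub>R\<^esub> n) \<odot>\<^bsub>C (i + 1)\<^esub> z \<in> boundaries C D (i + 1)"
      using C1.pow_smult_add[OF yc z, of m n] by metis
  qed
next
  interpret C1: module R "C (i + 1)" by (rule module_C)
  show "baer R (C (i + 1)) (carrier (C (i + 1))) (bd_tors (i + 1))"
  proof (rule C1.baer_quotient[OF noeth bd_tors_submodule tors_submodule _ baer_C tors_exact_baer[OF assms(1)]])
    show "tors R \<aa> (C (i + 1)) \<subseteq> bd_tors (i + 1)"
    proof
      fix x assume x: "x \<in> tors R \<aa> (C (i + 1))"
      have "x = \<zero>\<^bsub>C (i + 1)\<^esub> \<oplus>\<^bsub>C (i + 1)\<^esub> x" using C1.submodule_carrier[OF tors_submodule x] by simp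
      then show "x \<in> bd_tors (i + 1)"
        unfolding bd_tors_def set_add_iff using x C1.submodule_zero[OF boundaries_submodule] by blast
    qed
  qed
qed

lemma tors_exact_minus_one: "tors_exact (- 1)"
proof -
  obtain k0 where k0: "\<And>i. i < k0 \<Longrightarrow> carrier (C i) = {\<zero>\<^bsub>C i\<^esub>}" using bounded by blast
  define k where "k = min k0 0 - 1"
  have ck: "carrier (C k) = {\<zero>\<^bsub>C k\<^esub>}" using k0 by (simp add: k_def)
  interpret Ck: module R "C k" by (rule module_C)
  have b: "bd_tors k = carrier (C k)"
  proof
    show "bd_tors k \<subseteq> carrier (C k)" by (rule Ck.submoduleE(1)[OF bd_tors_submodule])
    show "carrier (C k) \<subseteq> bd_tors k" unfolding ck using Ck.submodule_zero[OF bd_tors_submodule] by simp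
  qed
  have gk: "tors_exact k"
    unfolding tors_exact_def
  proof (intro conjI ballI impI)
    show "w \<in> bd_tors k" if "w \<in> carrier (C k)" for w using b that by simp
    have "x \<ominus>\<^bsub>C k\<^esub> r \<odot>\<^bsub>C k\<^esub> \<zero>\<^bsub>C k\<^esub> \<in> carrier (C k)"
      if "linear_relation R (C k) G" "(r, x) \<in> G" for G r x
      using linear_relationD(1,2)[OF that(1) that(2)] by simp
    then show "baer R (C k) (carrier (C k)) (bd_tors k)"
      unfolding baer_def b using Ck.M.zero_closed by blast
  qed
  have "k \<le> - 1" by (simp add: k_def)
  have "i \<le> - 1 \<longrightarrow> tors_exact i" if "k \<le> i" for i
    using that
  proof (induction i rule: int_ge_induct)
    case base
    then show ?case using gk by simp
  next
    case (step i)
    then show ?case using tors_exact_step[of i] by simp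
  qed
  then show ?thesis using \<open>k \<le> - 1\<close> by simp
qed

text \<open>
  Injectivity of \<open>H\<^sup>0(\<Gamma> C) \<rightarrow> H\<^sup>0(C)\<close>.
\<close>
lemma tors_boundary:
  assumes z: "z \<in> tors R \<aa> (C 0)" "z \<in> boundaries C D 0"
  shows "z \<in> D (- 1) ` tors R \<aa> (C (- 1))"
proof -
  interpret C1: module R "C (- 1)" by (rule module_C)
  obtain w where w: "w \<in> carrier (C (- 1))" "z = D (- 1) w"
    using z(2) boundaries_succ[of "- 1"] by auto
  have "w \<in> bd_tors (- 1)" using tors_exact_minus_one w z(1) by (auto simp: tors_exact_def)
  then obtain u g where ug: "u \<in> boundaries C D (- 1)" "g \<in> tors R \<aa> (C (- 1))" "w = u \<oplus>\<^bsub>C (- 1)\<^esub> g"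
    unfolding bd_tors_def set_add_iff by blast
  interpret C0: module R "C (- 1 + 1)" by (rule module_C)
  have g: "g \<in> carrier (C (- 1))" using C1.submodule_carrier[OF tors_submodule ug(2)] .
  have u: "u \<in> carrier (C (- 1))" "D (- 1) u = \<zero>\<^bsub>C (- 1 + 1)\<^esub>"
    using subsetD[OF boundaries_cycles ug(1)] unfolding cycles_def by blast+
  have "D (- 1) w = \<zero>\<^bsub>C (- 1 + 1)\<^esub> \<oplus>\<^bsub>C (- 1 + 1)\<^esub> D (- 1) g" unfolding ug(3) D_add[OF u(1) g] u(2) ..
  then have "z = D (- 1) g" using w(2) C0.M.l_zero[OF D_closed[OF g]] by metis
  then show ?thesis using ug(2) by blast
qed

text \<open>
  Surjectivity of \<open>H\<^sup>0(\<Gamma> C)\<close> onto the torsion of \<open>H\<^sup>0(C)\<close>.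
\<close>
lemma torsion_class_lift:
  assumes z: "z \<in> cycles C D 0"
    and tz: "\<And>y. y \<in> \<aa> \<Longrightarrow> \<exists>n::nat. (y [^]\<^bsub>R\<^esub> n) \<odot>\<^bsub>C 0\<^esub> z \<in> boundaries C D 0"
  obtains g where "g \<in> tors R \<aa> (C 0)" "g \<in> cycles C D 0" "z \<ominus>\<^bsub>C 0\<^esub> g \<in> boundaries C D 0"
proof -
  interpret C0: module R "C 0" by (rule module_C)
  have zc: "z \<in> carrier (C 0)" using z by (simp add: cycles_def)
  have "z \<in> bd_tors 0" using tors_exact_lift[OF tors_exact_minus_one, of z] zc tz by simp
  then obtain u g where ug: "u \<in> boundaries C D 0" "g \<in> tors R \<aa> (C 0)" "z = u \<oplus>\<^bsub>C 0\<^esub> g"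
    unfolding bd_tors_def set_add_iff by blast
  have uc: "u \<in> carrier (C 0)" "g \<in> carrier (C 0)"
    using C0.submodule_carrier[OF boundaries_submodule ug(1)] C0.submodule_carrier[OF tors_submodule ug(2)] .
  have "g = z \<ominus>\<^bsub>C 0\<^esub> u" "z \<ominus>\<^bsub>C 0\<^esub> g = u" unfolding ug(3) using uc by algebra+
  moreover have "z \<ominus>\<^bsub>C 0\<^esub> u \<in> cycles C D 0"
    using C0.submodule_minus[OF cycles_submodule z] ug(1) boundaries_cycles by blast
  ultimately show thesis using that ug(1,2) by simp
qed

lemma torsion_cycles: "cycles (\<lambda>i. torsion R \<aa> (C i)) D i = cycles C D i \<inter> tors R \<aa> (C i)"
  using module.carrier_torsion[OF module_C noeth ideal_a]
  by (auto simp: cycles_def torsion_def tors_mod_def)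

lemma torsion_boundaries: "boundaries (\<lambda>i. torsion R \<aa> (C i)) D i = D (i - 1) ` tors R \<aa> (C (i - 1))"
  using module.carrier_torsion[OF module_C noeth ideal_a] by (simp add: boundaries_def)

lemma coh_Ass_torsion_zero:
  "coh_Ass R (\<lambda>i. torsion R \<aa> (C i)) D 0 = subquot_Ass R M (carrier M) L \<inter> V R \<aa>"
proof -
  interpret C0: module R "C 0" by (rule module_C)
  interpret M: module R M by (rule module_M)
  let ?C = "\<lambda>i. torsion R \<aa> (C i)"
  let ?B = "boundaries C D 0" and ?T = "tors R \<aa> (C 0)"
  have smult: "smult (torsion R \<aa> (C 0)) = smult (C 0)" by (simp add: torsion_def)
  have TB: "boundaries ?C D 0 = ?B \<inter> ?T"
  proof
    show "boundaries ?C D 0 \<subseteq> ?B \<inter> ?T"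
      using D_tors[of _ "- 1"] boundaries_succ[of "- 1"] by (auto simp: torsion_boundaries tors_mod_def)
    show "?B \<inter> ?T \<subseteq> boundaries ?C D 0" using tors_boundary by (auto simp: torsion_boundaries)
  qed
  have colT: "colon R (torsion R \<aa> (C 0)) (boundaries ?C D 0) z = colon R (C 0) ?B z" if "z \<in> ?T" for z
    using C0.submodule_smult[OF tors_submodule _ that] by (auto simp: colon_def TB smult)
  have cong: "colon R (C 0) ?B z = colon R (C 0) ?B z'"
    if z: "z \<in> carrier (C 0)" "z' \<in> carrier (C 0)" "z \<ominus>\<^bsub>C 0\<^esub> z' \<in> ?B" for z z'
  proof -
    have "r \<odot>\<^bsub>C 0\<^esub> z \<in> ?B \<longleftrightarrow> r \<odot>\<^bsub>C 0\<^esub> z' \<in> ?B" if r: "r \<in> carrier R" for r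
    proof -
      have "r \<odot>\<^bsub>C 0\<^esub> z = r \<odot>\<^bsub>C 0\<^esub> z' \<oplus>\<^bsub>C 0\<^esub> r \<odot>\<^bsub>C 0\<^esub> (z \<ominus>\<^bsub>C 0\<^esub> z')" using r z(1,2) by algebra
      then show ?thesis
        using C0.submodule_add_iff[OF boundaries_submodule _ C0.submodule_smult[OF boundaries_submodule r z(3)],
            of "r \<odot>\<^bsub>C 0\<^esub> z'"] r z(2) by simp
    qed
    then show ?thesis by (auto simp: colon_def)
  qed
  have col\<eta>: "colon R (C 0) ?B (\<eta> m) = colon R M L m" if m: "m \<in> carrier M" for m
  proof -
    have "r \<odot>\<^bsub>C 0\<^esub> \<eta> m \<in> ?B \<longleftrightarrow> r \<odot>\<^bsub>M\<^esub> m \<in> L" if r: "r \<in> carrier R" for r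
      using \<eta>_ker[OF M.smult_closed[OF r m]] mod_homD(3)[OF \<eta>_hom r m] by simp
    then show ?thesis by (auto simp: colon_def)
  qed
  have \<eta>c: "\<eta> m \<in> carrier (C 0)" if "m \<in> carrier M" for m using mod_homD(1)[OF \<eta>_hom that] .
  have "p \<in> subquot_Ass R M (carrier M) L \<inter> V R \<aa>" if p: "p \<in> coh_Ass R ?C D 0" for p
  proof -
    from p obtain z where pr: "primeideal p R" and z: "z \<in> cycles C D 0" "z \<in> ?T"
      and pz: "p = colon R (C 0) ?B z"
      unfolding coh_Ass_def subquot_Ass_def torsion_cycles using colT by blast
    have zc: "z \<in> carrier (C 0)" using z by (simp add: cycles_def)
    obtain m where m: "m \<in> carrier M" "z \<ominus>\<^bsub>C 0\<^esub> \<eta> m \<in> ?B" using \<eta>_surj[OF z(1)] by blast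
    have "p = colon R M L m" using pz cong[OF zc \<eta>c[OF m(1)] m(2)] col\<eta>[OF m(1)] by simp
    moreover have "\<aa> \<subseteq> p"
    proof
      fix y assume y: "y \<in> \<aa>"
      then have yc: "y \<in> carrier R" using a_carrier by blast
      obtain n :: nat where "(y [^]\<^bsub>R\<^esub> n) \<odot>\<^bsub>C 0\<^esub> z = \<zero>\<^bsub>C 0\<^esub>" using z(2) y unfolding tors_mod_def by blast
      then have "y [^]\<^bsub>R\<^esub> n \<in> p" using yc C0.submodule_zero[OF boundaries_submodule] by (simp add: pz colon_def)
      then show "y \<in> p" by (rule C0.R.primeideal_pow[OF pr yc])
    qed
    ultimately show ?thesis using pr m(1) by (auto simp: subquot_Ass_def V_def)
  qed
  moreover have "p \<in> coh_Ass R ?C D 0" if p: "p \<in> subquot_Ass R M (carrier M) L" "p \<in> V R \<aa>" for p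
  proof -
    from p obtain m where pr: "primeideal p R" and ap: "\<aa> \<subseteq> p" and m: "m \<in> carrier M"
      and pm: "p = colon R M L m" by (auto simp: subquot_Ass_def V_def)
    have pz: "p = colon R (C 0) ?B (\<eta> m)" using pm col\<eta>[OF m] by simp
    have "\<exists>n::nat. (y [^]\<^bsub>R\<^esub> n) \<odot>\<^bsub>C 0\<^esub> \<eta> m \<in> ?B" if y: "y \<in> \<aa>" for y
    proof -
      have "y \<odot>\<^bsub>C 0\<^esub> \<eta> m \<in> ?B" using y ap pz by (auto simp: colon_def)
      then show ?thesis using y a_carrier by (intro exI[of _ 1]) auto
    qed
    then obtain g where g: "g \<in> ?T" "g \<in> cycles C D 0" "\<eta> m \<ominus>\<^bsub>C 0\<^esub> g \<in> ?B"
      using torsion_class_lift[OF \<eta>_cycle[OF m]] by metis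
    have gc: "g \<in> carrier (C 0)" using g(2) by (simp add: cycles_def)
    have "p = colon R (torsion R \<aa> (C 0)) (boundaries ?C D 0) g"
      using pz cong[OF \<eta>c[OF m] gc g(3)] colT[OF g(1)] by simp
    then show ?thesis using pr g(1,2) unfolding coh_Ass_def subquot_Ass_def torsion_cycles by blast
  qed
  ultimately show ?thesis by blast
qed

end

section \<open>Cones on filter regular elements\<close>

lemma (in torsion_resolution) torsion_is_complex:
  "cochain_complex R (\<lambda>i. torsion R \<aa> (C i)) D"
proof (rule cochain_complex.intro)
  have eq: "torsion R \<aa> (C i) = C i\<lparr>carrier := tors R \<aa> (C i)\<rparr>" for i
    using module.carrier_torsion[OF module_C[of i] noeth ideal_a] by (simp add: torsion_def)
  fix i
  show "module R (torsion R \<aa> (C i))"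
    unfolding eq by (rule submodule.submodule_is_module[OF tors_submodule module_C])
  have tc: "u \<in> carrier (C i)" if "u \<in> tors R \<aa> (C i)" for u using that by (simp add: tors_mod_def)
  show "D i \<in> mod_hom R (torsion R \<aa> (C i)) (torsion R \<aa> (C (i + 1)))"
    unfolding eq by (rule mod_homI) (auto simp: D_tors D_add D_smult tc)
  show "D (i + 1) (D i u) = \<zero>\<^bsub>torsion R \<aa> (C (i + 1 + 1))\<^esub>" if "u \<in> carrier (torsion R \<aa> (C i))" for u
    using that unfolding eq by (simp add: D_D tc)
qed

lemma (in cone_complex) cone_tors_iff:
  assumes a: "\<aa> \<subseteq> carrier R"
  shows "interleave u v \<in> tors R \<aa> (cone C i) \<longleftrightarrow> u \<in> tors R \<aa> (C i) \<and> v \<in> tors R \<aa> (C (i + 1))"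
proof -
  interpret C0: module R "C i" by (rule module_C)
  interpret C1: module R "C (i + 1)" by (rule module_C)
  have z: "\<zero>\<^bsub>cone C i\<^esub> = interleave \<zero>\<^bsub>C i\<^esub> \<zero>\<^bsub>C (i + 1)\<^esub>" by (simp add: cone_def)
  show ?thesis
  proof
    assume "interleave u v \<in> tors R \<aa> (cone C i)"
    then show "u \<in> tors R \<aa> (C i) \<and> v \<in> tors R \<aa> (C (i + 1))"
      unfolding tors_mod_def by (simp add: z) blast
  next
    assume uv: "u \<in> tors R \<aa> (C i) \<and> v \<in> tors R \<aa> (C (i + 1))"
    then have c: "u \<in> carrier (C i)" "v \<in> carrier (C (i + 1))" by (auto simp: tors_mod_def)
    show "interleave u v \<in> tors R \<aa> (cone C i)"
      unfolding tors_mod_def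
    proof (intro CollectI conjI ballI)
      fix y assume y: "y \<in> \<aa>"
      then have yc: "y \<in> carrier R" using a by blast
      obtain m n :: nat where mn: "(y [^]\<^bsub>R\<^esub> m) \<odot>\<^bsub>C i\<^esub> u = \<zero>\<^bsub>C i\<^esub>" "(y [^]\<^bsub>R\<^esub> n) \<odot>\<^bsub>C (i + 1)\<^esub> v = \<zero>\<^bsub>C (i + 1)\<^esub>"
        using uv y unfolding tors_mod_def by blast
      have "(y [^]\<^bsub>R\<^esub> (n + m)) \<odot>\<^bsub>C i\<^esub> u = \<zero>\<^bsub>C i\<^esub>" using mn(1) yc c by (simp add: C0.pow_smult_add)
      moreover have "(y [^]\<^bsub>R\<^esub> (n + m)) \<odot>\<^bsub>C (i + 1)\<^esub> v = \<zero>\<^bsub>C (i + 1)\<^esub>"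
        using C1.pow_smult_add[OF yc c(2), of m n] mn(2) yc unfolding add.commute[of n m] by simp
      ultimately have "(y [^]\<^bsub>R\<^esub> (n + m)) \<odot>\<^bsub>cone C i\<^esub> interleave u v = \<zero>\<^bsub>cone C i\<^esub>" by (simp add: z)
      then show "\<exists>n::nat. (y [^]\<^bsub>R\<^esub> n) \<odot>\<^bsub>cone C i\<^esub> interleave u v \<in> {\<zero>\<^bsub>cone C i\<^esub>}" by blast
    qed (use c in simp)
  qed
qed

lemma (in cone_complex) baer_cone:
  assumes a: "\<aa> \<subseteq> carrier R"
    and b: "baer R (C i) (carrier (C i)) (tors R \<aa> (C i))"
      "baer R (C (i + 1)) (carrier (C (i + 1))) (tors R \<aa> (C (i + 1)))"
  shows "baer R (cone C i) (carrier (cone C i)) (tors R \<aa> (cone C i))"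
  unfolding baer_def
proof (intro allI impI, elim conjE)
  interpret C0: module R "C i" by (rule module_C)
  interpret C1: module R "C (i + 1)" by (rule module_C)
  interpret K: module R "cone C i" by (rule cone.module_C)
  have z: "\<zero>\<^bsub>cone C i\<^esub> = interleave \<zero>\<^bsub>C i\<^esub> \<zero>\<^bsub>C (i + 1)\<^esub>" by (simp add: cone_def)
  have ad: "interleave u v \<oplus>\<^bsub>cone C i\<^esub> interleave u' v' = interleave (u \<oplus>\<^bsub>C i\<^esub> u') (v \<oplus>\<^bsub>C (i + 1)\<^esub> v')"
    for u v u' v' by (simp add: cone_def)
  fix G assume G: "linear_relation R (cone C i) G"
    and G0: "\<forall>f. (\<zero>\<^bsub>R\<^esub>, f) \<in> G \<longrightarrow> f \<in> tors R \<aa> (cone C i)"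
  note g = linear_relationD[OF G]
  have ev: "evens \<in> mod_hom R (cone C i) (C i)" and od: "odds \<in> mod_hom R (cone C i) (C (i + 1))"
    by (auto intro!: mod_homI simp: cone_def pair_module_def)
  have G0': "evens f \<in> tors R \<aa> (C i)" "odds f \<in> tors R \<aa> (C (i + 1))" if "(\<zero>\<^bsub>R\<^esub>, f) \<in> G" for f
    using G0 that cone_tors_iff[OF a, of "evens f" "odds f" i] by auto
  obtain l1 where l1: "l1 \<in> carrier (C i)"
    "\<And>r u. (r, u) \<in> {(r, evens f) | r f. (r, f) \<in> G} \<Longrightarrow> u \<ominus>\<^bsub>C i\<^esub> r \<odot>\<^bsub>C i\<^esub> l1 \<in> tors R \<aa> (C i)"
    by (rule baerD[OF b(1) linear_relation_image[OF cone.module_C module_C ev G]])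
      (use g(2) mod_homD(1)[OF ev] G0'(1) in blast)+
  obtain l2 where l2: "l2 \<in> carrier (C (i + 1))"
    "\<And>r u. (r, u) \<in> {(r, odds f) | r f. (r, f) \<in> G} \<Longrightarrow>
      u \<ominus>\<^bsub>C (i + 1)\<^esub> r \<odot>\<^bsub>C (i + 1)\<^esub> l2 \<in> tors R \<aa> (C (i + 1))"
    by (rule baerD[OF b(2) linear_relation_image[OF cone.module_C module_C od G]])
      (use g(2) mod_homD(1)[OF od] G0'(2) in blast)+
  have "f \<ominus>\<^bsub>cone C i\<^esub> r \<odot>\<^bsub>cone C i\<^esub> interleave l1 l2 \<in> tors R \<aa> (cone C i)" if rf: "(r, f) \<in> G" for r f
  proof -
    obtain u v where fe: "f = interleave u v" by (rule interleave_cases)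
    have r: "r \<in> carrier R" using g(1)[OF rf] .
    have "\<ominus>\<^bsub>cone C i\<^esub> interleave (r \<odot>\<^bsub>C i\<^esub> l1) (r \<odot>\<^bsub>C (i + 1)\<^esub> l2) =
        interleave (\<ominus>\<^bsub>C i\<^esub> (r \<odot>\<^bsub>C i\<^esub> l1)) (\<ominus>\<^bsub>C (i + 1)\<^esub> (r \<odot>\<^bsub>C (i + 1)\<^esub> l2))"
      by (rule K.M.minus_equality) (use r l1(1) l2(1) in \<open>simp_all add: ad z C0.M.l_neg C1.M.l_neg\<close>)
    then have "f \<ominus>\<^bsub>cone C i\<^esub> r \<odot>\<^bsub>cone C i\<^esub> interleave l1 l2 =
        interleave (u \<ominus>\<^bsub>C i\<^esub> r \<odot>\<^bsub>C i\<^esub> l1) (v \<ominus>\<^bsub>C (i + 1)\<^esub> r \<odot>\<^bsub>C (i + 1)\<^esub> l2)"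
      unfolding fe cone_smult K.M.minus_eq C0.M.minus_eq C1.M.minus_eq by (simp add: ad)
    moreover have "(r, u) \<in> {(r, evens f) | r f. (r, f) \<in> G}" "(r, v) \<in> {(r, odds f) | r f. (r, f) \<in> G}"
      using rf unfolding fe by force+
    ultimately show ?thesis using l1(2) l2(2) cone_tors_iff[OF a] by simp
  qed
  moreover have "interleave l1 l2 \<in> carrier (cone C i)" using l1(1) l2(1) by simp
  ultimately show "\<exists>l\<in>carrier (cone C i). \<forall>r f. (r, f) \<in> G \<longrightarrow>
      f \<ominus>\<^bsub>cone C i\<^esub> r \<odot>\<^bsub>cone C i\<^esub> l \<in> tors R \<aa> (cone C i)" by blast
qed

text \<open>
  This is the long exact sequence of the cone, element by element. Filter regularity of \<open>x\<close> enters in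
  degree \<open>-1\<close> only, where the new cohomology contains the elements of \<open>M / L\<close> killed by \<open>x\<close>.
\<close>
lemma torsion_resolution_cone:
  fixes C :: "int \<Rightarrow> ('a, nat \<Rightarrow> 'e, 'n) module_scheme"
  assumes res: "torsion_resolution R C D \<aa> M \<eta> L" and xa: "x \<in> \<aa>"
    and reg: "\<And>m. m \<in> carrier M \<Longrightarrow> x \<odot>\<^bsub>M\<^esub> m \<in> L \<Longrightarrow> m \<in> tors_mod R \<aa> M L"
  shows "torsion_resolution R (cone C) (cone_diff R C D x) \<aa> M (\<lambda>m. interleave (\<eta> m) \<zero>\<^bsub>C 1\<^esub>)
    {l \<oplus>\<^bsub>M\<^esub> x \<odot>\<^bsub>M\<^esub> m | l m. l \<in> L \<and> m \<in> carrier M}"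
proof -
  interpret torsion_resolution R C D \<aa> M \<eta> L by fact
  interpret cone_complex R C D x by unfold_locales (use xa a_carrier in blast)
  interpret M: module R M by (rule module_M)
  have zadd: "(0::int) + 1 = 1" by simp
  have Lc: "l \<in> carrier M" if "l \<in> L" for l using M.submodule_carrier[OF submodule_L that] .
  \<comment> \<open>modulo boundaries, \<open>(u, D w)\<close> is \<open>(u + x w, 0)\<close>\<close>
  have shift: "\<exists>w\<in>carrier (C i). v = D i w \<and> u \<oplus>\<^bsub>C i\<^esub> x \<odot>\<^bsub>C i\<^esub> w \<in> cycles C D i"
    if uv: "interleave u v \<in> cycles (cone C) (cone_diff R C D x) i" and v: "v \<in> boundaries C D (i + 1)"
    for u v i
  proof -
    interpret C0: module R "C i" by (rule module_C)
    interpret C1: module R "C (i + 1)" by (rule module_C)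
    obtain w where w: "w \<in> carrier (C i)" "v = D i w" using v unfolding boundaries_succ by blast
    have "D i u \<oplus>\<^bsub>C (i + 1)\<^esub> x \<odot>\<^bsub>C (i + 1)\<^esub> v = \<zero>\<^bsub>C (i + 1)\<^esub>" "u \<in> carrier (C i)"
      using uv by (simp_all add: cone_cycles_iff)
    then have "u \<oplus>\<^bsub>C i\<^esub> x \<odot>\<^bsub>C i\<^esub> w \<in> cycles C D i"
      using w x by (simp add: cycles_def D_add D_smult)
    then show ?thesis using w by blast
  qed
  show ?thesis
  proof (intro torsion_resolution.intro torsion_resolution_axioms.intro)
    show "cochain_complex R (cone C) (cone_diff R C D x)" by (rule cone_is_complex)
    show "noetherian_ring R" "ideal \<aa> R" "module R M" by (fact noeth ideal_a module_M)+
    obtain k where k: "\<And>i. i < k \<Longrightarrow> carrier (C i) = {\<zero>\<^bsub>C i\<^esub>}" using bounded by blast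
    have "carrier (cone C i) = {\<zero>\<^bsub>cone C i\<^esub>}" if "i < k - 1" for i
    proof -
      have "f \<in> carrier (cone C i) \<longleftrightarrow> f = \<zero>\<^bsub>cone C i\<^esub>" for f
        by (rule interleave_cases[of f]) (use that k[of i] k[of "i + 1"] in \<open>simp add: cone_def\<close>)
      then show ?thesis by blast
    qed
    then show "\<exists>k. \<forall>i<k. carrier (cone C i) = {\<zero>\<^bsub>cone C i\<^esub>}" by blast
    show "baer R (cone C i) (carrier (cone C i)) (tors R \<aa> (cone C i))" for i
      by (rule baer_cone[OF a_carrier baer_C baer_C])
  next
    fix i :: int assume i: "i < 0"
    interpret C0: module R "C i" by (rule module_C)
    interpret C1: module R "C (i + 1)" by (rule module_C)
    interpret K: module R "cone C i" by (rule cone.module_C)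
    show "cycles (cone C) (cone_diff R C D x) i \<subseteq> tors_mod R \<aa> (cone C i) (boundaries (cone C) (cone_diff R C D x) i)"
    proof
      fix f assume f: "f \<in> cycles (cone C) (cone_diff R C D x) i"
      obtain u v where fe: "f = interleave u v" by (rule interleave_cases)
      have uv: "u \<in> carrier (C i)" "v \<in> cycles C D (i + 1)"
        "D i u \<oplus>\<^bsub>C (i + 1)\<^esub> x \<odot>\<^bsub>C (i + 1)\<^esub> v = \<zero>\<^bsub>C (i + 1)\<^esub>"
        using f unfolding fe by (simp_all add: cone_cycles_iff)
      have vc: "v \<in> carrier (C (i + 1))" using uv(2) by (simp add: cycles_def)
      have fc: "f \<in> carrier (cone C i)" using f by (simp add: cycles_def)
      have vt: "v \<in> tors_mod R \<aa> (C (i + 1)) (boundaries C D (i + 1))"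
      proof (cases "i + 1 < 0")
        case True
        then show ?thesis using neg uv(2) by blast
      next
        case False
        then have i0: "i + 1 = 0" using i by simp
        obtain m where m: "m \<in> carrier M" "v \<ominus>\<^bsub>C (i + 1)\<^esub> \<eta> m \<in> boundaries C D (i + 1)"
          using \<eta>_surj uv(2) unfolding i0 by blast
        have \<eta>m: "\<eta> m \<in> carrier (C (i + 1))" using mod_homD(1)[OF \<eta>_hom m(1)] unfolding i0 .
        have "x \<odot>\<^bsub>C (i + 1)\<^esub> v = D i (\<ominus>\<^bsub>C i\<^esub> u)"
          using uv(1,3) vc x C1.M.minus_equality[of "x \<odot>\<^bsub>C (i + 1)\<^esub> v" "D i u"]
          by (simp add: D_neg C1.M.a_comm)
        then have 1: "x \<odot>\<^bsub>C (i + 1)\<^esub> v \<in> boundaries C D (i + 1)"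
          unfolding boundaries_succ using uv(1) by simp
        have 2: "x \<odot>\<^bsub>C (i + 1)\<^esub> (v \<ominus>\<^bsub>C (i + 1)\<^esub> \<eta> m) \<in> boundaries C D (i + 1)"
          using C1.submodule_smult[OF boundaries_submodule x m(2)] .
        have "x \<odot>\<^bsub>C (i + 1)\<^esub> \<eta> m = x \<odot>\<^bsub>C (i + 1)\<^esub> v \<ominus>\<^bsub>C (i + 1)\<^esub> x \<odot>\<^bsub>C (i + 1)\<^esub> (v \<ominus>\<^bsub>C (i + 1)\<^esub> \<eta> m)"
          using x vc \<eta>m by algebra
        then have "x \<odot>\<^bsub>C (i + 1)\<^esub> \<eta> m \<in> boundaries C D (i + 1)"
          using C1.submodule_minus[OF boundaries_submodule 1 2] by simp
        then have "\<eta> (x \<odot>\<^bsub>M\<^esub> m) \<in> boundaries C D 0" using mod_homD(3)[OF \<eta>_hom x m(1)] unfolding i0 by simp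
        then have mt: "m \<in> tors_mod R \<aa> M L" using reg[OF m(1)] \<eta>_ker x m(1) by simp
        have \<eta>t: "\<eta> m \<in> tors_mod R \<aa> (C (i + 1)) (boundaries C D (i + 1))"
          unfolding tors_mod_def
        proof (intro CollectI conjI ballI \<eta>m)
          fix y assume y: "y \<in> \<aa>"
          then obtain n :: nat where n: "(y [^]\<^bsub>R\<^esub> n) \<odot>\<^bsub>M\<^esub> m \<in> L" using mt unfolding tors_mod_def by blast
          have yn: "y [^]\<^bsub>R\<^esub> n \<in> carrier R" using y a_carrier by auto
          have "(y [^]\<^bsub>R\<^esub> n) \<odot>\<^bsub>C 0\<^esub> \<eta> m \<in> boundaries C D 0"
            using n \<eta>_ker[OF M.smult_closed[OF yn m(1)]] mod_homD(3)[OF \<eta>_hom yn m(1)] by simp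
          then show "\<exists>n::nat. (y [^]\<^bsub>R\<^esub> n) \<odot>\<^bsub>C (i + 1)\<^esub> \<eta> m \<in> boundaries C D (i + 1)" unfolding i0 by blast
        qed
        have "v \<ominus>\<^bsub>C (i + 1)\<^esub> \<eta> m \<in> tors_mod R \<aa> (C (i + 1)) (boundaries C D (i + 1))"
          using C1.tors_mod_upper[OF boundaries_submodule a_carrier] m(2) by (rule subsetD)
        then have "(v \<ominus>\<^bsub>C (i + 1)\<^esub> \<eta> m) \<oplus>\<^bsub>C (i + 1)\<^esub> \<eta> m \<in> tors_mod R \<aa> (C (i + 1)) (boundaries C D (i + 1))"
          using \<eta>t by (rule C1.submodule_add[OF C1.tors_mod_submodule[OF a_carrier boundaries_submodule]])
        moreover have "(v \<ominus>\<^bsub>C (i + 1)\<^esub> \<eta> m) \<oplus>\<^bsub>C (i + 1)\<^esub> \<eta> m = v" using vc \<eta>m by algebra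
        ultimately show ?thesis by simp
      qed
      show "f \<in> tors_mod R \<aa> (cone C i) (boundaries (cone C) (cone_diff R C D x) i)"
        unfolding tors_mod_def
      proof (intro CollectI conjI ballI fc)
        fix y assume y: "y \<in> \<aa>"
        then have yc: "y \<in> carrier R" using a_carrier by blast
        obtain n :: nat where n: "(y [^]\<^bsub>R\<^esub> n) \<odot>\<^bsub>C (i + 1)\<^esub> v \<in> boundaries C D (i + 1)"
          using vt y unfolding tors_mod_def by blast
        have "(y [^]\<^bsub>R\<^esub> n) \<odot>\<^bsub>cone C i\<^esub> f \<in> cycles (cone C) (cone_diff R C D x) i"
          using K.submodule_smult[OF cone.cycles_submodule _ f] yc by simp
        then obtain w where w: "w \<in> carrier (C i)" "(y [^]\<^bsub>R\<^esub> n) \<odot>\<^bsub>C (i + 1)\<^esub> v = D i w"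
          "(y [^]\<^bsub>R\<^esub> n) \<odot>\<^bsub>C i\<^esub> u \<oplus>\<^bsub>C i\<^esub> x \<odot>\<^bsub>C i\<^esub> w \<in> cycles C D i"
          using shift[of "(y [^]\<^bsub>R\<^esub> n) \<odot>\<^bsub>C i\<^esub> u" "(y [^]\<^bsub>R\<^esub> n) \<odot>\<^bsub>C (i + 1)\<^esub> v" i] n
          unfolding fe by auto
        then obtain m :: nat where m: "(y [^]\<^bsub>R\<^esub> m) \<odot>\<^bsub>C i\<^esub> ((y [^]\<^bsub>R\<^esub> n) \<odot>\<^bsub>C i\<^esub> u \<oplus>\<^bsub>C i\<^esub> x \<odot>\<^bsub>C i\<^esub> w) \<in> boundaries C D i"
          using neg[OF i] y unfolding tors_mod_def by blast
        define r s where "r = y [^]\<^bsub>R\<^esub> n" and "s = y [^]\<^bsub>R\<^esub> m"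
        have rs: "r \<in> carrier R" "s \<in> carrier R" using yc by (simp_all add: r_def s_def)
        have "s \<odot>\<^bsub>C i\<^esub> (r \<odot>\<^bsub>C i\<^esub> u) \<oplus>\<^bsub>C i\<^esub> x \<odot>\<^bsub>C i\<^esub> (s \<odot>\<^bsub>C i\<^esub> w) = s \<odot>\<^bsub>C i\<^esub> (r \<odot>\<^bsub>C i\<^esub> u \<oplus>\<^bsub>C i\<^esub> x \<odot>\<^bsub>C i\<^esub> w)"
          using rs uv(1) w(1) x by algebra
        then have "interleave (s \<odot>\<^bsub>C i\<^esub> (r \<odot>\<^bsub>C i\<^esub> u)) (s \<odot>\<^bsub>C (i + 1)\<^esub> (r \<odot>\<^bsub>C (i + 1)\<^esub> v)) \<in> boundaries (cone C) (cone_diff R C D x) i"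
          using rs uv(1) vc w(1) x m w(2)[folded r_def] unfolding r_def[symmetric] s_def[symmetric]
          by (subst cone_boundaries_iff) (auto simp: D_smult intro!: bexI[of _ "s \<odot>\<^bsub>C i\<^esub> w"])
        then have "s \<odot>\<^bsub>cone C i\<^esub> (r \<odot>\<^bsub>cone C i\<^esub> f) \<in> boundaries (cone C) (cone_diff R C D x) i"
          unfolding fe by simp
        then show "\<exists>n::nat. (y [^]\<^bsub>R\<^esub> n) \<odot>\<^bsub>cone C i\<^esub> f \<in> boundaries (cone C) (cone_diff R C D x) i"
          using K.pow_smult_add[OF yc fc, of m n] unfolding r_def s_def by metis
      qed
    qed
  next
    fix i :: int assume i: "i > 0"
    show "cycles (cone C) (cone_diff R C D x) i \<subseteq> boundaries (cone C) (cone_diff R C D x) i"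
    proof
      fix f assume f: "f \<in> cycles (cone C) (cone_diff R C D x) i"
      obtain u v where fe: "f = interleave u v" by (rule interleave_cases)
      have uv: "u \<in> carrier (C i)" "v \<in> cycles C D (i + 1)"
        using f unfolding fe by (simp_all add: cone_cycles_iff)
      then have "v \<in> boundaries C D (i + 1)" using pos[of "i + 1"] i by auto
      then obtain w where "w \<in> carrier (C i)" "v = D i w" "u \<oplus>\<^bsub>C i\<^esub> x \<odot>\<^bsub>C i\<^esub> w \<in> cycles C D i"
        using shift f unfolding fe by blast
      then show "f \<in> boundaries (cone C) (cone_diff R C D x) i"
        unfolding fe using pos[OF i] uv by (auto simp: cone_boundaries_iff cycles_def)
    qed
  next
    show "submodule {l \<oplus>\<^bsub>M\<^esub> x \<odot>\<^bsub>M\<^esub> m | l m. l \<in> L \<and> m \<in> carrier M} R M"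
      by (rule M.submodule_add_multiples[OF submodule_L x])
  next
    interpret C0: module R "C 0" by (rule module_C)
    interpret C1: module R "C 1" by (rule module_C)
    interpret K: module R "cone C 0" by (rule cone.module_C)
    have \<eta>c: "\<eta> m \<in> carrier (C 0)" if "m \<in> carrier M" for m using mod_homD(1)[OF \<eta>_hom that] .
    show "(\<lambda>m. interleave (\<eta> m) \<zero>\<^bsub>C 1\<^esub>) \<in> mod_hom R M (cone C 0)"
      using \<eta>c mod_homD(2,3)[OF \<eta>_hom] by (intro mod_homI) (simp_all add: cone_def)
    have z1: "\<zero>\<^bsub>C 1\<^esub> \<in> cycles C D 1" using C1.submodule_zero[OF cycles_submodule] .
    show "interleave (\<eta> m) \<zero>\<^bsub>C 1\<^esub> \<in> cycles (cone C) (cone_diff R C D x) 0" if m: "m \<in> carrier M" for m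
      using \<eta>_cycle[OF m] z1 x cone_cycles_iff[of "\<eta> m" "\<zero>\<^bsub>C 1\<^esub>" 0] by (simp add: cycles_def)
    have bd: "interleave u v \<in> boundaries (cone C) (cone_diff R C D x) 0 \<longleftrightarrow>
        (\<exists>w\<in>carrier (C 0). v = D 0 w \<and> u \<oplus>\<^bsub>C 0\<^esub> x \<odot>\<^bsub>C 0\<^esub> w \<in> boundaries C D 0)"
      if "u \<in> carrier (C 0)" "v \<in> carrier (C 1)" for u v
      using cone_boundaries_iff[of u 0 v] that by simp
    show "interleave (\<eta> m) \<zero>\<^bsub>C 1\<^esub> \<in> boundaries (cone C) (cone_diff R C D x) 0 \<longleftrightarrow>
        m \<in> {l \<oplus>\<^bsub>M\<^esub> x \<odot>\<^bsub>M\<^esub> m | l m. l \<in> L \<and> m \<in> carrier M}" (is "?l \<longleftrightarrow> ?r") if m: "m \<in> carrier M" for m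
    proof
      assume ?l
      then obtain w where w: "w \<in> carrier (C 0)" "D 0 w = \<zero>\<^bsub>C 1\<^esub>" "\<eta> m \<oplus>\<^bsub>C 0\<^esub> x \<odot>\<^bsub>C 0\<^esub> w \<in> boundaries C D 0"
        using bd[OF \<eta>c[OF m] C1.M.zero_closed] by auto
      then have "w \<in> cycles C D 0" by (simp add: cycles_def)
      then obtain m' where m': "m' \<in> carrier M" "w \<ominus>\<^bsub>C 0\<^esub> \<eta> m' \<in> boundaries C D 0" using \<eta>_surj by blast
      have 1: "x \<odot>\<^bsub>C 0\<^esub> (w \<ominus>\<^bsub>C 0\<^esub> \<eta> m') \<in> boundaries C D 0"
        by (rule C0.submodule_smult[OF boundaries_submodule x m'(2)])
      have e: "\<eta> (m \<oplus>\<^bsub>M\<^esub> x \<odot>\<^bsub>M\<^esub> m') = \<eta> m \<oplus>\<^bsub>C 0\<^esub> x \<odot>\<^bsub>C 0\<^esub> \<eta> m'"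
        using mod_homD(2)[OF \<eta>_hom m, of "x \<odot>\<^bsub>M\<^esub> m'"] mod_homD(3)[OF \<eta>_hom x m'(1)] m'(1) x by simp
      have "\<eta> m \<oplus>\<^bsub>C 0\<^esub> x \<odot>\<^bsub>C 0\<^esub> \<eta> m' = (\<eta> m \<oplus>\<^bsub>C 0\<^esub> x \<odot>\<^bsub>C 0\<^esub> w) \<ominus>\<^bsub>C 0\<^esub> x \<odot>\<^bsub>C 0\<^esub> (w \<ominus>\<^bsub>C 0\<^esub> \<eta> m')"
        using \<eta>c[OF m] \<eta>c[OF m'(1)] w(1) x by algebra
      then have "\<eta> (m \<oplus>\<^bsub>M\<^esub> x \<odot>\<^bsub>M\<^esub> m') \<in> boundaries C D 0"
        unfolding e using C0.submodule_minus[OF boundaries_submodule w(3) 1] by simp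
      then have "m \<oplus>\<^bsub>M\<^esub> x \<odot>\<^bsub>M\<^esub> m' \<in> L" using \<eta>_ker m m'(1) x by simp
      moreover have "m = (m \<oplus>\<^bsub>M\<^esub> x \<odot>\<^bsub>M\<^esub> m') \<oplus>\<^bsub>M\<^esub> x \<odot>\<^bsub>M\<^esub> (\<ominus>\<^bsub>M\<^esub> m')" using m m'(1) x by algebra
      ultimately show ?r using m'(1) by blast
    next
      assume ?r
      then obtain l m' where e: "l \<in> L" "m' \<in> carrier M" "m = l \<oplus>\<^bsub>M\<^esub> x \<odot>\<^bsub>M\<^esub> m'" by blast
      have lc: "l \<in> carrier M" using Lc[OF e(1)] .
      have "\<eta> m = \<eta> l \<oplus>\<^bsub>C 0\<^esub> x \<odot>\<^bsub>C 0\<^esub> \<eta> m'"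
        unfolding e using mod_homD(2)[OF \<eta>_hom lc, of "x \<odot>\<^bsub>M\<^esub> m'"] mod_homD(3)[OF \<eta>_hom x e(2)] e(2) x by simp
      then have "\<eta> m \<oplus>\<^bsub>C 0\<^esub> x \<odot>\<^bsub>C 0\<^esub> (\<ominus>\<^bsub>C 0\<^esub> \<eta> m') = \<eta> l" using \<eta>c[OF lc] \<eta>c[OF e(2)] x by algebra
      moreover have "\<eta> l \<in> boundaries C D 0" using \<eta>_ker[OF lc] e(1) by simp
      moreover have "D 0 (\<ominus>\<^bsub>C 0\<^esub> \<eta> m') = \<zero>\<^bsub>C 1\<^esub>"
        using D_neg[OF \<eta>c[OF e(2)]] \<eta>_cycle[OF e(2)] C1.minus_zero_module by (simp add: cycles_def)
      ultimately show ?l using bd[OF \<eta>c[OF m] C1.M.zero_closed] \<eta>c[OF e(2)] by (metis C0.M.a_inv_closed)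
    qed
    fix f assume f: "f \<in> cycles (cone C) (cone_diff R C D x) 0"
    obtain u v where fe: "f = interleave u v" by (rule interleave_cases)
    have uv: "u \<in> carrier (C 0)" "v \<in> cycles C D 1"
      using f cone_cycles_iff[of u v 0] unfolding fe by simp_all
    have "v \<in> boundaries C D (0 + 1)" using pos[of 1] uv(2) by auto
    then obtain w where w: "w \<in> carrier (C 0)" "v = D 0 w" "u \<oplus>\<^bsub>C 0\<^esub> x \<odot>\<^bsub>C 0\<^esub> w \<in> cycles C D 0"
      using shift f unfolding fe by blast
    obtain m where m: "m \<in> carrier M" "(u \<oplus>\<^bsub>C 0\<^esub> x \<odot>\<^bsub>C 0\<^esub> w) \<ominus>\<^bsub>C 0\<^esub> \<eta> m \<in> boundaries C D 0"
      using \<eta>_surj[OF w(3)] by blast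
    have vc: "v \<in> carrier (C 1)" using uv(2) by (simp add: cycles_def)
    have "\<ominus>\<^bsub>cone C 0\<^esub> interleave (\<eta> m) \<zero>\<^bsub>C 1\<^esub> = interleave (\<ominus>\<^bsub>C 0\<^esub> \<eta> m) \<zero>\<^bsub>C 1\<^esub>"
      by (rule K.M.minus_equality) (use \<eta>c[OF m(1)] in \<open>simp_all add: cone_def C0.M.l_neg\<close>)
    then have eq: "f \<ominus>\<^bsub>cone C 0\<^esub> interleave (\<eta> m) \<zero>\<^bsub>C 1\<^esub> = interleave (u \<ominus>\<^bsub>C 0\<^esub> \<eta> m) v"
      unfolding fe K.M.minus_eq C0.M.minus_eq using vc by (simp add: cone_def)
    have "(u \<ominus>\<^bsub>C 0\<^esub> \<eta> m) \<oplus>\<^bsub>C 0\<^esub> x \<odot>\<^bsub>C 0\<^esub> w = (u \<oplus>\<^bsub>C 0\<^esub> x \<odot>\<^bsub>C 0\<^esub> w) \<ominus>\<^bsub>C 0\<^esub> \<eta> m"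
      using uv(1) w(1) x \<eta>c[OF m(1)] by algebra
    then have "interleave (u \<ominus>\<^bsub>C 0\<^esub> \<eta> m) v \<in> boundaries (cone C) (cone_diff R C D x) 0"
      using bd[of "u \<ominus>\<^bsub>C 0\<^esub> \<eta> m" v] uv(1) vc \<eta>c[OF m(1)] w(1,2) m(2) by auto
    then show "\<exists>m\<in>carrier M. f \<ominus>\<^bsub>cone C 0\<^esub> interleave (\<eta> m) \<zero>\<^bsub>C 1\<^esub> \<in> boundaries (cone C) (cone_diff R C D x) 0"
      using m(1) unfolding eq[symmetric] by blast
  qed
qed

lemma torsion_cone:
  assumes res: "torsion_resolution R C D \<aa> M \<eta> L"
  shows "torsion R \<aa> (cone C i) = cone (\<lambda>i. torsion R \<aa> (C i)) i"
proof -
  interpret torsion_resolution R C D \<aa> M \<eta> L by fact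
  interpret C0: module R "C 0" by (rule module_C)
  interpret cone_complex R C D "\<zero>\<^bsub>R\<^esub>" by unfold_locales simp
  have "carrier (torsion R \<aa> (cone C i)) = tors R \<aa> (cone C i)"
    by (rule module.carrier_torsion[OF cone.module_C noeth ideal_a])
  also have "\<dots> = {f. evens f \<in> carrier (torsion R \<aa> (C i)) \<and> odds f \<in> carrier (torsion R \<aa> (C (i + 1)))}"
    using cone_tors_iff[OF a_carrier, of "evens f" "odds f" i for f]
      module.carrier_torsion[OF module_C noeth ideal_a] by auto
  finally show ?thesis
    by (intro module.equality) (simp_all add: cone_def pair_module_def torsion_def)
qed

lemma cone_diff_torsion: "cone_diff R (\<lambda>i. torsion R \<aa> (C i)) D x = cone_diff R C D x"
  by (simp add: cone_diff_def torsion_def fun_eq_iff)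

section \<open>Finiteness of associated primes and prime avoidance\<close>

text \<open>
  For the extension of \<open>M / (L + R y)\<close> by the cyclic module \<open>(L + R y) / L\<close>, which is
  \<open>R / (L : y)\<close>.
\<close>
lemma (in module) subquot_Ass_extension:
  assumes L: "submodule L R M" and y: "y \<in> carrier M"
  shows "subquot_Ass R M (carrier M) L \<subseteq>
    subquot_Ass R (regular_module R) (carrier R) (colon R M L y) \<union>
    subquot_Ass R M (carrier M) {l \<oplus>\<^bsub>M\<^esub> s \<odot>\<^bsub>M\<^esub> y | l s. l \<in> L \<and> s \<in> carrier R}"
    (is "_ \<subseteq> ?A \<union> subquot_Ass R M (carrier M) ?K")
proof
  fix p assume "p \<in> subquot_Ass R M (carrier M) L"
  then obtain z where pr: "primeideal p R" and z: "z \<in> carrier M" and pz: "p = colon R M L z"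
    unfolding subquot_Ass_def by blast
  show "p \<in> ?A \<union> subquot_Ass R M (carrier M) ?K"
  proof (rule prime_colon_dichotomy[OF pr pz z submodule_add_principal(2)[OF L y]])
    assume "p = colon R M ?K z"
    then show ?thesis using pr z unfolding subquot_Ass_def by blast
  next
    fix r assume r: "r \<in> carrier R" "r \<odot>\<^bsub>M\<^esub> z \<in> ?K" and pr': "p = colon R M L (r \<odot>\<^bsub>M\<^esub> z)"
    then obtain l s where e: "l \<in> L" "s \<in> carrier R" "r \<odot>\<^bsub>M\<^esub> z = l \<oplus>\<^bsub>M\<^esub> s \<odot>\<^bsub>M\<^esub> y" by blast
    have lc: "l \<in> carrier M" using submodule_carrier[OF L e(1)] .
    have "q \<odot>\<^bsub>M\<^esub> (r \<odot>\<^bsub>M\<^esub> z) \<in> L \<longleftrightarrow> q \<otimes> s \<in> colon R M L y" if q: "q \<in> carrier R" for q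
    proof -
      have "q \<odot>\<^bsub>M\<^esub> (r \<odot>\<^bsub>M\<^esub> z) = (q \<otimes> s) \<odot>\<^bsub>M\<^esub> y \<oplus>\<^bsub>M\<^esub> q \<odot>\<^bsub>M\<^esub> l"
        unfolding e(3) using q lc e(2) y by algebra
      then show ?thesis
        using submodule_add_iff[OF L _ submodule_smult[OF L q e(1)], of "(q \<otimes> s) \<odot>\<^bsub>M\<^esub> y"] q e(2) y
        by (simp add: colon_def)
    qed
    then have "p = colon R (regular_module R) (colon R M L y) s"
      unfolding pr' by (auto simp: colon_def)
    then show ?thesis using pr e(2) unfolding subquot_Ass_def by blast
  qed
qed

lemma (in module) subquot_Ass_whole: "subquot_Ass R M (carrier M) (carrier M) = {}"
proof -
  have "p \<notin> subquot_Ass R M (carrier M) (carrier M)" for p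
  proof
    assume "p \<in> subquot_Ass R M (carrier M) (carrier M)"
    then have "primeideal p R" "p = carrier R" by (auto simp: subquot_Ass_def colon_def)
    then show False using primeideal.I_notcarr by blast
  qed
  then show ?thesis by blast
qed

text \<open>
  Noetherian induction on \<open>J\<close>. For a prime \<open>J\<close> the only associated prime is \<open>J\<close>. Otherwise
  \<open>f g \<in> J\<close> with \<open>f, g \<notin> J\<close>, and \<open>R / J\<close> is an extension of \<open>R / (J + R f)\<close> by \<open>R / (J : f)\<close>,
  where both ideals are larger.
\<close>
lemma finite_Ass_cyclic:
  assumes R: "cring R" and noeth: "noetherian_ring R" and J: "ideal J R"
  shows "finite (subquot_Ass R (regular_module R) (carrier R) J)"
proof (rule ccontr)
  interpret R: cring R by fact
  interpret M: module R "regular_module R" by (rule R.regular_module)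
  let ?A = "\<lambda>J. subquot_Ass R (regular_module R) (carrier R) J"
  assume inf: "infinite (?A J)"
  define S where "S = {J. ideal J R \<and> infinite (?A J)}"
  have "J \<in> S" using J inf by (simp add: S_def)
  moreover have "ideal J R" if "J \<in> S" for J using that by (simp add: S_def)
  ultimately obtain K where KS: "K \<in> S" and Kmax: "\<And>J. J \<in> S \<Longrightarrow> K \<subseteq> J \<Longrightarrow> J = K"
    using noetherian_ring.maximal_ideal_in_family[OF noeth, of S] by blast
  have K: "ideal K R" "infinite (?A K)" using KS by (simp_all add: S_def)
  have Ksub: "submodule K R (regular_module R)"
    using R.ideal_closed[OF K(1)] by (intro M.submodule_intro) auto
  have notprime: "\<not> primeideal K R"
  proof
    assume pr: "primeideal K R"
    have "p = K" if pA: "p \<in> ?A K" for p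
    proof -
      obtain s where p: "primeideal p R" "s \<in> carrier R" "p = colon R (regular_module R) K s"
        using pA unfolding subquot_Ass_def by blast
      have "s \<notin> K"
      proof
        assume "s \<in> K"
        then have "p = carrier R" using R.ideal_closed(5)[OF K(1)] unfolding p(3) colon_def by auto
        then show False using primeideal.I_notcarr[OF p(1)] by blast
      qed
      then show "p = K"
        using primeideal.I_prime[OF pr] R.ideal_closed(1)[OF K(1)] ideal.I_r_closed[OF K(1)] p(2)
        unfolding p(3) colon_def by auto
    qed
    then have "?A K \<subseteq> {K}" by blast
    then show False using K(2) finite_subset by blast
  qed
  have "carrier R \<noteq> K"
  proof
    assume "carrier R = K"
    then show False using K(2) M.subquot_Ass_whole by simp
  qed
  then obtain f g where fg: "f \<in> carrier R" "g \<in> carrier R" "f \<otimes>\<^bsub>R\<^esub> g \<in> K" "f \<notin> K" "g \<notin> K"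
    using notprime primeidealI[OF K(1) R] by blast
  let ?J1 = "colon R (regular_module R) K f"
  let ?J2 = "{l \<oplus>\<^bsub>R\<^esub> s \<otimes>\<^bsub>R\<^esub> f | l s. l \<in> K \<and> s \<in> carrier R}"
  have J1: "ideal ?J1 R" using M.colon_ideal[OF Ksub] fg(1) by simp
  have "K \<subseteq> ?J1" using R.ideal_closed(1)[OF K(1)] ideal.I_r_closed[OF K(1)] fg(1) by (auto simp: colon_def)
  moreover have "g \<in> ?J1" using fg by (simp add: colon_def R.m_comm)
  ultimately have "?J1 \<notin> S" using Kmax[of ?J1] fg(5) by blast
  then have f1: "finite (?A ?J1)" using J1 by (simp add: S_def)
  note J2 = R.ideal_add_principal[OF K(1) fg(1)]
  have "?J2 \<notin> S"
  proof
    assume "?J2 \<in> S"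
    then have "?J2 = K" using J2(2) by (rule Kmax)
    then show False using J2(3) fg(4) by simp
  qed
  then have f2: "finite (?A ?J2)" using J2(1) by (simp add: S_def)
  have "?A K \<subseteq> ?A ?J1 \<union> ?A ?J2" using M.subquot_Ass_extension[OF Ksub, of f] fg(1) by simp
  then show False using K(2) f1 f2 finite_subset by blast
qed

text \<open>
  The generators are added to \<open>L\<close> one by one.
\<close>
lemma finite_Ass_fin_gen:
  assumes noeth: "noetherian_ring R" and fg: "fin_gen_module R M" and L: "submodule L R M"
  shows "finite (subquot_Ass R M (carrier M) L)"
proof -
  from fg have "module R M" by (simp add: fin_gen_module_def)
  then interpret module R M .
  from fg obtain S where S: "S \<subseteq> carrier M" "finite S" "gen_submodule R M S = carrier M"
    unfolding fin_gen_module_def by blast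
  have "finite (subquot_Ass R M (carrier M) L)"
    if "submodule L R M" "\<And>N. submodule N R M \<Longrightarrow> L \<subseteq> N \<Longrightarrow> S \<subseteq> N \<Longrightarrow> N = carrier M" for L
    using S(2,1) that
  proof (induction S arbitrary: L rule: finite_induct)
    case empty
    have "L = carrier M" using empty by blast
    then show ?case by (simp add: subquot_Ass_whole)
  next
    case (insert y S)
    have y: "y \<in> carrier M" using insert.prems(1) by blast
    let ?K = "{l \<oplus>\<^bsub>M\<^esub> s \<odot>\<^bsub>M\<^esub> y | l s. l \<in> L \<and> s \<in> carrier R}"
    note K = submodule_add_principal[OF insert.prems(2) y]
    have "finite (subquot_Ass R M (carrier M) ?K)"
    proof (rule insert.IH[OF _ K(1)])
      show "S \<subseteq> carrier M" using insert.prems(1) by blast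
      fix N assume N: "submodule N R M" "?K \<subseteq> N" "S \<subseteq> N"
      then have "L \<subseteq> N" "y \<in> N" using subset_trans[OF K(2) N(2)] subsetD[OF N(2) K(3)] by simp_all
      then show "N = carrier M" using insert.prems(3)[OF N(1)] N(3) by simp
    qed
    moreover have "finite (subquot_Ass R (regular_module R) (carrier R) (colon R M L y))"
      by (rule finite_Ass_cyclic[OF R.is_cring noeth colon_ideal[OF insert.prems(2) y]])
    ultimately show ?case using subquot_Ass_extension[OF insert.prems(2) y] finite_subset by blast
  qed
  moreover have "N = carrier M" if "submodule N R M" "S \<subseteq> N" for N
    using that S(3) submoduleE(1)[OF that(1)] unfolding gen_submodule_def by blast
  ultimately show ?thesis using L by blast
qed

lemma (in cring) element_of_ideals_outside_prime:
  assumes p: "primeideal p R" and I: "ideal I R" "\<not> I \<subseteq> p"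
    and F: "finite F" "\<And>q. q \<in> F \<Longrightarrow> ideal q R" "\<And>q. q \<in> F \<Longrightarrow> \<not> q \<subseteq> p"
  shows "\<exists>y\<in>I. (\<forall>q\<in>F. y \<in> q) \<and> y \<notin> p"
  using F
proof (induction F rule: finite_induct)
  case empty
  then show ?case using I(2) by blast
next
  case (insert q F)
  from insert.IH insert.prems obtain y where y: "y \<in> I" "\<forall>q\<in>F. y \<in> q" "y \<notin> p" by blast
  from insert.prems(2)[of q] obtain z where z: "z \<in> q" "z \<notin> p" by blast
  have q: "ideal q R" using insert.prems(1) by blast
  have c: "y \<in> carrier R" "z \<in> carrier R" using ideal_closed(1)[OF I(1)] ideal_closed(1)[OF q] y(1) z(1) by auto
  have "y \<otimes> z \<in> I" using ideal.I_r_closed[OF I(1) y(1) c(2)] .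
  moreover have "y \<otimes> z \<in> q'" if "q' \<in> insert q F" for q'
    using that ideal.I_r_closed[OF insert.prems(1), of q' y z] ideal.I_l_closed[OF q z(1) c(1)] y(2) c(2) by auto
  moreover have "y \<otimes> z \<notin> p" using primeideal.I_prime[OF p c] y(3) z(2) by blast
  ultimately show ?case by blast
qed

text \<open>
  A prime inside another one of \<open>F\<close> may be dropped, since it suffices to avoid the larger one.
  Once there is no inclusion, an element that avoids all primes but \<open>p\<close> can be corrected at \<open>p\<close> by an element of all the others.
\<close>
lemma (in cring) prime_avoidance:
  assumes I: "ideal I R" and F: "finite F" "\<And>p. p \<in> F \<Longrightarrow> primeideal p R" "\<And>p. p \<in> F \<Longrightarrow> \<not> I \<subseteq> p"
  shows "\<exists>x\<in>I. \<forall>p\<in>F. x \<notin> p"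
  using F
proof (induction "card F" arbitrary: F rule: less_induct)
  case less
  note Ic = ideal_closed[OF I]
  show ?case
  proof (cases "F = {}")
    case True
    then show ?thesis using Ic(2) by blast
  next
    case False
    then obtain p where p: "p \<in> F" by blast
    have card: "card (F - {q}) < card F" if "q \<in> F" for q using card_Diff1_less[OF less.prems(1) that] .
    have IH: "\<exists>x\<in>I. \<forall>p\<in>F - {q}. x \<notin> p" if "q \<in> F" for q
      by (rule less.hyps[OF card[OF that]]) (use less.prems in auto)
    show ?thesis
    proof (cases "\<exists>q\<in>F - {p}. q \<subseteq> p")
      case True
      then obtain q where "q \<in> F" "q \<noteq> p" "q \<subseteq> p" by blast
      then show ?thesis using IH[of q] p by blast
    next
      case False
      interpret p: primeideal p R using less.prems(2)[OF p] .
      have "finite (F - {p})" using less.prems(1) by simp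
      moreover have "\<And>q. q \<in> F - {p} \<Longrightarrow> ideal q R" "\<And>q. q \<in> F - {p} \<Longrightarrow> \<not> q \<subseteq> p"
        using False less.prems(2) primeideal.axioms(1) by blast+
      ultimately obtain y where y: "y \<in> I" "\<And>q. q \<in> F - {p} \<Longrightarrow> y \<in> q" "y \<notin> p"
        using element_of_ideals_outside_prime[OF p.primeideal I less.prems(3)[OF p], of "F - {p}"] by metis
      obtain x where x: "x \<in> I" "\<And>q. q \<in> F - {p} \<Longrightarrow> x \<notin> q" using IH[OF p] by blast
      have c: "x \<in> carrier R" "y \<in> carrier R" using Ic(1) x(1) y(1) by auto
      show ?thesis
      proof (cases "x \<in> p")
        case False
        then show ?thesis using x by blast
      next
        case True
        have diff: "u \<in> q" if "ideal q R" "u \<oplus> v \<in> q" "v \<in> q" "u \<in> carrier R" "v \<in> carrier R" for u v q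
        proof -
          have "(u \<oplus> v) \<oplus> \<ominus> v \<in> q" using ideal_closed(3,4)[OF that(1)] that(2,3) by blast
          moreover have "(u \<oplus> v) \<oplus> \<ominus> v = u" using that(4,5) by algebra
          ultimately show ?thesis by simp
        qed
        have "x \<oplus> y \<notin> q" if q: "q \<in> F" for q
        proof (cases "q = p")
          case True
          have "y \<oplus> x \<notin> p" using diff[of p y x] p.is_ideal \<open>x \<in> p\<close> y(3) c by blast
          then show ?thesis using True c a_comm by simp
        next
          case False
          then show ?thesis
            using diff[of q x y] primeideal.axioms(1)[OF less.prems(2)[OF q]] x(2) y(2) q c by blast
        qed
        moreover have "x \<oplus> y \<in> I" using Ic(3) x(1) y(1) by blast
        ultimately show ?thesis by blast
      qed
    qed
  qed
qed

section \<open>Quotient modules\<close>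

context module
begin

lemma mem_coset_iff:
  assumes B: "submodule B R M" and z: "z \<in> carrier M"
  shows "w \<in> B +>\<^bsub>M\<^esub> z \<longleftrightarrow> w \<in> carrier M \<and> w \<ominus>\<^bsub>M\<^esub> z \<in> B"
proof
  assume "w \<in> B +>\<^bsub>M\<^esub> z"
  then obtain b where b: "b \<in> B" "w = b \<oplus>\<^bsub>M\<^esub> z" by (auto simp: a_r_coset_def')
  have bc: "b \<in> carrier M" using submodule_carrier[OF B b(1)] .
  have "(b \<oplus>\<^bsub>M\<^esub> z) \<ominus>\<^bsub>M\<^esub> z = b" using bc z by algebra
  then show "w \<in> carrier M \<and> w \<ominus>\<^bsub>M\<^esub> z \<in> B" using b bc z by simp
next
  assume w: "w \<in> carrier M \<and> w \<ominus>\<^bsub>M\<^esub> z \<in> B"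
  then have "w = (w \<ominus>\<^bsub>M\<^esub> z) \<oplus>\<^bsub>M\<^esub> z" using z by algebra
  then show "w \<in> B +>\<^bsub>M\<^esub> z" using w unfolding a_r_coset_def' by blast
qed

lemma coset_eq_iff:
  assumes B: "submodule B R M" and z: "z \<in> carrier M" "z' \<in> carrier M"
  shows "B +>\<^bsub>M\<^esub> z = B +>\<^bsub>M\<^esub> z' \<longleftrightarrow> z \<ominus>\<^bsub>M\<^esub> z' \<in> B"
proof
  assume "B +>\<^bsub>M\<^esub> z = B +>\<^bsub>M\<^esub> z'"
  moreover have "z \<in> B +>\<^bsub>M\<^esub> z"
    using mem_coset_iff[OF B z(1)] z(1) submodule_zero[OF B] by (simp add: M.minus_eq M.r_neg)
  ultimately show "z \<ominus>\<^bsub>M\<^esub> z' \<in> B" using mem_coset_iff[OF B z(2)] by blast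
next
  assume zz: "z \<ominus>\<^bsub>M\<^esub> z' \<in> B"
  have "w \<ominus>\<^bsub>M\<^esub> z \<in> B \<longleftrightarrow> w \<ominus>\<^bsub>M\<^esub> z' \<in> B" if w: "w \<in> carrier M" for w
  proof -
    have "w \<ominus>\<^bsub>M\<^esub> z' = (w \<ominus>\<^bsub>M\<^esub> z) \<oplus>\<^bsub>M\<^esub> (z \<ominus>\<^bsub>M\<^esub> z')" using w z by algebra
    then show ?thesis using submodule_add_iff[OF B _ zz, of "w \<ominus>\<^bsub>M\<^esub> z"] w z by simp
  qed
  then show "B +>\<^bsub>M\<^esub> z = B +>\<^bsub>M\<^esub> z'"
    using mem_coset_iff[OF B z(1)] mem_coset_iff[OF B z(2)] by blast
qed

lemma coset_eq_submodule_iff: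
  assumes B: "submodule B R M" and z: "z \<in> carrier M"
  shows "B +>\<^bsub>M\<^esub> z = B \<longleftrightarrow> z \<in> B"
proof -
  have "w \<in> B +>\<^bsub>M\<^esub> \<zero>\<^bsub>M\<^esub> \<longleftrightarrow> w \<in> B" for w
    using mem_coset_iff[OF B M.zero_closed, of w] submodule_carrier[OF B, of w]
    by (auto simp: M.minus_eq minus_zero_module)
  then have "B +>\<^bsub>M\<^esub> \<zero>\<^bsub>M\<^esub> = B" by blast
  then show ?thesis using coset_eq_iff[OF B z M.zero_closed] z by (simp add: M.minus_eq minus_zero_module)
qed

lemma quot_module_smult:
  assumes B: "submodule B R M" and z: "z \<in> carrier M" and r: "r \<in> carrier R"
  shows "r \<odot>\<^bsub>quot_module M B\<^esub> (B +>\<^bsub>M\<^esub> z) = B +>\<^bsub>M\<^esub> (r \<odot>\<^bsub>M\<^esub> z)"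
proof -
  have eq: "B +>\<^bsub>M\<^esub> (r \<odot>\<^bsub>M\<^esub> x) = B +>\<^bsub>M\<^esub> (r \<odot>\<^bsub>M\<^esub> z)" if x: "x \<in> B +>\<^bsub>M\<^esub> z" for x
  proof -
    have x: "x \<in> carrier M" "x \<ominus>\<^bsub>M\<^esub> z \<in> B" using x mem_coset_iff[OF B z] by auto
    have "r \<odot>\<^bsub>M\<^esub> x \<ominus>\<^bsub>M\<^esub> r \<odot>\<^bsub>M\<^esub> z = r \<odot>\<^bsub>M\<^esub> (x \<ominus>\<^bsub>M\<^esub> z)" using x(1) z r by algebra
    then show ?thesis using coset_eq_iff[OF B] x z r submodule_smult[OF B r x(2)] by simp
  qed
  have "z \<in> B +>\<^bsub>M\<^esub> z"
    using mem_coset_iff[OF B z] z submodule_zero[OF B] by (simp add: M.minus_eq M.r_neg)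
  then have "(\<Union>x\<in>B +>\<^bsub>M\<^esub> z. B +>\<^bsub>M\<^esub> (r \<odot>\<^bsub>M\<^esub> x)) = B +>\<^bsub>M\<^esub> (r \<odot>\<^bsub>M\<^esub> z)"
    by (intro SUP_eq_const eq) blast
  then show ?thesis by (simp add: quot_module_def)
qed

lemma quot_module_carrier: "carrier (quot_module M B) = (\<lambda>z. B +>\<^bsub>M\<^esub> z) ` carrier M"
  by (auto simp: quot_module_def A_RCOSETS_def')

lemma Ass_quot_module:
  assumes B: "submodule B R M"
  shows "Ass R (quot_module M B) = subquot_Ass R M (carrier M) B"
proof -
  have "{r \<in> carrier R. r \<odot>\<^bsub>quot_module M B\<^esub> (B +>\<^bsub>M\<^esub> z) = \<zero>\<^bsub>quot_module M B\<^esub>} = colon R M B z"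
    if z: "z \<in> carrier M" for z
  proof -
    have "\<zero>\<^bsub>quot_module M B\<^esub> = B" by (simp add: quot_module_def)
    then have "r \<odot>\<^bsub>quot_module M B\<^esub> (B +>\<^bsub>M\<^esub> z) = \<zero>\<^bsub>quot_module M B\<^esub> \<longleftrightarrow> r \<odot>\<^bsub>M\<^esub> z \<in> B"
      if r: "r \<in> carrier R" for r
      using quot_module_smult[OF B z r] coset_eq_submodule_iff[OF B, of "r \<odot>\<^bsub>M\<^esub> z"] z r by simp
    then show ?thesis unfolding colon_def by blast
  qed
  then show ?thesis unfolding Ass_def subquot_Ass_def quot_module_carrier by auto
qed

lemma quot_module_killed:
  assumes B: "submodule B R M" and I: "I \<subseteq> carrier R"
    and k: "ideal_smult R I (quot_module M B) = {\<zero>\<^bsub>quot_module M B\<^esub>}"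
    and r: "r \<in> I" and z: "z \<in> carrier M"
  shows "r \<odot>\<^bsub>M\<^esub> z \<in> B"
proof -
  let ?Q = "quot_module M B"
  have "B +>\<^bsub>M\<^esub> z \<in> carrier ?Q" using z by (simp add: quot_module_carrier)
  then have "r \<odot>\<^bsub>?Q\<^esub> (B +>\<^bsub>M\<^esub> z) \<in> ideal_smult R I ?Q"
    using r unfolding ideal_smult_def gen_submodule_def by blast
  then have "B +>\<^bsub>M\<^esub> (r \<odot>\<^bsub>M\<^esub> z) = B"
    unfolding k using quot_module_smult[OF B z, of r] r I by (auto simp: quot_module_def)
  then show ?thesis using coset_eq_submodule_iff[OF B, of "r \<odot>\<^bsub>M\<^esub> z"] r I z by auto
qed

lemma gen_submodule_submodule:
  assumes "S \<subseteq> carrier M"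
  shows "submodule (gen_submodule R M S) R M"
  unfolding gen_submodule_def
  by (rule submodule_intro)
    (use assms carrier_is_submodule submodule_zero submodule_add submodule_smult in auto)

lemma ideal_smult_submodule:
  assumes "I \<subseteq> carrier R"
  shows "submodule (ideal_smult R I M) R M"
  unfolding ideal_smult_def by (rule gen_submodule_submodule) (use assms in auto)

lemma ideal_smult_least:
  assumes "submodule N R M" "\<And>r m. r \<in> I \<Longrightarrow> m \<in> carrier M \<Longrightarrow> r \<odot>\<^bsub>M\<^esub> m \<in> N"
  shows "ideal_smult R I M \<subseteq> N"
  using assms unfolding ideal_smult_def gen_submodule_def by blast

lemma ideal_smult_mem: "r \<in> I \<Longrightarrow> m \<in> carrier M \<Longrightarrow> r \<odot>\<^bsub>M\<^esub> m \<in> ideal_smult R I M"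
  unfolding ideal_smult_def gen_submodule_def by blast

lemma ideal_smult_genideal_empty: "ideal_smult R (genideal R {}) M = {\<zero>\<^bsub>M\<^esub>}"
proof
  have "genideal R {} \<subseteq> {\<zero>}" using R.genideal_minimal[OF R.zeroideal] by simp
  then show "ideal_smult R (genideal R {}) M \<subseteq> {\<zero>\<^bsub>M\<^esub>}"
    by (intro ideal_smult_least submodule_zero_set) auto
  have "genideal R {} \<subseteq> carrier R" using R.ideal_closed(1)[OF R.genideal_ideal] by simp
  then show "{\<zero>\<^bsub>M\<^esub>} \<subseteq> ideal_smult R (genideal R {}) M"
    using submodule_zero[OF ideal_smult_submodule] by simp
qed

lemma ideal_smult_genideal_insert:
  assumes S: "S \<subseteq> carrier R" and x: "x \<in> carrier R"
  shows "ideal_smult R (genideal R (insert x S)) M =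
    {l \<oplus>\<^bsub>M\<^esub> x \<odot>\<^bsub>M\<^esub> m | l m. l \<in> ideal_smult R (genideal R S) M \<and> m \<in> carrier M}" (is "?l = ?r")
proof
  let ?L = "ideal_smult R (genideal R S) M"
  have I: "ideal (genideal R S) R" using R.genideal_ideal[OF S] .
  have I': "ideal (genideal R (insert x S)) R" using R.genideal_ideal[of "insert x S"] S x by simp
  have L: "submodule ?L R M" using ideal_smult_submodule R.ideal_closed(1)[OF I] .
  have L': "submodule ?l R M" using ideal_smult_submodule R.ideal_closed(1)[OF I'] .
  note Lc = submodule_carrier[OF L]
  have sub: "submodule ?r R M" by (rule submodule_add_multiples[OF L x])
  show "?l \<subseteq> ?r"
  proof (rule ideal_smult_least[OF sub])
    fix r m assume r: "r \<in> genideal R (insert x S)" and m: "m \<in> carrier M"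
    note K = R.ideal_add_principal[OF I x]
    have "insert x S \<subseteq> {i \<oplus> s \<otimes> x | i s. i \<in> genideal R S \<and> s \<in> carrier R}"
      using subset_trans[OF R.genideal_self[OF S] K(2)] K(3) by (rule insert_subsetI[rotated])
    then have "r \<in> {i \<oplus> s \<otimes> x | i s. i \<in> genideal R S \<and> s \<in> carrier R}"
      using R.genideal_minimal[OF K(1)] r by blast
    then obtain i s where e: "i \<in> genideal R S" "s \<in> carrier R" "r = i \<oplus> s \<otimes> x" by blast
    have ic: "i \<in> carrier R" using R.ideal_closed(1)[OF I] e(1) by blast
    have "r \<odot>\<^bsub>M\<^esub> m = i \<odot>\<^bsub>M\<^esub> m \<oplus>\<^bsub>M\<^esub> x \<odot>\<^bsub>M\<^esub> (s \<odot>\<^bsub>M\<^esub> m)" unfolding e(3) using ic e(2) x m by algebra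
    then show "r \<odot>\<^bsub>M\<^esub> m \<in> ?r" using ideal_smult_mem[OF e(1) m] e(2) m by blast
  qed
  have gen: "insert x S \<subseteq> genideal R (insert x S)" using R.genideal_self[of "insert x S"] S x by simp
  have "genideal R S \<subseteq> genideal R (insert x S)" using R.genideal_minimal[OF I'] gen by simp
  then have "?L \<subseteq> ?l"
    by (intro ideal_smult_least[OF L'] ideal_smult_mem) auto
  moreover have "x \<odot>\<^bsub>M\<^esub> m \<in> ?l" if "m \<in> carrier M" for m
    using ideal_smult_mem[OF _ that] gen by blast
  ultimately show "?r \<subseteq> ?l" using submodule_add[OF L'] by blast
qed

end

section \<open>The complex of an injective resolution\<close>

definition const_module :: "('a, 'e, 'n) module_scheme \<Rightarrow> ('a, nat \<Rightarrow> 'e) module"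
  where "const_module N =
    \<lparr>carrier = (\<lambda>e _. e) ` carrier N, monoid.mult = (\<lambda>_ _. undefined), one = undefined,
     ring.zero = (\<lambda>_. \<zero>\<^bsub>N\<^esub>), ring.add = (\<lambda>f g n. f n \<oplus>\<^bsub>N\<^esub> g n), smult = (\<lambda>r f n. r \<odot>\<^bsub>N\<^esub> f n)\<rparr>"

lemma const_module_simps [simp]:
  "carrier (const_module N) = (\<lambda>e _. e) ` carrier N" "\<zero>\<^bsub>const_module N\<^esub> = (\<lambda>_. \<zero>\<^bsub>N\<^esub>)"
  "f \<oplus>\<^bsub>const_module N\<^esub> g = (\<lambda>n. f n \<oplus>\<^bsub>N\<^esub> g n)" "r \<odot>\<^bsub>const_module N\<^esub> f = (\<lambda>n. r \<odot>\<^bsub>N\<^esub> f n)"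
  by (simp_all add: const_module_def)

lemma const_eq_iff [simp]: "(\<lambda>_::nat. a) = (\<lambda>_. b) \<longleftrightarrow> a = b"
  by (auto simp: fun_eq_iff)

lemma const_image_iff [simp]: "(\<lambda>_::nat. a) \<in> (\<lambda>e _. e) ` A \<longleftrightarrow> a \<in> A"
  by (auto simp: fun_eq_iff)

lemma const_module_module:
  assumes "module R N"
  shows "module R (const_module N)"
proof -
  interpret N: module R N by fact
  show ?thesis
  proof (rule moduleI[OF N.R.is_cring])
    show "abelian_group (const_module N)"
    proof (rule abelian_groupI)
      show "\<exists>y\<in>carrier (const_module N). y \<oplus>\<^bsub>const_module N\<^esub> x = \<zero>\<^bsub>const_module N\<^esub>"
        if x: "x \<in> carrier (const_module N)" for x
      proof -
        obtain e where e: "e \<in> carrier N" "x = (\<lambda>_. e)" using x by auto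
        then show ?thesis by (intro bexI[of _ "\<lambda>_. \<ominus>\<^bsub>N\<^esub> e"]) (auto simp: N.M.l_neg)
      qed
    qed (auto simp: N.M.a_ac)
  qed (auto simp: N.smult_l_distr N.smult_r_distr N.smult_assoc1)
qed

lemma baer_const_module:
  assumes N: "module R N" and b: "baer R N (carrier N) {\<zero>\<^bsub>N\<^esub>}"
  shows "baer R (const_module N) (carrier (const_module N)) {\<zero>\<^bsub>const_module N\<^esub>}"
  unfolding baer_def
proof (intro allI impI, elim conjE)
  interpret N: module R N by fact
  interpret K: module R "const_module N" by (rule const_module_module[OF N])
  fix G assume G: "linear_relation R (const_module N) G"
    and G0: "\<forall>x. (\<zero>\<^bsub>R\<^esub>, x) \<in> G \<longrightarrow> x \<in> {\<zero>\<^bsub>const_module N\<^esub>}"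
  note g = linear_relationD[OF G]
  have f: "(\<lambda>f. f 0) \<in> mod_hom R (const_module N) N" by (rule mod_homI) auto
  obtain l where l: "l \<in> carrier N"
    "\<And>r x. (r, x) \<in> {(r, f 0) | r f. (r, f) \<in> G} \<Longrightarrow> x \<ominus>\<^bsub>N\<^esub> r \<odot>\<^bsub>N\<^esub> l \<in> {\<zero>\<^bsub>N\<^esub>}"
    by (rule baerD[OF b linear_relation_image[OF K.module_axioms N f G]])
      (use g(2) G0 in force)+
  have "x \<ominus>\<^bsub>const_module N\<^esub> r \<odot>\<^bsub>const_module N\<^esub> (\<lambda>_. l) = \<zero>\<^bsub>const_module N\<^esub>" if rx: "(r, x) \<in> G" for r x
  proof -
    obtain e where e: "e \<in> carrier N" "x = (\<lambda>_. e)" using g(2)[OF rx] by auto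
    have r: "r \<in> carrier R" using g(1)[OF rx] .
    have "e \<ominus>\<^bsub>N\<^esub> r \<odot>\<^bsub>N\<^esub> l = \<zero>\<^bsub>N\<^esub>" using l(2)[of r e] rx e by force
    moreover have "\<ominus>\<^bsub>const_module N\<^esub> (\<lambda>_. r \<odot>\<^bsub>N\<^esub> l) = (\<lambda>_. \<ominus>\<^bsub>N\<^esub> (r \<odot>\<^bsub>N\<^esub> l))"
      by (rule K.M.minus_equality) (use l(1) r in \<open>auto simp: N.M.l_neg\<close>)
    ultimately show ?thesis unfolding e(2) K.M.minus_eq N.M.minus_eq by simp
  qed
  then show "\<exists>l\<in>carrier (const_module N). \<forall>r x. (r, x) \<in> G \<longrightarrow>
      x \<ominus>\<^bsub>const_module N\<^esub> r \<odot>\<^bsub>const_module N\<^esub> l \<in> {\<zero>\<^bsub>const_module N\<^esub>}"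
    using l(1) by (intro bexI[of _ "\<lambda>_. l"]) auto
qed

lemma carrier_torsion_const_module:
  "carrier (torsion R \<aa> (const_module N)) = (\<lambda>e _. e) ` carrier (torsion R \<aa> N)"
proof -
  have "f \<in> carrier (torsion R \<aa> (const_module N)) \<longleftrightarrow> f \<in> (\<lambda>e _. e) ` carrier (torsion R \<aa> N)" for f
    unfolding torsion_def by (auto simp: image_iff) metis+
  then show ?thesis by blast
qed

lemma submodule_restrict:
  assumes M: "module R M" and B: "submodule B R M" and K: "submodule K R M" and BK: "B \<subseteq> K"
  shows "submodule B R (M\<lparr>carrier := K\<rparr>)"
proof -
  interpret M: module R M by fact
  interpret K: module R "M\<lparr>carrier := K\<rparr>" by (rule submodule.submodule_is_module[OF K M])
  show ?thesis
    by (rule K.submodule_intro)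
      (use BK M.submodule_zero[OF B] M.submodule_add[OF B] M.submodule_smult[OF B] in auto)
qed

text \<open>
  The resolution as a complex indexed by integers, zero in negative degrees, with elements as
  constant sequences: the type on which cones can be iterated.
\<close>
definition padded :: "(nat \<Rightarrow> ('a, 'e, 'n) module_scheme) \<Rightarrow> int \<Rightarrow> ('a, nat \<Rightarrow> 'e) module"
  where "padded E i = const_module (if i < 0 then (E 0)\<lparr>carrier := {\<zero>\<^bsub>E 0\<^esub>}\<rparr> else E (nat i))"

definition padded_diff ::
    "(nat \<Rightarrow> ('a, 'e, 'n) module_scheme) \<Rightarrow> (nat \<Rightarrow> 'e \<Rightarrow> 'e) \<Rightarrow> int \<Rightarrow> (nat \<Rightarrow> 'e) \<Rightarrow> nat \<Rightarrow> 'e"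
  where "padded_diff E d i f = (\<lambda>n. if i < 0 then \<zero>\<^bsub>E 0\<^esub> else d (nat i) (f n))"

locale noetherian_injective_resolution =
  fixes R :: "('a, 'r) ring_scheme"
    and M :: "('a, 'b, 'm) module_scheme"
    and E :: "nat \<Rightarrow> ('a, 'e, 'n) module_scheme"
    and \<epsilon> :: "'b \<Rightarrow> 'e" and d :: "nat \<Rightarrow> 'e \<Rightarrow> 'e" and \<aa> :: "'a set"
  assumes cring_R: "cring R" and noeth: "noetherian_ring R" and ideal_a: "ideal \<aa> R"
    and res: "injective_resolution R M \<epsilon> E d"
begin

interpretation R: cring R by (rule cring_R)

lemma module_E: "module R (E i)"
  using res by (simp add: injective_resolution_def injective_module_def)

lemma module_M: "module R M"
  using res by (simp add: injective_resolution_def)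

lemma d_hom: "d i \<in> mod_hom R (E i) (E (Suc i))"
  using res by (simp add: injective_resolution_def)

lemma exact_E: "d i ` carrier (E i) = {x \<in> carrier (E (Suc i)). d (Suc i) x = \<zero>\<^bsub>E (Suc (Suc i))\<^esub>}"
  using res by (simp add: injective_resolution_def a_kernel_def')

lemma d_d: "x \<in> carrier (E i) \<Longrightarrow> d (Suc i) (d i x) = \<zero>\<^bsub>E (Suc (Suc i))\<^esub>"
  using exact_E[of i] by blast

lemma padded_int: "padded E (int i) = const_module (E i)" "padded E (int i + 1) = const_module (E (Suc i))"
  by (simp_all add: padded_def nat_add_distrib)

lemma padded_diff_int: "padded_diff E d (int i) f = (\<lambda>n. d i (f n))"
  by (simp add: padded_diff_def)

lemma padded_neg: "i < 0 \<Longrightarrow> padded E i = const_module ((E 0)\<lparr>carrier := {\<zero>\<^bsub>E 0\<^esub>}\<rparr>)"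
  by (simp add: padded_def)

lemma int_nat_or_negative: obtains k where "i = int k" | "(i::int) < 0"
  using zero_le_imp_eq_int[of i] by (cases "i < 0") auto

lemma module_zero: "module R ((E 0)\<lparr>carrier := {\<zero>\<^bsub>E 0\<^esub>}\<rparr>)"
  using submodule.submodule_is_module[OF module.submodule_zero_set[OF module_E] module_E] .

lemma module_padded: "module R (padded E i)"
  unfolding padded_def by (intro const_module_module) (use module_E module_zero in auto)

lemma padded_zero: "i < 0 \<Longrightarrow> \<zero>\<^bsub>padded E (i + 1)\<^esub> = (\<lambda>_. \<zero>\<^bsub>E 0\<^esub>)"
  by (cases "i + 1 < 0") (auto simp: padded_def)

lemma padded_complex: "cochain_complex R (padded E) (padded_diff E d)"
proof (rule cochain_complex.intro)
  fix i
  show "module R (padded E i)" by (rule module_padded)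
  interpret B1: module R "padded E (i + 1)" by (rule module_padded)
  show hom: "padded_diff E d i \<in> mod_hom R (padded E i) (padded E (i + 1))"
  proof (cases i rule: int_nat_or_negative)
    case (1 k)
    show ?thesis unfolding 1
      by (rule mod_homI) (auto simp: padded_int padded_diff_int mod_homD[OF d_hom])
  next
    case 2
    have c: "padded_diff E d i = (\<lambda>_. \<zero>\<^bsub>padded E (i + 1)\<^esub>)"
      using 2 padded_zero[OF 2] by (auto simp: padded_diff_def fun_eq_iff)
    show ?thesis unfolding c by (rule mod_homI) (auto simp del: const_module_simps)
  qed
  fix u assume u: "u \<in> carrier (padded E i)"
  show "padded_diff E d (i + 1) (padded_diff E d i u) = \<zero>\<^bsub>padded E (i + 1 + 1)\<^esub>"
  proof (cases i rule: int_nat_or_negative)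
    case (1 k)
    obtain e where "e \<in> carrier (E k)" "u = (\<lambda>_. e)" using u unfolding 1 padded_int by auto
    then show ?thesis
      using d_d[of e k] padded_diff_int[of "Suc k"] padded_int(2)[of "Suc k"] unfolding 1
      by (simp add: padded_diff_int add.commute)
  next
    case 2
    show ?thesis
    proof (cases "i + 1 < 0")
      case True
      then show ?thesis using padded_zero[OF True] by (simp add: padded_diff_def)
    next
      case False
      then have "i = - 1" using 2 by simp
      then show ?thesis
        using mod_hom_zero[OF module_E module_E d_hom, of 0] by (simp add: padded_diff_def padded_def)
    qed
  qed
qed

interpretation padded: cochain_complex R "padded E" "padded_diff E d" by (rule padded_complex)

lemma padded_torsion_resolution:
  "torsion_resolution R (padded E) (padded_diff E d) \<aa> M (\<lambda>m _. \<epsilon> m) {\<zero>\<^bsub>M\<^esub>}"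
proof (intro torsion_resolution.intro torsion_resolution_axioms.intro)
  show "cochain_complex R (padded E) (padded_diff E d)" by (rule padded_complex)
  show "noetherian_ring R" "ideal \<aa> R" "module R M" by (fact noeth ideal_a module_M)+
  interpret M: module R M by (rule module_M)
  note ac = R.ideal_closed(1)[OF ideal_a]
  have eps: "\<epsilon> \<in> mod_hom R M (E 0)" "inj_on \<epsilon> (carrier M)"
    "\<epsilon> ` carrier M = {x \<in> carrier (E 0). d 0 x = \<zero>\<^bsub>E (Suc 0)\<^esub>}"
    using res by (simp_all add: injective_resolution_def a_kernel_def')
  have carr_neg: "carrier (padded E i) = {\<zero>\<^bsub>padded E i\<^esub>}" if "i < 0" for i
    using that by (simp add: padded_neg)
  then show "\<exists>k. \<forall>i<k. carrier (padded E i) = {\<zero>\<^bsub>padded E i\<^esub>}" by blast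
  show "baer R (padded E i) (carrier (padded E i)) (tors R \<aa> (padded E i))" for i
  proof -
    interpret B: module R "padded E i" by (rule module_padded)
    have "baer R (padded E i) (carrier (padded E i)) {\<zero>\<^bsub>padded E i\<^esub>}"
    proof (cases i rule: int_nat_or_negative)
      case (1 k)
      have "injective_module R (E k)" using res by (simp add: injective_resolution_def)
      then show ?thesis
        unfolding 1 padded_int by (rule baer_const_module[OF module_E injective_imp_baer[OF cring_R]])
    next
      case 2
      have "x \<ominus>\<^bsub>padded E i\<^esub> r \<odot>\<^bsub>padded E i\<^esub> \<zero>\<^bsub>padded E i\<^esub> \<in> {\<zero>\<^bsub>padded E i\<^esub>}"
        if "linear_relation R (padded E i) G" "(r, x) \<in> G" for G r x
      proof -
        have "x \<ominus>\<^bsub>padded E i\<^esub> r \<odot>\<^bsub>padded E i\<^esub> \<zero>\<^bsub>padded E i\<^esub> \<in> carrier (padded E i)"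
          by (intro B.M.minus_closed B.smult_closed B.M.zero_closed linear_relationD(1,2)[OF that])
        then show ?thesis unfolding carr_neg[OF 2] .
      qed
      then show ?thesis unfolding baer_def using B.M.zero_closed by blast
    qed
    then show ?thesis by (rule B.baer_mod_torsion[OF noeth ac])
  qed
  show "cycles (padded E) (padded_diff E d) i \<subseteq> tors_mod R \<aa> (padded E i) (boundaries (padded E) (padded_diff E d) i)"
    if i: "i < 0" for i
  proof -
    interpret B: module R "padded E i" by (rule module_padded)
    have "cycles (padded E) (padded_diff E d) i \<subseteq> {\<zero>\<^bsub>padded E i\<^esub>}"
      using carr_neg[OF i] by (auto simp: cycles_def)
    also have "\<dots> \<subseteq> boundaries (padded E) (padded_diff E d) i"
      using B.submodule_zero[OF padded.boundaries_submodule] by simp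
    also have "\<dots> \<subseteq> tors_mod R \<aa> (padded E i) (boundaries (padded E) (padded_diff E d) i)"
      by (rule B.tors_mod_upper[OF padded.boundaries_submodule ac])
    finally show ?thesis .
  qed
  show "cycles (padded E) (padded_diff E d) i \<subseteq> boundaries (padded E) (padded_diff E d) i" if i: "i > 0" for i
  proof
    obtain k where k: "i = int k + 1" using i zero_less_imp_eq_int[OF i] by (metis Suc_pred of_nat_Suc add.commute)
    fix f assume f: "f \<in> cycles (padded E) (padded_diff E d) i"
    have ik: "i = int (Suc k)" using k by simp
    obtain e where e: "e \<in> carrier (E (Suc k))" "f = (\<lambda>_. e)" "d (Suc k) e = \<zero>\<^bsub>E (Suc (Suc k))\<^esub>"
      using f unfolding ik cycles_def padded_int padded_diff_int by auto
    then obtain e' where e': "e' \<in> carrier (E k)" "e = d k e'" using exact_E[of k] by blast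
    have "f = padded_diff E d (int k) (\<lambda>_. e')" using e(2) e'(2) by (simp add: padded_diff_int)
    then show "f \<in> boundaries (padded E) (padded_diff E d) i"
      unfolding k padded.boundaries_succ padded_int using e'(1) by auto
  qed
  show "submodule {\<zero>\<^bsub>M\<^esub>} R M" by (rule M.submodule_zero_set)
  have b0: "padded E 0 = const_module (E 0)" "padded E 1 = const_module (E (Suc 0))"
    using padded_int[of 0] by simp_all
  show "(\<lambda>m _. \<epsilon> m) \<in> mod_hom R M (padded E 0)"
    unfolding b0 using mod_homD[OF eps(1)] by (intro mod_homI) auto
  have cyc0: "cycles (padded E) (padded_diff E d) 0 = (\<lambda>e _. e) ` \<epsilon> ` carrier M"
    unfolding eps(3) by (auto simp: cycles_def b0 padded_diff_def)
  then show "(\<lambda>_. \<epsilon> m) \<in> cycles (padded E) (padded_diff E d) 0" if "m \<in> carrier M" for m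
    using that by auto
  interpret B0: module R "padded E 0" by (rule module_padded)
  interpret E0: module R "E 0" by (rule module_E)
  show "\<exists>m\<in>carrier M. z \<ominus>\<^bsub>padded E 0\<^esub> (\<lambda>_. \<epsilon> m) \<in> boundaries (padded E) (padded_diff E d) 0"
    if z: "z \<in> cycles (padded E) (padded_diff E d) 0" for z
  proof -
    obtain m where m: "m \<in> carrier M" "z = (\<lambda>_. \<epsilon> m)" using z unfolding cyc0 by auto
    have "z \<in> carrier (padded E 0)" using z by (simp add: cycles_def)
    then have "z \<ominus>\<^bsub>padded E 0\<^esub> (\<lambda>_. \<epsilon> m) = \<zero>\<^bsub>padded E 0\<^esub>" unfolding m(2) by (simp add: B0.M.minus_eq B0.M.r_neg)
    then have "z \<ominus>\<^bsub>padded E 0\<^esub> (\<lambda>_. \<epsilon> m) \<in> boundaries (padded E) (padded_diff E d) 0"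
      using B0.submodule_zero[OF padded.boundaries_submodule[of 0]] by (simp only:)
    then show ?thesis using m(1) by (rule bexI)
  qed
  have bd0: "boundaries (padded E) (padded_diff E d) 0 = {\<lambda>_. \<zero>\<^bsub>E 0\<^esub>}"
    by (simp add: boundaries_def padded_neg padded_diff_def)
  show "(\<lambda>_. \<epsilon> m) \<in> boundaries (padded E) (padded_diff E d) 0 \<longleftrightarrow> m \<in> {\<zero>\<^bsub>M\<^esub>}" if m: "m \<in> carrier M" for m
    using mod_hom_zero[OF module_M module_E eps(1)] inj_onD[OF eps(2), of m "\<zero>\<^bsub>M\<^esub>"] m
    unfolding bd0 by auto
qed

abbreviation "Z i \<equiv> a_kernel (torsion R \<aa> (E i)) (torsion R \<aa> (E (Suc i))) (d i)"

abbreviation "B i \<equiv> (case i of 0 \<Rightarrow> {\<zero>\<^bsub>torsion R \<aa> (E 0)\<^esub>} | Suc k \<Rightarrow> d k ` carrier (torsion R \<aa> (E k)))"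

lemma torsion_carrier: "carrier (torsion R \<aa> (E i)) = tors R \<aa> (E i)"
  by (rule module.carrier_torsion[OF module_E noeth ideal_a])

lemma torsion_eq: "torsion R \<aa> (E i) = E i\<lparr>carrier := tors R \<aa> (E i)\<rparr>"
  using torsion_carrier[of i] by (simp add: torsion_def)

lemma module_torsion: "module R (torsion R \<aa> (E i))"
  unfolding torsion_eq using module_E R.ideal_closed(1)[OF ideal_a]
  by (intro submodule.submodule_is_module module.tors_mod_submodule module.submodule_zero_set)

lemma d_torsion_hom: "d i \<in> mod_hom R (torsion R \<aa> (E i)) (torsion R \<aa> (E (Suc i)))"
proof (rule mod_homI)
  note h = mod_homD[OF d_hom[of i]]
  have c: "x \<in> carrier (E i)" if "x \<in> carrier (torsion R \<aa> (E i))" for x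
    using that by (simp add: torsion_def)
  show "d i x \<in> carrier (torsion R \<aa> (E (Suc i)))" if x: "x \<in> carrier (torsion R \<aa> (E i))" for x
  proof -
    from x obtain n where n: "\<forall>r\<in>ideal_pow R \<aa> n. r \<odot>\<^bsub>E i\<^esub> x = \<zero>\<^bsub>E i\<^esub>" by (auto simp: torsion_def)
    have "r \<odot>\<^bsub>E (Suc i)\<^esub> d i x = \<zero>\<^bsub>E (Suc i)\<^esub>" if r: "r \<in> ideal_pow R \<aa> n" for r
      using h(3)[OF _ c[OF x], of r] n r R.ideal_closed(1)[OF R.ideal_pow_ideal[OF ideal_a]]
        mod_hom_zero[OF module_E module_E d_hom] by (metis subsetD)
    then show ?thesis using h(1)[OF c[OF x]] by (auto simp: torsion_def)
  qed
qed (use mod_homD[OF d_hom[of i]] in \<open>simp_all add: torsion_def\<close>)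

lemma Z_submodule: "submodule (Z i) R (torsion R \<aa> (E i))"
  by (rule mod_hom_kernel[OF module_torsion module_torsion d_torsion_hom])

lemma B_submodule: "submodule (B i) R (torsion R \<aa> (E i)\<lparr>carrier := Z i\<rparr>)"
proof (rule submodule_restrict[OF module_torsion _ Z_submodule])
  show "submodule (B i) R (torsion R \<aa> (E i))"
    using module.submodule_zero_set[OF module_torsion] mod_hom_image[OF module_torsion module_torsion d_torsion_hom]
    by (cases i) auto
  show "B i \<subseteq> Z i"
  proof (cases i)
    case 0
    then show ?thesis using module.submodule_zero[OF module_torsion Z_submodule, of 0] by simp
  next
    case (Suc k)
    have "d (Suc k) (d k x) = \<zero>\<^bsub>E (Suc (Suc k))\<^esub>" if "x \<in> carrier (torsion R \<aa> (E k))" for x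
      using d_d that by (simp add: torsion_def)
    moreover have "\<zero>\<^bsub>torsion R \<aa> (E (Suc (Suc k)))\<^esub> = \<zero>\<^bsub>E (Suc (Suc k))\<^esub>" by (simp add: torsion_def)
    ultimately show ?thesis using mod_homD(1)[OF d_torsion_hom] unfolding Suc a_kernel_def' by auto
  qed
qed

lemma local_cohomology_eq: "local_cohomology R \<aa> E d i = quot_module (torsion R \<aa> (E i)\<lparr>carrier := Z i\<rparr>) (B i)"
  unfolding local_cohomology_def cohomology_def by (rule refl)

lemma module_Z: "module R (torsion R \<aa> (E i)\<lparr>carrier := Z i\<rparr>)"
  by (rule submodule.submodule_is_module[OF Z_submodule module_torsion])

lemma padded_cycles: "cycles (\<lambda>i. torsion R \<aa> (padded E i)) (padded_diff E d) (int i) = (\<lambda>e _. e) ` Z i"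
proof -
  have z: "\<zero>\<^bsub>torsion R \<aa> (padded E (int i + 1))\<^esub> = (\<lambda>_. \<zero>\<^bsub>E (Suc i)\<^esub>)"
    "\<zero>\<^bsub>torsion R \<aa> (const_module (E (Suc i)))\<^esub> = (\<lambda>_. \<zero>\<^bsub>E (Suc i)\<^esub>)"
    "\<zero>\<^bsub>torsion R \<aa> (E (Suc i))\<^esub> = \<zero>\<^bsub>E (Suc i)\<^esub>"
    by (simp_all add: torsion_def padded_int)
  show ?thesis
    unfolding cycles_def a_kernel_def' padded_int carrier_torsion_const_module padded_diff_int z by auto
qed

lemma padded_boundaries: "boundaries (\<lambda>i. torsion R \<aa> (padded E i)) (padded_diff E d) (int i) = (\<lambda>e _. e) ` B i"
proof (cases i)
  case 0
  interpret N: module R "padded E (- 1)" by (rule module_padded)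
  have "\<zero>\<^bsub>padded E (- 1)\<^esub> \<in> carrier (torsion R \<aa> (padded E (- 1)))"
    unfolding module.carrier_torsion[OF module_padded noeth ideal_a]
    using N.submodule_zero[OF N.tors_mod_submodule[OF R.ideal_closed(1)[OF ideal_a] N.submodule_zero_set]] .
  then have "carrier (torsion R \<aa> (padded E (- 1))) \<noteq> {}" by blast
  then show ?thesis unfolding 0 boundaries_def by (auto simp: padded_diff_def torsion_def)
next
  case (Suc k)
  then show ?thesis
    by (auto simp: boundaries_def padded_int padded_diff_int carrier_torsion_const_module image_iff)
qed

lemma coh_Ass_padded:
  "coh_Ass R (\<lambda>i. torsion R \<aa> (padded E i)) (padded_diff E d) (int i) = Ass R (local_cohomology R \<aa> E d i)"
proof -
  interpret N: module R "torsion R \<aa> (E i)\<lparr>carrier := Z i\<rparr>" by (rule module_Z)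
  have "colon R (torsion R \<aa> (padded E (int i))) ((\<lambda>e _. e) ` B i) (\<lambda>_. z) =
      colon R (torsion R \<aa> (E i)\<lparr>carrier := Z i\<rparr>) (B i) z" for z
    unfolding colon_def by (simp add: torsion_def padded_int)
  then show ?thesis
    unfolding local_cohomology_eq N.Ass_quot_module[OF B_submodule]
    unfolding coh_Ass_def subquot_Ass_def padded_cycles padded_boundaries by auto
qed

lemma kills_padded:
  assumes "I \<subseteq> carrier R"
    and "ideal_smult R I (local_cohomology R \<aa> E d i) = {\<zero>\<^bsub>local_cohomology R \<aa> E d i\<^esub>}"
  shows "kills_cohomology I (\<lambda>i. torsion R \<aa> (padded E i)) (padded_diff E d) (int i)"
proof -
  interpret N: module R "torsion R \<aa> (E i)\<lparr>carrier := Z i\<rparr>" by (rule module_Z)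
  have "r \<odot>\<^bsub>E i\<^esub> z \<in> B i" if "r \<in> I" "z \<in> Z i" for r z
    using N.quot_module_killed[OF B_submodule assms(1) assms(2)[unfolded local_cohomology_eq] that(1), of z] that(2)
    by (simp add: torsion_def)
  then show ?thesis
    unfolding kills_cohomology_def padded_cycles padded_boundaries by (auto simp: torsion_def padded_int)
qed

lemma Ass_local_cohomology_V: "Ass R (local_cohomology R \<aa> E d i) \<subseteq> V R \<aa>"
proof
  interpret N: module R "torsion R \<aa> (E i)\<lparr>carrier := Z i\<rparr>" by (rule module_Z)
  fix p assume "p \<in> Ass R (local_cohomology R \<aa> E d i)"
  then obtain z where pr: "primeideal p R" and z: "z \<in> Z i"
    and pz: "p = colon R (torsion R \<aa> (E i)\<lparr>carrier := Z i\<rparr>) (B i) z"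
    unfolding local_cohomology_eq N.Ass_quot_module[OF B_submodule] subquot_Ass_def by auto
  obtain n where n: "\<forall>r\<in>ideal_pow R \<aa> n. r \<odot>\<^bsub>E i\<^esub> z = \<zero>\<^bsub>E i\<^esub>"
    using z by (auto simp: a_kernel_def' torsion_def)
  have "\<zero>\<^bsub>E i\<^esub> \<in> B i" using N.submodule_zero[OF B_submodule] by (simp add: torsion_def)
  then have "ideal_pow R \<aa> n \<subseteq> p"
    using n R.ideal_closed(1)[OF R.ideal_pow_ideal[OF ideal_a]] unfolding pz colon_def by (auto simp: torsion_def)
  then show "p \<in> V R \<aa>" using R.prime_contains_ideal_pow[OF ideal_a pr] pr by (simp add: V_def)
qed

end

section \<open>Iterated cones\<close>

lemma (in module) filter_regular_quot_by_seq:
  assumes noeth: "noetherian_ring R" and a: "ideal \<aa> R" and xs: "set xs \<subseteq> carrier R"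
    and reg: "filter_regular R \<aa> (quot_by_seq R M xs) x"
    and m: "m \<in> carrier M" "x \<odot>\<^bsub>M\<^esub> m \<in> ideal_smult R (genideal R (set xs)) M"
  shows "m \<in> tors_mod R \<aa> M (ideal_smult R (genideal R (set xs)) M)"
proof -
  have L: "submodule (ideal_smult R (genideal R (set xs)) M) R M"
    using ideal_smult_submodule R.ideal_closed(1)[OF R.genideal_ideal[OF xs]] .
  have x: "x \<in> carrier R" using reg R.ideal_closed(1)[OF a] by (auto simp: filter_regular_def)
  show ?thesis
    by (rule filter_regular_annihilator_torsion[OF noeth a L x _ m])
      (use reg in \<open>auto simp: filter_regular_def quot_by_seq_def Ass_quot_module[OF L]\<close>)
qed

text \<open>
  The hypothesis on \<open>J\<close> says that \<open>\<aa>\<close> and \<open>J\<close> have the same radical, so \<open>J\<close> lies in none of the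
  finitely many primes that the next element has to avoid.
\<close>
lemma exists_filter_regular_seq:
  assumes "noetherian_ring R" and fg: "fin_gen_module R M" and a: "ideal \<aa> R"
    and J: "ideal J R" "J \<subseteq> \<aa>" "\<And>p. primeideal p R \<Longrightarrow> J \<subseteq> p \<Longrightarrow> \<aa> \<subseteq> p"
  shows "\<exists>xs. length xs = n \<and> set xs \<subseteq> J \<and> filter_regular_seq R \<aa> M xs"
proof (induction n)
  case 0
  then show ?case by (auto simp: filter_regular_seq_def)
next
  case (Suc n)
  then obtain xs where xs: "length xs = n" "set xs \<subseteq> J" "filter_regular_seq R \<aa> M xs" by blast
  from fg have "module R M" by (simp add: fin_gen_module_def)
  then interpret module R M .
  have xsc: "set xs \<subseteq> carrier R" using xs(2) R.ideal_closed(1)[OF J(1)] by blast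
  have L: "submodule (ideal_smult R (genideal R (set xs)) M) R M"
    using ideal_smult_submodule R.ideal_closed(1)[OF R.genideal_ideal[OF xsc]] .
  let ?F = "Ass R (quot_by_seq R M xs) - V R \<aa>"
  have fin: "finite ?F"
    unfolding quot_by_seq_def Ass_quot_module[OF L] using finite_Ass_fin_gen[OF assms(1) fg L] by blast
  have "\<exists>x\<in>J. \<forall>p\<in>?F. x \<notin> p"
  proof (rule R.prime_avoidance[OF J(1) fin])
    show "primeideal p R" if "p \<in> ?F" for p using that by (auto simp: Ass_def)
    show "\<not> J \<subseteq> p" if "p \<in> ?F" for p using that J(3)[of p] by (auto simp: Ass_def V_def)
  qed
  then obtain x where x: "x \<in> J" "\<forall>p\<in>?F. x \<notin> p" by blast
  then have "filter_regular R \<aa> (quot_by_seq R M xs) x" using J(2) by (auto simp: filter_regular_def)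
  then have "filter_regular_seq R \<aa> M (xs @ [x])"
    using xs(1,3) unfolding filter_regular_seq_def by (auto simp: nth_append less_Suc_eq)
  then show ?case using xs x by (intro exI[of _ "xs @ [x]"]) auto
qed

context noetherian_injective_resolution
begin

interpretation R: cring R by (rule cring_R)

text \<open>
  At step \<open>j\<close> the hypothesis on \<open>I\<close> is available in degrees below \<open>t - j\<close>, so the formula for the
  associated primes persists up to degree \<open>t - j\<close>; degree \<open>0\<close> is still covered at \<open>j = t\<close>.
\<close>
lemma iterated_cone:
  assumes I: "ideal I R" "I \<subseteq> \<aa>" and t: "length xs \<le> t"
    and kills: "\<forall>i<t. kills_cohomology I (\<lambda>i. torsion R \<aa> (padded E i)) (padded_diff E d) (int i)"
    and xs: "set xs \<subseteq> ideal_prod R I I" "filter_regular_seq R \<aa> M xs"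
    and j: "j \<le> length xs"
  shows "\<exists>(C :: int \<Rightarrow> ('a, nat \<Rightarrow> 'e) module) D \<eta>.
    torsion_resolution R C D \<aa> M \<eta> (ideal_smult R (genideal R (set (take j xs))) M) \<and>
    (\<forall>i. i + j < t \<longrightarrow> kills_cohomology I (\<lambda>i. torsion R \<aa> (C i)) D (int i)) \<and>
    (\<forall>i. i + j \<le> t \<longrightarrow> {p \<in> coh_Ass R (\<lambda>i. torsion R \<aa> (C i)) D (int i). I \<subseteq> p} =
      {p \<in> (\<Union>k\<in>{i..i + j}. Ass R (local_cohomology R \<aa> E d k)). I \<subseteq> p})"
  using j
proof (induction j)
  case 0
  interpret M: module R M by (rule module_M)
  have "torsion_resolution R (padded E) (padded_diff E d) \<aa> M (\<lambda>m _. \<epsilon> m)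
      (ideal_smult R (genideal R (set (take 0 xs))) M)"
    using padded_torsion_resolution by (simp add: M.ideal_smult_genideal_empty)
  then show ?case using kills coh_Ass_padded by (intro exI[of _ "padded E"] exI[of _ "padded_diff E d"]) auto
next
  case (Suc j)
  from Suc.IH[OF Suc_leD[OF Suc.prems]] obtain C :: "int \<Rightarrow> ('a, nat \<Rightarrow> 'e) module" and D \<eta> where
    IH: "torsion_resolution R C D \<aa> M \<eta> (ideal_smult R (genideal R (set (take j xs))) M) \<and>
    (\<forall>i. i + j < t \<longrightarrow> kills_cohomology I (\<lambda>i. torsion R \<aa> (C i)) D (int i)) \<and>
    (\<forall>i. i + j \<le> t \<longrightarrow> {p \<in> coh_Ass R (\<lambda>i. torsion R \<aa> (C i)) D (int i). I \<subseteq> p} =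
      {p \<in> (\<Union>k\<in>{i..i + j}. Ass R (local_cohomology R \<aa> E d k)). I \<subseteq> p})"
    by (elim exE)
  note tr = IH[THEN conjunct1]
  note kj = IH[THEN conjunct2, THEN conjunct1, THEN spec, THEN mp]
  note Aj = IH[THEN conjunct2, THEN conjunct2, THEN spec, THEN mp]
  interpret M: module R M by (rule module_M)
  have jl: "j < length xs" using Suc.prems by simp
  define x where "x = xs ! j"
  have xII: "x \<in> ideal_prod R I I" using xs(1) jl by (auto simp: x_def)
  have xI: "x \<in> I" using xII R.ideal_prod_inter[OF I(1) I(1)] by blast
  have xc: "x \<in> carrier R" using xI R.ideal_closed(1)[OF I(1)] by blast
  have sc: "set (take j xs) \<subseteq> carrier R"
    using set_take_subset[of j xs] xs(1) R.ideal_prod_in_carrier[OF I(1) I(1)] by blast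
  have reg: "filter_regular R \<aa> (quot_by_seq R M (take j xs)) x"
    using xs(2) jl by (simp add: filter_regular_seq_def x_def)
  have "set (take (Suc j) xs) = insert x (set (take j xs))"
    using jl by (simp add: take_Suc_conv_app_nth x_def)
  then have L: "ideal_smult R (genideal R (set (take (Suc j) xs))) M =
    {l \<oplus>\<^bsub>M\<^esub> x \<odot>\<^bsub>M\<^esub> m | l m. l \<in> ideal_smult R (genideal R (set (take j xs))) M \<and> m \<in> carrier M}"
    using M.ideal_smult_genideal_insert[OF sc xc] by simp
  let ?T = "\<lambda>i. torsion R \<aa> (C i)"
  let ?C = "cone C" and ?D = "cone_diff R C D x"
  have tr': "torsion_resolution R ?C ?D \<aa> M (\<lambda>m. interleave (\<eta> m) \<zero>\<^bsub>C 1\<^esub>)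
      (ideal_smult R (genideal R (set (take (Suc j) xs))) M)"
    unfolding L
    by (rule torsion_resolution_cone[OF tr _ M.filter_regular_quot_by_seq[OF noeth ideal_a sc reg]])
      (use xI I(2) in blast)
  have Teq: "(\<lambda>i. torsion R \<aa> (?C i)) = cone ?T" using torsion_cone[OF tr] by blast
  have Deq: "?D = cone_diff R ?T D x" by (rule cone_diff_torsion[symmetric])
  interpret T: cone_complex R ?T D x
    using torsion_resolution.torsion_is_complex[OF tr] xc by (simp add: cone_complex_def cone_complex_axioms_def)
  have "kills_cohomology I (\<lambda>i. torsion R \<aa> (?C i)) ?D (int i)" if "i + Suc j < t" for i
    unfolding Teq Deq using T.kills_cohomology_cone[OF I(1) xII kj[of i]] kj[of "Suc i"] that
    by (simp add: add.commute)
  moreover have "{p \<in> coh_Ass R (\<lambda>i. torsion R \<aa> (?C i)) ?D (int i). I \<subseteq> p} =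
      {p \<in> (\<Union>k\<in>{i..i + Suc j}. Ass R (local_cohomology R \<aa> E d k)). I \<subseteq> p}" if i: "i + Suc j \<le> t" for i
  proof -
    have "{p \<in> coh_Ass R (\<lambda>i. torsion R \<aa> (?C i)) ?D (int i). I \<subseteq> p} =
        {p \<in> coh_Ass R ?T D (int i) \<union> coh_Ass R ?T D (int i + 1). I \<subseteq> p}"
      unfolding Teq Deq using T.coh_Ass_cone[OF I(1) xII kj[of i]] i by simp
    also have "\<dots> = {p \<in> coh_Ass R ?T D (int i). I \<subseteq> p} \<union> {p \<in> coh_Ass R ?T D (int (Suc i)). I \<subseteq> p}"
      by (auto simp: add.commute)
    also have "\<dots> = {p \<in> (\<Union>k\<in>{i..i + j} \<union> {Suc i..Suc i + j}. Ass R (local_cohomology R \<aa> E d k)). I \<subseteq> p}"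
      using Aj[of i] Aj[of "Suc i"] i by auto
    also have "{i..i + j} \<union> {Suc i..Suc i + j} = {i..i + Suc j}" by auto
    finally show ?thesis .
  qed
  ultimately show ?case
    using tr' by (intro exI[of _ ?C] exI[of _ ?D] exI[of _ "\<lambda>m. interleave (\<eta> m) \<zero>\<^bsub>C 1\<^esub>"] conjI allI impI)
qed

lemma Ass_quot_by_seq:
  assumes I: "ideal I R" "I \<subseteq> \<aa>" and t: "length xs \<le> t"
    and kills: "\<And>i. i < t \<Longrightarrow> ideal_smult R I (local_cohomology R \<aa> E d i) = {\<zero>\<^bsub>local_cohomology R \<aa> E d i\<^esub>}"
    and xs: "set xs \<subseteq> ideal_prod R I I" "filter_regular_seq R \<aa> M xs"
    and j: "j \<le> length xs"
  shows "(\<Union>i\<in>{0..j}. Ass R (local_cohomology R \<aa> E d i)) = Ass R (quot_by_seq R M (take j xs)) \<inter> V R \<aa>"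
proof -
  interpret M: module R M by (rule module_M)
  let ?L = "ideal_smult R (genideal R (set (take j xs))) M"
  have "set (take j xs) \<subseteq> carrier R"
    using set_take_subset[of j xs] xs(1) R.ideal_prod_in_carrier[OF I(1) I(1)] by blast
  then have L: "submodule ?L R M"
    using M.ideal_smult_submodule R.ideal_closed(1)[OF R.genideal_ideal] by blast
  have "\<forall>i<t. kills_cohomology I (\<lambda>i. torsion R \<aa> (padded E i)) (padded_diff E d) (int i)"
    using kills_padded[OF R.ideal_closed(1)[OF I(1)] kills] by blast
  from iterated_cone[OF I t this xs j]
  obtain C :: "int \<Rightarrow> ('a, nat \<Rightarrow> 'e) module" and D \<eta> where
    it: "torsion_resolution R C D \<aa> M \<eta> ?L \<and>
    (\<forall>i. i + j < t \<longrightarrow> kills_cohomology I (\<lambda>i. torsion R \<aa> (C i)) D (int i)) \<and>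
    (\<forall>i. i + j \<le> t \<longrightarrow> {p \<in> coh_Ass R (\<lambda>i. torsion R \<aa> (C i)) D (int i). I \<subseteq> p} =
      {p \<in> (\<Union>k\<in>{i..i + j}. Ass R (local_cohomology R \<aa> E d k)). I \<subseteq> p})"
    by (elim exE)
  note tr = it[THEN conjunct1]
  note A = it[THEN conjunct2, THEN conjunct2, THEN spec, THEN mp]
  have IV: "I \<subseteq> p" if "p \<in> V R \<aa>" for p using that I(2) by (auto simp: V_def)
  have "{p \<in> subquot_Ass R M (carrier M) ?L \<inter> V R \<aa>. I \<subseteq> p} =
      {p \<in> (\<Union>k\<in>{0..j}. Ass R (local_cohomology R \<aa> E d k)). I \<subseteq> p}"
    using A[of 0] torsion_resolution.coh_Ass_torsion_zero[OF tr] j t by simp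
  then show ?thesis
    unfolding quot_by_seq_def M.Ass_quot_module[OF L] using IV Ass_local_cohomology_V by blast
qed

end

theorem corollary4p4:
  fixes R :: "('a, 'r) ring_scheme"
    and M :: "('a, 'b, 'm) module_scheme"
    and E :: "nat \<Rightarrow> ('a, 'e, 'n) module_scheme"
    and \<epsilon> :: "'b \<Rightarrow> 'e"
    and d :: "nat \<Rightarrow> 'e \<Rightarrow> 'e"
    and \<aa> :: "'a set"
    and t n0 :: nat
  assumes "cring R" and "noetherian_ring R"
    and "fin_gen_module R M"
    and "ideal \<aa> R"
    and "injective_resolution R M \<epsilon> E d"
    and "t > 0" and "n0 > 0"
    and "\<And>i. i < t \<Longrightarrow>
      ideal_smult R (ideal_pow R \<aa> n0) (local_cohomology R \<aa> E d i) =
        {\<zero>\<^bsub>local_cohomology R \<aa> E d i\<^esub>}"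
  shows "(\<forall>xs. length xs = t \<and> set xs \<subseteq> ideal_pow R \<aa> (2 * n0) \<and> filter_regular_seq R \<aa> M xs \<longrightarrow>
           (\<forall>j\<in>{1..t}. (\<Union>i\<in>{0..j}. Ass R (local_cohomology R \<aa> E d i)) =
              Ass R (quot_by_seq R M (take j xs)) \<inter> V R \<aa>))
         \<and> finite (Ass R (local_cohomology R \<aa> E d t))"
proof (intro conjI allI impI ballI; (elim conjE)?)
  interpret R: cring R by fact
  interpret noetherian_injective_resolution R M E \<epsilon> d \<aa> by (rule noetherian_injective_resolution.intro[OF assms(1,2,4,5)])
  interpret M: module R M by (rule module_M)
  let ?I = "ideal_pow R \<aa> n0" and ?J = "ideal_pow R \<aa> (2 * n0)"
  have I: "ideal ?I R" "?I \<subseteq> \<aa>"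
    by (rule R.ideal_pow_ideal[OF assms(4)], rule R.ideal_pow_le[OF assms(4,7)])
  have J: "?J = ideal_prod R ?I ?I" using R.ideal_pow_add[OF assms(4), of n0 n0] by (simp add: mult_2)
  have main: "(\<Union>i\<in>{0..j}. Ass R (local_cohomology R \<aa> E d i)) =
      Ass R (quot_by_seq R M (take j xs)) \<inter> V R \<aa>"
    if "length xs = t" "set xs \<subseteq> ?J" "filter_regular_seq R \<aa> M xs" "j \<le> t" for xs j
    by (rule Ass_quot_by_seq[OF I _ assms(8), where t = t]) (use that in \<open>simp_all add: J\<close>)
  show "(\<Union>i\<in>{0..j}. Ass R (local_cohomology R \<aa> E d i)) =
      Ass R (quot_by_seq R M (take j xs)) \<inter> V R \<aa>"
    if "j \<in> {1..t}" "length xs = t" "set xs \<subseteq> ?J" "filter_regular_seq R \<aa> M xs" for xs j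
    using main[OF that(2-4)] that(1) by simp
  have Ji: "ideal ?J R" by (rule R.ideal_pow_ideal[OF assms(4)])
  have "?J \<subseteq> \<aa>" using R.ideal_pow_le[OF assms(4)] assms(7) by simp
  then have "\<exists>xs. length xs = t \<and> set xs \<subseteq> ?J \<and> filter_regular_seq R \<aa> M xs"
    by (rule exists_filter_regular_seq[OF assms(2-4) Ji]) (rule R.prime_contains_ideal_pow[OF assms(4)])
  then obtain xs where xs: "length xs = t" "set xs \<subseteq> ?J" "filter_regular_seq R \<aa> M xs" by blast
  have "set xs \<subseteq> carrier R" using xs(2) R.ideal_closed(1)[OF Ji] by blast
  then have L: "submodule (ideal_smult R (genideal R (set xs)) M) R M"
    using M.ideal_smult_submodule R.ideal_closed(1)[OF R.genideal_ideal] by blast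
  have "Ass R (local_cohomology R \<aa> E d t) \<subseteq> Ass R (quot_by_seq R M xs)"
    using main[OF xs order_refl] xs(1) by auto
  moreover have "finite (Ass R (quot_by_seq R M xs))"
    unfolding quot_by_seq_def M.Ass_quot_module[OF L] by (rule finite_Ass_fin_gen[OF assms(2,3) L])
  ultimately show "finite (Ass R (local_cohomology R \<aa> E d t))" by (rule finite_subset)
qed

end
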